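(* Let $n>2$, $G=\{1,\dots,n\}$, let $P$ be a set of unordered pairs $\{i,j\}$ with $i\neq j$, $i,j\in\{1,\dots,n\}$, such that $\{1,n\}\notin P$, and let $Q$ be the set of constraints $\sigma_{ij}=1$ for all $\{i,j\}\in P$. Then $V^Q$ has a (non-empty) primitive boundary if and only if the following condition holds: for every $i$ with $1<i<n$ there is a sequence of pairwise distinct elements of $\{1,\dots,n\}$ (a subsequence of a permutation of $1,\dots,n$) that begins with $1$, ends with $n$ and contains $i$, such that no pair of neighbours in the sequence belongs to $P$.
   Context: Let $N\ge n$ and let $V$ be the space of parameters $q=(q_{ij})_{i,j=1,\dots,N}$, $q_{ij}\in\mathbb{C}\setminus\{0\}$. Put $\sigma_{ij}=q_{ij}q_{ji}$ for $i\ne j$. Let $\mathcal{B}_q$ be the free unital associative $\mathbb{C}$-algebra on $e_1,\dots,e_N$ with the linear operators $\partial_1,\dots,\partial_N$ defined by $\partial_i 1=0$ and $\partial_i(e_jx)=\delta_{ij}x+q_{ij}e_j\partial_i x$. A constant is an element without term of order $0$ annihilated by all $\partial_i$. For a finite set $G'\subset\{1,\dots,N\}$, $\mathcal{B}_{G'}$ is the span of the monomials $e_{i_1}\cdots e_{i_k}$ with $(i_1,\dots,i_k)$ running over the orderings of $G'$ (polynomials of degree $G'$, without repetition). Degrees are ordered by inclusion. $S_{G'}$ is the matrix, indexed by orderings of $G'$, with entries $(S_{G'})_{\underline i\,\underline j}=\partial_{i_k}\cdots\partial_{i_1}(e_{j_1}\cdots e_{j_k})$. For a set $Q$ of constraints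 $\sigma_{ij}=1$, $\{i,j\}\in P$, $V^Q\subset V$ is the subset on which they hold. For $q\in V^Q$, $\mathcal{I}(Q)$ is the two-sided ideal generated by the constants $e_ie_j-q_{ji}e_je_i$, $\{i,j\}\in P$; it is stable under all $\partial_i$. Put $\mathcal{B}_{G}(Q)=\mathcal{B}_{G}/(\mathcal{I}(Q)\cap\mathcal{B}_{G})$. A constant in $\mathcal{B}_G(Q)$ is an element annihilated by all the induced operators $\partial_i$. The primitive boundary of $V^Q$ (relative to $G$) is the set of points $q\in V^Q$ at which $\mathcal{B}_G(Q)$ contains a non-zero constant, but at which there is no additional constant of lower degree, i.e. for every proper subset $G'\subsetneq G$ the matrix $S_{G'}(q)$ has the same rank as at points of $V^Q$ in general position (equivalently, every constant of degree $G'\subsetneq G$ lies in $\mathcal{I}(Q)$). *)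

theory Defs
  imports
    "HOL-Algebra.Ideal"
    "HOL-Library.FuncSet"
    "HOL-Library.Poly_Mapping"
    "HOL-Combinatorics.Multiset_Permutations"
    "Jordan_Normal_Form.DL_Rank"
begin

section \<open>The free algebra and its skew derivations\<close>

text \<open>Words form a monoid under concatenation, written additively because \<^typ>\<open>'a \<Rightarrow>\<^sub>0 'b\<close> requires
  an additive monoid of exponents. The monoid algebra of the words in natural numbers is the free
  algebra on generators indexed by the natural numbers; the algebra on \<open>e\<^sub>1, \<dots>, e\<^sub>N\<close> is carved out
  of it by \<open>free_alg\<close> below.\<close>

instantiation list :: (type) monoid_add
begin

definition zero_list :: "'a list" where "zero_list = []"
definition plus_list :: "'a list \<Rightarrow> 'a list \<Rightarrow> 'a list" where "plus_list = (@)"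

instance
  by standard (simp_all add: zero_list_def plus_list_def)

end

type_synonym elt = "nat list \<Rightarrow>\<^sub>0 complex"

type_synonym params = "nat \<Rightarrow> nat \<Rightarrow> complex"

definition mon :: "nat list \<Rightarrow> elt" where
  "mon w = Poly_Mapping.single w 1"

definition scal :: "complex \<Rightarrow> elt" where
  "scal c = Poly_Mapping.single 0 c"

abbreviation gen :: "nat \<Rightarrow> elt" where
  "gen i \<equiv> mon [i]"

definition free_alg :: "nat \<Rightarrow> elt ring" where
  "free_alg N =
    \<lparr>carrier = {x. Poly_Mapping.keys x \<subseteq> lists {1..N}},
     monoid.mult = (*), one = 1, zero = 0, add = (+)\<rparr>"

primrec deriv_word :: "params \<Rightarrow> nat \<Rightarrow> nat list \<Rightarrow> elt" where
  "deriv_word q i [] = 0"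
| "deriv_word q i (j # w) =
     (if i = j then mon w else 0) + scal (q i j) * gen j * deriv_word q i w"

definition deriv :: "params \<Rightarrow> nat \<Rightarrow> elt \<Rightarrow> elt" where
  "deriv q i x =
    (\<Sum>w\<in>Poly_Mapping.keys x. scal (Poly_Mapping.lookup x w) * deriv_word q i w)"

definition homog :: "nat set \<Rightarrow> elt set" where
  "homog G = {x. Poly_Mapping.keys x \<subseteq> permutations_of_set G}"


section \<open>The matrices \<open>S\<close>\<close>

definition orderings :: "nat set \<Rightarrow> nat list list" where
  "orderings G = permutations_of_set_list (sorted_list_of_set G)"

text \<open>The element \<open>\<partial>\<^sub>i\<^sub>k \<dots> \<partial>\<^sub>i\<^sub>1 (e\<^sub>j\<^sub>1 \<dots> e\<^sub>j\<^sub>k)\<close> is a scalar multiple of \<open>1\<close>; the entry is that scalar.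
  Note that \<open>\<partial>\<^sub>i\<^sub>1\<close> acts first.\<close>

definition S_entry :: "params \<Rightarrow> nat list \<Rightarrow> nat list \<Rightarrow> complex" where
  "S_entry q is js = Poly_Mapping.lookup (fold (deriv q) is (mon js)) 0"

definition S_mat :: "params \<Rightarrow> nat set \<Rightarrow> complex mat" where
  "S_mat q G = (let os = orderings G; m = length os
     in mat m m (\<lambda>(a, b). S_entry q (os ! a) (os ! b)))"

definition S_rank :: "params \<Rightarrow> nat set \<Rightarrow> nat" where
  "S_rank q G = vec_space.rank (dim_row (S_mat q G)) (S_mat q G)"


section \<open>Parameter spaces\<close>

definition param_space :: "nat \<Rightarrow> params set" where
  "param_space N = {1..N} \<rightarrow>\<^sub>E {1..N} \<rightarrow>\<^sub>E (- {0})"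

definition sigma :: "params \<Rightarrow> nat \<Rightarrow> nat \<Rightarrow> complex" where
  "sigma q i j = q i j * q j i"

definition constrained_params :: "nat \<Rightarrow> nat set set \<Rightarrow> params set" where
  "constrained_params N P =
    {q \<in> param_space N. \<forall>i j. {i, j} \<in> P \<longrightarrow> sigma q i j = 1}"

inductive_set param_polys :: "nat \<Rightarrow> (params \<Rightarrow> complex) set" for N where
  const: "(\<lambda>q. c) \<in> param_polys N"
| coord: "i \<in> {1..N} \<Longrightarrow> j \<in> {1..N} \<Longrightarrow> (\<lambda>q. q i j) \<in> param_polys N"
| add: "f \<in> param_polys N \<Longrightarrow> g \<in> param_polys N \<Longrightarrow> (\<lambda>q. f q + g q) \<in> param_polys N"
| mult: "f \<in> param_polys N \<Longrightarrow> g \<in> param_polys N \<Longrightarrow> (\<lambda>q. f q * g q) \<in> param_polys N"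

text \<open>A property holds in general position on \<open>W\<close> if it holds on a non-empty principal Zariski-open
  subset. This is the right notion for irreducible \<open>W\<close>, such as the subtori
  \<^term>\<open>constrained_params N P\<close> when all members of \<open>P\<close> have two elements.\<close>

definition in_general_position :: "nat \<Rightarrow> params set \<Rightarrow> (params \<Rightarrow> bool) \<Rightarrow> bool" where
  "in_general_position N W R \<longleftrightarrow>
    (\<exists>f\<in>param_polys N. (\<exists>p\<in>W. f p \<noteq> 0) \<and> (\<forall>p\<in>W. f p \<noteq> 0 \<longrightarrow> R p))"


section \<open>The quotient algebra and the primitive boundary\<close>

definition comm_ideal :: "nat \<Rightarrow> nat set set \<Rightarrow> params \<Rightarrow> elt set" where
  "comm_ideal N P q = Idl\<^bsub>free_alg N\<^esub>
     {gen i * gen j - scal (q j i) * gen j * gen i | i j. {i, j} \<in> P}"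

definition ideal_part :: "nat \<Rightarrow> nat set set \<Rightarrow> params \<Rightarrow> nat set \<Rightarrow> elt set" where
  "ideal_part N P q G = comm_ideal N P q \<inter> homog G"

definition quot_class :: "nat \<Rightarrow> nat set set \<Rightarrow> params \<Rightarrow> nat set \<Rightarrow> elt \<Rightarrow> elt set" where
  "quot_class N P q G x = ideal_part N P q G +>\<^bsub>free_alg N\<^esub> x"

definition quot_homog :: "nat \<Rightarrow> nat set set \<Rightarrow> params \<Rightarrow> nat set \<Rightarrow> elt set set" where
  "quot_homog N P q G = quot_class N P q G ` homog G"

text \<open>The operator induced by \<open>\<partial>\<^sub>i\<close> on the component of degree \<open>G\<close> takes values in the component of
  degree \<^term>\<open>G - {i}\<close>. The classes united here coincide because the ideal is stable under \<open>\<partial>\<^sub>i\<close>.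
  For \<open>i \<notin> G\<close> the operator is zero.\<close>

definition quot_deriv ::
  "nat \<Rightarrow> nat set set \<Rightarrow> params \<Rightarrow> nat set \<Rightarrow> nat \<Rightarrow> elt set \<Rightarrow> elt set" where
  "quot_deriv N P q G i X = (\<Union>x\<in>X. quot_class N P q (G - {i}) (deriv q i x))"

definition quot_constants :: "nat \<Rightarrow> nat set set \<Rightarrow> params \<Rightarrow> nat set \<Rightarrow> elt set set" where
  "quot_constants N P q G =
    {X \<in> quot_homog N P q G. \<forall>i\<in>{1..N}. quot_deriv N P q G i X = quot_class N P q (G - {i}) 0}"

definition primitive_boundary :: "nat \<Rightarrow> nat set set \<Rightarrow> nat set \<Rightarrow> params set" where
  "primitive_boundary N P G =
    {q \<in> constrained_params N P.
      (\<exists>X\<in>quot_constants N P q G. X \<noteq> quot_class N P q G 0) \<and>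
      (\<forall>G'. G' \<subset> G \<longrightarrow>
        in_general_position N (constrained_params N P) (\<lambda>p. S_rank q G' = S_rank p G'))}"


section \<open>Basic facts\<close>

lemma scal_mult: "scal c * scal d = scal (c * d)"
  by (simp add: scal_def mult_single)

lemma lookup_scal_mult: "Poly_Mapping.lookup (scal c * x) w = c * Poly_Mapping.lookup x w"
proof -
  have "scal c * x = Poly_Mapping.map ((*) c) x"
    by (simp add: scal_def mult_map_scale_conv_mult)
  then show ?thesis
    by (simp add: Poly_Mapping.map.rep_eq when_def)
qed

lemma scal_add: "scal (c + d) = scal c + scal d"
  by (simp add: scal_def single_add)

lemma scal_0: "scal 0 = 0"
  by (simp add: scal_def)

lemma scal_commute: "scal c * x = x * scal c"
proof -
  let ?s = "\<Sum>w\<in>Poly_Mapping.keys x. Poly_Mapping.single w (Poly_Mapping.lookup x w)"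
  have "Poly_Mapping.single w a * scal c = scal c * Poly_Mapping.single w a" for w a
    by (simp add: scal_def mult_single mult.commute)
  then have "scal c * ?s = ?s * scal c"
    by (simp add: sum_distrib_left sum_distrib_right)
  moreover have "x = ?s"
    by (rule poly_mapping_eqI) (auto simp: lookup_sum lookup_single when_def in_keys_iff)
  ultimately show ?thesis
    by (rule ssubst[where P = "\<lambda>z. scal c * z = z * scal c", rotated])
qed

lemma deriv_superset:
  assumes "finite A" "Poly_Mapping.keys x \<subseteq> A"
  shows "deriv q i x = (\<Sum>w\<in>A. scal (Poly_Mapping.lookup x w) * deriv_word q i w)"
  unfolding deriv_def
  by (rule sum.mono_neutral_left) (use assms in \<open>auto simp: in_keys_iff scal_0\<close>)

lemma deriv_add: "deriv q i (x + y) = deriv q i x + deriv q i y"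
proof -
  let ?A = "Poly_Mapping.keys x \<union> Poly_Mapping.keys y"
  have "finite ?A" "Poly_Mapping.keys (x + y) \<subseteq> ?A"
    using Poly_Mapping.keys_add[of x y] by auto
  then show ?thesis
    by (simp add: deriv_superset[of ?A] lookup_add scal_add distrib_right sum.distrib)
qed

lemma deriv_scal: "deriv q i (scal c * x) = scal c * deriv q i x"
proof -
  have "Poly_Mapping.keys (scal c * x) \<subseteq> Poly_Mapping.keys x"
    by (auto simp: in_keys_iff lookup_scal_mult)
  then show ?thesis
    by (simp add: deriv_superset[of "Poly_Mapping.keys x"] lookup_scal_mult sum_distrib_left
        scal_mult[symmetric] mult.assoc)
qed

lemma scal_1: "scal 1 = 1"
  by (simp add: scal_def)

lemma deriv_mon: "deriv q i (mon w) = deriv_word q i w"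
  by (simp add: deriv_def mon_def scal_1)

lemma deriv_0: "deriv q i 0 = 0"
  by (simp add: deriv_def)

lemma mon_Nil: "mon [] = 1"
  by (simp add: mon_def flip: zero_list_def)

lemma mon_append: "mon (v @ w) = mon v * mon w"
  by (simp add: mon_def mult_single plus_list_def)

lemma elt_expand: "x = (\<Sum>w\<in>Poly_Mapping.keys x. scal (Poly_Mapping.lookup x w) * mon w)"
  by (rule poly_mapping_eqI)
    (auto simp: lookup_sum lookup_scal_mult mon_def lookup_single when_def in_keys_iff
      if_distrib[of "\<lambda>c. _ * c"] cong: if_cong)

lemma deriv_sum: "deriv q i (\<Sum>a\<in>A. f a) = (\<Sum>a\<in>A. deriv q i (f a))"
  by (induction A rule: infinite_finite_induct) (simp_all add: deriv_0 deriv_add)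

lemma deriv_1: "deriv q i 1 = 0"
  using deriv_mon[of q i "[]"] by (simp add: mon_Nil)

theorem deriv_gen_mult:
  "deriv q i (gen j * x) = (if i = j then x else 0) + scal (q i j) * gen j * deriv q i x"
proof -
  let ?K = "Poly_Mapping.keys x" and ?c = "\<lambda>w. scal (Poly_Mapping.lookup x w)"
  have swap: "a * (?c w * b) = ?c w * (a * b)" for a b w
    by (simp only: mult.assoc[symmetric] scal_commute[of _ a])
  have mon_Cons: "gen j * mon w = mon (j # w)" for w
    using mon_append[of "[j]" w] by simp
  have "gen j * x = gen j * (\<Sum>w\<in>?K. ?c w * mon w)"
    by (rule arg_cong[OF elt_expand])
  also have "\<dots> = (\<Sum>w\<in>?K. ?c w * mon (j # w))"
    by (simp only: sum_distrib_left swap mon_Cons)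
  finally have "deriv q i (gen j * x) = (\<Sum>w\<in>?K. ?c w * deriv_word q i (j # w))"
    by (simp only: deriv_sum deriv_scal deriv_mon)
  also have "\<dots> = (\<Sum>w\<in>?K. ?c w * (if i = j then mon w else 0))
      + scal (q i j) * gen j * (\<Sum>w\<in>?K. ?c w * deriv_word q i w)"
    by (simp only: deriv_word.simps distrib_left sum.distrib sum_distrib_left swap)
  also have "(\<Sum>w\<in>?K. ?c w * (if i = j then mon w else 0)) = (if i = j then x else 0)"
    using elt_expand[of x, symmetric] by (cases "i = j") (simp_all only: if_True if_False refl mult_zero_right sum.neutral_const)
  finally show ?thesis
    by (simp only: deriv_def)
qed

lemma set_orderings: "finite G \<Longrightarrow> set (orderings G) = permutations_of_set G"
  using permutations_of_list[of "sorted_list_of_set G"]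
  by (simp add: orderings_def distinct_remdups_id)

lemma distinct_orderings: "distinct (orderings G)"
  by (simp add: orderings_def distinct_permutations_of_set_list)

lemma free_alg_add_closed:
  "x \<in> carrier (free_alg N) \<Longrightarrow> y \<in> carrier (free_alg N) \<Longrightarrow> x + y \<in> carrier (free_alg N)"
  using Poly_Mapping.keys_add[of x y] unfolding free_alg_def by auto

lemma free_alg_uminus_closed: "x \<in> carrier (free_alg N) \<Longrightarrow> - x \<in> carrier (free_alg N)"
  by (simp add: free_alg_def)

lemma free_alg_mult_closed:
  assumes "x \<in> carrier (free_alg N)" "y \<in> carrier (free_alg N)"
  shows "x * y \<in> carrier (free_alg N)"
proof -
  have "v + w \<in> lists {1..N}" if "v \<in> Poly_Mapping.keys x" "w \<in> Poly_Mapping.keys y" for v w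
    using that assms by (force simp: free_alg_def plus_list_def)
  then show ?thesis
    using keys_mult[of x y] by (fastforce simp: free_alg_def simp del: in_lists_conv_set)
qed

lemma free_alg_simps [simp]:
  "\<zero>\<^bsub>free_alg N\<^esub> = 0" "\<one>\<^bsub>free_alg N\<^esub> = 1"
  "x \<oplus>\<^bsub>free_alg N\<^esub> y = x + y" "x \<otimes>\<^bsub>free_alg N\<^esub> y = x * y"
  by (simp_all add: free_alg_def)

lemma free_alg_0_1: "0 \<in> carrier (free_alg N)" "1 \<in> carrier (free_alg N)"
  by (simp_all add: free_alg_def zero_list_def)

lemma ring_free_alg: "ring (free_alg N)"
proof (rule ringI)
  show "abelian_group (free_alg N)"
  proof (rule abelian_groupI)
    fix x assume "x \<in> carrier (free_alg N)"
    then show "\<exists>y\<in>carrier (free_alg N). y \<oplus>\<^bsub>free_alg N\<^esub> x = \<zero>\<^bsub>free_alg N\<^esub>"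
      by (intro bexI[of _ "- x"]) (simp_all add: free_alg_uminus_closed)
  qed (simp_all add: free_alg_add_closed free_alg_0_1 add.assoc add.commute)
  show "Group.monoid (free_alg N)"
    by (rule monoidI) (simp_all add: free_alg_mult_closed free_alg_0_1 mult.assoc)
qed (simp_all add: distrib_left distrib_right)

end

theory Submission
  imports Defs
begin

text \<open>Let \<open>\<Gamma>\<close> be the graph of the pairs outside \<open>P\<close>. Modulo the commutation relations an ordering only
  remembers an acyclic orientation of \<open>\<Gamma>\<close>, and \<open>S\<close> becomes a Varchenko matrix indexed by such orientations;
  call it nondegenerate if it is invertible. A constant in the quotient whose degree has only nondegenerate
  proper subsets is primitive, hence negated by the antipode, while the square of the antipode is
  multiplication by the product of all \<open>\<sigma>\<^sub>i\<^sub>j\<close>. So nondegeneracy fails only where that product is \<open>1\<close>.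
  If two proper subsets sharing at most one vertex cover \<open>\<Gamma>\<close> without edges between their differences,
  then \<open>S\<close> is a tensor product and no new constant can appear. Otherwise \<open>\<Gamma>\<close> has an acyclic orientation with
  unique source \<open>1\<close> and unique sink \<open>n\<close>, by successive insertion of ears. Take \<open>\<sigma>\<^sub>i\<^sub>j\<close> small on every edge but
  \<open>{1, n}\<close>, with total product \<open>1\<close>. If \<open>S\<close> were invertible, the antipode formula for that orientation would give a
  vanishing alternating sum over its down-sets, but the term of the down-set \<open>{1}\<close> is close to \<open>1\<close> and the
  other ones are small.\<close>

section \<open>Orderings and their weights\<close>

text \<open>As soon as a class has two members, \<open>S\<close> itself is singular, so every
  statement about invertibility concerns the matrix on classes. The bridge is
  \<open>wt_gate\<close>: a weight from \<open>C\<close> to \<open>D\<close> may be routed through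
  \<open>E\<close> when the pairs on which \<open>E\<close> disagrees with both have sigma 1. This
  one rule makes rows and columns of a class proportional, makes the weights across a separation a
  matrix of rank one, and factors the terms of the antipode. One common vertex is harmless at a
  separation because two words that share one letter can always be merged; two shared letters might
  occur in opposite orders. For the degenerate point, a single parameter on the edge from
  \<open>s\<close> to \<open>t\<close> compensates all the others. The product is then 1 on
  \<open>G\<close>, but a non-trivial power of the small number \<open>d\<close> on each proper
  subset with an edge. Bipolarity singles out one large term: a proper down-set other than
  \<open>{s}\<close> contains an edge, whose reversal costs a factor \<open>d\<close>. The generic
  rank is identified as the number of classes, for which the constrained torus has to be
  irreducible.\<close>

primrec ords :: "nat list \<Rightarrow> (nat \<times> nat) set" where
  "ords [] = {}"
| "ords (a # w) = {a} \<times> set w \<union> ords w"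

definition invs :: "nat list \<Rightarrow> nat list \<Rightarrow> (nat \<times> nat) set" where
  "invs C D = ords C \<inter> (ords D)\<inverse>"

definition wt :: "params \<Rightarrow> nat list \<Rightarrow> nat list \<Rightarrow> complex" where
  "wt q C D = (\<Prod>(a, b)\<in>invs C D. q a b)"

text \<open>The class of an ordering is an acyclic orientation of \<open>\<Gamma>\<close>. Orderings of the same class differ by
  commutations of neighbours that form a pair in \<open>P\<close>.\<close>

definition cls :: "nat set set \<Rightarrow> nat list \<Rightarrow> (nat \<times> nat) set" where
  "cls P C = {(a, b) \<in> ords C. {a, b} \<notin> P}"

definition restr :: "nat set \<Rightarrow> nat list \<Rightarrow> nat list" where
  "restr A = filter (\<lambda>x. x \<in> A)"

definition unit_on :: "nat set set \<Rightarrow> params \<Rightarrow> bool" where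
  "unit_on P q \<longleftrightarrow> (\<forall>i j. {i, j} \<in> P \<longrightarrow> sigma q i j = 1)"

abbreviation Om :: "nat set \<Rightarrow> nat list set" where
  "Om \<equiv> permutations_of_set"

lemma ords_subset: "ords w \<subseteq> set w \<times> set w"
  by (induction w) auto

lemma finite_ords [simp]: "finite (ords w)"
  by (rule finite_subset[OF ords_subset]) simp

lemma finite_invs [simp]: "finite (invs C D)"
  by (simp add: invs_def)

lemma ords_append: "ords (u @ v) = ords u \<union> ords v \<union> set u \<times> set v"
  by (induction u) auto

lemma ords_filter: "ords (filter Q w) = {(a, b) \<in> ords w. Q a \<and> Q b}"
  by (induction w) auto

lemma ords_restr: "ords (restr A w) = ords w \<inter> A \<times> A"
  by (auto simp: restr_def ords_filter)

lemma ords_rev: "ords (rev w) = (ords w)\<inverse>"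
  by (induction w) (auto simp: ords_append)

lemma ords_asym: "distinct w \<Longrightarrow> (a, b) \<in> ords w \<Longrightarrow> (b, a) \<notin> ords w"
  using ords_subset by (induction w) auto

lemma ords_total: "a \<in> set w \<Longrightarrow> b \<in> set w \<Longrightarrow> a \<noteq> b \<Longrightarrow> (a, b) \<in> ords w \<or> (b, a) \<in> ords w"
  by (induction w) auto

lemma OmD: "D \<in> Om G \<Longrightarrow> set D = G" "D \<in> Om G \<Longrightarrow> distinct D"
  by (simp_all add: permutations_of_set_def)

lemma Om_ords_asym: "D \<in> Om G \<Longrightarrow> (a, b) \<in> ords D \<Longrightarrow> (b, a) \<notin> ords D"
  using ords_asym OmD(2) by blast

lemma Om_ords_irrefl: "D \<in> Om G \<Longrightarrow> (a, a) \<notin> ords D"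
  using Om_ords_asym by blast

lemma Om_ords_total: "D \<in> Om G \<Longrightarrow> a \<in> G \<Longrightarrow> b \<in> G \<Longrightarrow> a \<noteq> b \<Longrightarrow> (a, b) \<in> ords D \<or> (b, a) \<in> ords D"
  using ords_total OmD(1) by blast

lemma Om_ordsD: "D \<in> Om G \<Longrightarrow> (a, b) \<in> ords D \<Longrightarrow> a \<in> G \<and> b \<in> G"
  using ords_subset[of D] OmD(1) by blast

lemma Om_ords_flip: "C \<in> Om G \<Longrightarrow> D \<in> Om G \<Longrightarrow> (a, b) \<in> ords C \<Longrightarrow> (b, a) \<in> ords D \<longleftrightarrow> (a, b) \<notin> ords D"
  using Om_ordsD Om_ords_total Om_ords_asym Om_ords_irrefl by metis

lemma Om_ords_swap:
  "D \<in> Om G \<Longrightarrow> a \<in> G \<and> b \<in> G \<and> a \<noteq> b \<Longrightarrow> (b, a) \<in> ords D \<longleftrightarrow> (a, b) \<notin> ords D"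
  using Om_ords_total Om_ords_asym by blast

lemma restr_Om: "D \<in> Om G \<Longrightarrow> A \<subseteq> G \<Longrightarrow> restr A D \<in> Om A"
  by (auto simp: permutations_of_set_def restr_def)

lemma append_Om: "u \<in> Om A \<Longrightarrow> v \<in> Om B \<Longrightarrow> A \<inter> B = {} \<Longrightarrow> u @ v \<in> Om (A \<union> B)"
  by (auto simp: permutations_of_set_def)

lemma rev_Om: "D \<in> Om G \<Longrightarrow> rev D \<in> Om G"
  by (auto simp: permutations_of_set_def)

lemma restr_append: "restr A (u @ v) = restr A u @ restr A v"
  by (simp add: restr_def)

lemma restr_id: "set u \<subseteq> A \<Longrightarrow> restr A u = u"
  by (auto simp: restr_def filter_id_conv)

lemma restr_empty: "set u \<inter> A = {} \<Longrightarrow> restr A u = []"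
  by (auto simp: restr_def filter_empty_conv)

lemma wt_self: "C \<in> Om G \<Longrightarrow> wt q C C = 1"
proof -
  assume "C \<in> Om G"
  then have "invs C C = {}"
    unfolding invs_def using Om_ords_asym by blast
  then show ?thesis by (simp add: wt_def)
qed

lemma wt_cong: "(\<And>a b. (a, b) \<in> invs C D \<Longrightarrow> q a b = q' a b) \<Longrightarrow> wt q C D = wt q' C D"
  unfolding wt_def by (rule prod.cong) auto

lemma wt_one: "(\<And>a b. (a, b) \<in> invs C D \<Longrightarrow> q a b = 1) \<Longrightarrow> wt q C D = 1"
  unfolding wt_def by (rule prod.neutral) auto

text \<open>A pair on which \<open>E\<close> disagrees with both \<open>C\<close> and \<open>D\<close> is counted twice on the right, once in
  each direction.\<close>

lemma wt_gate:
  assumes C: "C \<in> Om G" and D: "D \<in> Om G" and E: "E \<in> Om G"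
    and unit: "\<And>a b. (a, b) \<in> invs C E \<Longrightarrow> (a, b) \<in> invs D E \<Longrightarrow> sigma q a b = 1"
  shows "wt q C D = wt q C E * wt q E D"
proof -
  let ?f = "\<lambda>(a, b). q a b"
  define X where "X = invs C E \<inter> invs D E"
  define Y where "Y = invs C E - invs D E"
  define Z where "Z = invs E D - X\<inverse>"
  have CE: "invs C E = X \<union> Y" "X \<inter> Y = {}"
    by (auto simp: X_def Y_def)
  have "X\<inverse> \<subseteq> invs E D"
    by (auto simp: X_def invs_def)
  then have ED: "invs E D = X\<inverse> \<union> Z" "X\<inverse> \<inter> Z = {}"
    by (auto simp: Z_def)
  have "(a, b) \<in> invs C D \<longleftrightarrow> (a, b) \<in> Y \<union> Z" for a b
  proof (cases "a \<in> G \<and> b \<in> G \<and> a \<noteq> b")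
    case True
    then show ?thesis
      using Om_ords_swap[OF C, of a b] Om_ords_swap[OF D, of a b] Om_ords_swap[OF E, of a b]
      unfolding X_def Y_def Z_def invs_def by auto
  next
    case False
    then have "(a, b) \<notin> ords C" "(a, b) \<notin> ords E"
      using Om_ordsD Om_ords_irrefl C E by blast+
    then show ?thesis
      unfolding X_def Y_def Z_def invs_def by auto
  qed
  then have CD: "invs C D = Y \<union> Z" by auto
  have CD2: "Y \<inter> Z = {}"
    using Om_ords_asym[OF E] unfolding Y_def Z_def invs_def by blast
  have fin: "finite X" "finite Y" "finite Z"
    by (auto simp: X_def Y_def Z_def)
  have "prod ?f (X\<inverse>) = (\<Prod>(a, b)\<in>X. q b a)"
    by (rule prod.reindex_bij_witness[of _ prod.swap prod.swap]) auto
  then have "prod ?f X * prod ?f (X\<inverse>) = (\<Prod>(a, b)\<in>X. q a b * q b a)"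
    by (simp add: prod.distrib case_prod_unfold)
  also have "\<dots> = 1"
    using unit by (intro prod.neutral) (auto simp: X_def sigma_def)
  finally have one: "prod ?f X * prod ?f (X\<inverse>) = 1" .
  have "wt q C E * wt q E D = (prod ?f X * prod ?f Y) * (prod ?f (X\<inverse>) * prod ?f Z)"
    unfolding wt_def CE(1) ED(1) using fin CE(2) ED(2) by (simp add: prod.union_disjoint)
  also have "\<dots> = (prod ?f X * prod ?f (X\<inverse>)) * (prod ?f Y * prod ?f Z)"
    by (simp add: mult_ac)
  also have "\<dots> = wt q C D"
    unfolding one wt_def CD using fin CD2 by (simp add: prod.union_disjoint)
  finally show ?thesis by simp
qed

text \<open>Pairs inside one block get the parameter 1, so \<open>wt (cross A B q)\<close> keeps
  exactly the factors that neither restriction sees.\<close>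

definition cross :: "nat set \<Rightarrow> nat set \<Rightarrow> params \<Rightarrow> params" where
  "cross A B q = (\<lambda>a b. if a \<in> A \<and> b \<in> A \<or> a \<in> B \<and> b \<in> B then 1 else q a b)"

lemma wt_restr:
  "wt q (restr A C) (restr A D) = (\<Prod>(a, b)\<in>invs C D. if a \<in> A \<and> b \<in> A then q a b else 1)"
proof -
  have "invs (restr A C) (restr A D) = invs C D \<inter> A \<times> A"
    by (auto simp: invs_def ords_restr)
  then show ?thesis
    unfolding wt_def by (auto simp: prod.inter_restrict case_prod_unfold mem_Times_iff intro!: prod.cong)
qed

text \<open>An inversion has two distinct entries. As the blocks share at most one vertex, it lies
  in at most one of them, and each factor is counted once.\<close>

lemma wt_factor:
  assumes C: "C \<in> Om (A \<union> B)" and AB: "A \<inter> B \<subseteq> {v}"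
  shows "wt q C D = wt q (restr A C) (restr A D) * wt q (restr B C) (restr B D) * wt (cross A B q) C D"
proof -
  have "\<not> (a \<in> A \<and> b \<in> A \<and> a \<in> B \<and> b \<in> B)" if "(a, b) \<in> invs C D" for a b
  proof -
    have "a \<noteq> b"
      using that Om_ords_irrefl[OF C] by (auto simp: invs_def)
    then show ?thesis using AB by blast
  qed
  then show ?thesis
    unfolding wt_restr unfolding wt_def prod.distrib[symmetric]
    by (intro prod.cong) (auto simp: cross_def)
qed

section \<open>Orientations as classes of orderings\<close>

text \<open>Both orderings are total on \<open>G\<close>, so without an inversion outside
  \<open>P\<close> they agree on every edge. This turns equality of orientations into a condition on
  the factors of \<open>wt\<close>.\<close>

lemma cls_eq_iff:
  assumes "C \<in> Om G" "D \<in> Om G"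
  shows "cls P C = cls P D \<longleftrightarrow> (\<forall>a b. (a, b) \<in> invs C D \<longrightarrow> {a, b} \<in> P)"
proof
  assume "cls P C = cls P D"
  then show "\<forall>a b. (a, b) \<in> invs C D \<longrightarrow> {a, b} \<in> P"
    using Om_ords_asym[OF assms(2)] by (auto simp: cls_def invs_def set_eq_iff)
next
  assume *: "\<forall>a b. (a, b) \<in> invs C D \<longrightarrow> {a, b} \<in> P"
  have "(a, b) \<in> cls P C \<longleftrightarrow> (a, b) \<in> cls P D" for a b
    using * Om_ords_flip[OF assms, of a b] Om_ords_flip[OF assms(2,1), of a b] insert_commute[of a b "{}"]
    unfolding cls_def invs_def by simp metis
  then show "cls P C = cls P D" by auto
qed

lemma cls_restr: "cls P (restr A C) = cls P C \<inter> A \<times> A"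
  by (auto simp: cls_def ords_restr)

lemma cls_rev: "cls P (rev C) = (cls P C)\<inverse>"
  by (auto simp: cls_def ords_rev insert_commute)

lemma cls_rev_eq: "cls P (rev C) = cls P D \<longleftrightarrow> cls P C = cls P (rev D)"
  unfolding cls_rev by (metis converse_converse)

lemma cls_append: "cls P (u @ v) = cls P u \<union> cls P v \<union> {(a, b) \<in> set u \<times> set v. {a, b} \<notin> P}"
  by (auto simp: cls_def ords_append)

text \<open>Inversions between members of one class are pairs in \<open>P\<close>, so
  \<open>wt_gate\<close> applies for any \<open>D\<close>: the rows of a class are multiples of each
  other. Dually, \<open>wt_gate_right\<close> treats the columns.\<close>

lemma wt_gate_left:
  assumes "unit_on P q" "C \<in> Om G" "D \<in> Om G" "E \<in> Om G" "cls P C = cls P E"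
  shows "wt q C D = wt q C E * wt q E D"
  using assms by (intro wt_gate[where G = G]) (auto simp: cls_eq_iff unit_on_def)

lemma wt_gate_right:
  assumes "unit_on P q" "C \<in> Om G" "D \<in> Om G" "E \<in> Om G" "cls P E = cls P D"
  shows "wt q C D = wt q C E * wt q E D"
  using assms by (intro wt_gate[where G = G]) (auto simp: cls_eq_iff[of D G E] eq_commute[of "cls P E"] unit_on_def)

section \<open>Commutation classes and nondegeneracy\<close>

text \<open>The choice refers to \<open>w\<close> only through its class, which makes
  \<open>rep\<close> constant on classes by definition.\<close>

definition rep :: "nat set set \<Rightarrow> nat set \<Rightarrow> nat list \<Rightarrow> nat list" where
  "rep P G w = (SOME v. v \<in> Om G \<and> cls P v = cls P w)"

definition reps :: "nat set set \<Rightarrow> nat set \<Rightarrow> nat list list" where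
  "reps P G = remdups (map (rep P G) (orderings G))"

definition red_mat :: "nat set set \<Rightarrow> nat set \<Rightarrow> params \<Rightarrow> complex mat" where
  "red_mat P G q = mat (length (reps P G)) (length (reps P G)) (\<lambda>(a, b). wt q (reps P G ! a) (reps P G ! b))"

definition S_app :: "nat set \<Rightarrow> params \<Rightarrow> (nat list \<Rightarrow> complex) \<Rightarrow> nat list \<Rightarrow> complex" where
  "S_app G q x C = (\<Sum>D\<in>Om G. wt q C D * x D)"

text \<open>The coefficient in the quotient of the class of \<open>C\<close>, normalized at \<open>C\<close>, of the element with
  coefficients \<open>x\<close>.\<close>

definition psi :: "nat set set \<Rightarrow> nat set \<Rightarrow> params \<Rightarrow> (nat list \<Rightarrow> complex) \<Rightarrow> nat list \<Rightarrow> complex" where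
  "psi P G q x C = (\<Sum>D\<in>{D \<in> Om G. cls P D = cls P C}. wt q C D * x D)"

text \<open>Invertibility of \<open>red_mat\<close> stated without representatives: \<open>S\<close>
  kills only elements whose class coefficients all vanish, and such elements lie in the ideal by
  \<open>psi_zero_imp_I\<close>.\<close>

definition nondeg :: "nat set set \<Rightarrow> nat set \<Rightarrow> params \<Rightarrow> bool" where
  "nondeg P G q \<longleftrightarrow>
    (\<forall>x. (\<forall>C\<in>Om G. S_app G q x C = 0) \<longrightarrow> (\<forall>C\<in>Om G. psi P G q x C = 0))"

lemma rep_Om: "w \<in> Om G \<Longrightarrow> rep P G w \<in> Om G"
  and cls_rep: "w \<in> Om G \<Longrightarrow> cls P (rep P G w) = cls P w"
proof -
  assume "w \<in> Om G"
  then have "rep P G w \<in> Om G \<and> cls P (rep P G w) = cls P w"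
    unfolding rep_def using someI[of "\<lambda>v. v \<in> Om G \<and> cls P v = cls P w" w] by simp
  then show "rep P G w \<in> Om G" "cls P (rep P G w) = cls P w" by auto
qed

lemma rep_eq: "cls P v = cls P w \<Longrightarrow> rep P G v = rep P G w"
  by (simp add: rep_def)

lemma rep_eq_iff: "v \<in> Om G \<Longrightarrow> w \<in> Om G \<Longrightarrow> rep P G v = rep P G w \<longleftrightarrow> cls P v = cls P w"
  using rep_eq cls_rep by metis

lemma rep_rep: "w \<in> Om G \<Longrightarrow> rep P G (rep P G w) = rep P G w"
  by (rule rep_eq) (simp add: cls_rep)

lemma set_reps: "finite G \<Longrightarrow> set (reps P G) = rep P G ` Om G"
  by (simp add: reps_def set_orderings)

lemma distinct_reps: "distinct (reps P G)"
  by (simp add: reps_def)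

lemma set_reps_Om: "finite G \<Longrightarrow> r \<in> set (reps P G) \<Longrightarrow> r \<in> Om G"
  by (auto simp: set_reps rep_Om)

lemma rep_reps: "finite G \<Longrightarrow> r \<in> set (reps P G) \<Longrightarrow> rep P G r = r"
  by (auto simp: set_reps rep_rep)

lemma rep_in_reps: "finite G \<Longrightarrow> w \<in> Om G \<Longrightarrow> rep P G w \<in> set (reps P G)"
  by (auto simp: set_reps)

lemma psi_gate:
  assumes "unit_on P q" "C \<in> Om G" "E \<in> Om G" "cls P C = cls P E"
  shows "psi P G q x C = wt q C E * psi P G q x E"
  unfolding psi_def sum_distrib_left assms(4)
  by (rule sum.cong) (auto simp: wt_gate_left[OF assms(1,2) _ assms(3,4)])

lemma S_app_gate:
  assumes "unit_on P q" "C \<in> Om G" "E \<in> Om G" "cls P C = cls P E"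
  shows "S_app G q x C = wt q C E * S_app G q x E"
  unfolding S_app_def sum_distrib_left
  by (rule sum.cong) (auto simp: wt_gate_left[OF assms(1,2) _ assms(3,4)])

text \<open>Columns of one class are proportional, so \<open>S\<close> factors through the class
  coefficients and acts on them by the reduced matrix.\<close>

lemma S_app_reps:
  assumes "unit_on P q" "finite G" "C \<in> Om G"
  shows "S_app G q x C = (\<Sum>r\<in>set (reps P G). wt q C r * psi P G q x r)"
proof -
  have "S_app G q x C = (\<Sum>r\<in>set (reps P G). \<Sum>D\<in>{D \<in> Om G. rep P G D = r}. wt q C D * x D)"
    unfolding S_app_def using assms(2)
    by (intro sum.group[symmetric]) (auto simp: set_reps)
  also have "\<dots> = (\<Sum>r\<in>set (reps P G). wt q C r * psi P G q x r)"
  proof (rule sum.cong[OF refl])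
    fix r assume r: "r \<in> set (reps P G)"
    then have rO: "r \<in> Om G" and rr: "rep P G r = r"
      using assms(2) set_reps_Om rep_reps by auto
    have "{D \<in> Om G. rep P G D = r} = {D \<in> Om G. cls P D = cls P r}"
      using rO rr rep_eq_iff by metis
    then show "(\<Sum>D\<in>{D \<in> Om G. rep P G D = r}. wt q C D * x D) = wt q C r * psi P G q x r"
      unfolding psi_def sum_distrib_left
      by (intro sum.cong) (auto simp: wt_gate_right[OF assms(1,3) _ rO])
  qed
  finally show ?thesis .
qed

lemma psi_reps_supported:
  assumes "finite G" "r \<in> set (reps P G)" and x: "\<And>D. D \<notin> set (reps P G) \<Longrightarrow> x D = 0"
  shows "psi P G q x r = x r"
proof -
  have rO: "r \<in> Om G" using assms set_reps_Om by blast
  have "psi P G q x r = (\<Sum>D\<in>{r}. wt q r D * x D)"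
    unfolding psi_def
  proof (rule sum.mono_neutral_right)
    have "D = r" if "D \<in> Om G" "cls P D = cls P r" "x D \<noteq> 0" for D
      using that x rep_reps[OF assms(1)] assms(2) rep_eq by metis
    then show "\<forall>D\<in>{D \<in> Om G. cls P D = cls P r} - {r}. wt q r D * x D = 0" by auto
  qed (use rO in auto)
  then show ?thesis using rO by (simp add: wt_self)
qed

lemma sum_reps_nth: "(\<Sum>r\<in>set (reps P G). f r) = (\<Sum>b<length (reps P G). f (reps P G ! b))"
  by (rule sum.reindex_bij_betw[symmetric]) (rule bij_betw_nth[OF distinct_reps], simp_all)

lemma red_mat_carrier: "red_mat P G q \<in> carrier_mat (length (reps P G)) (length (reps P G))"
  by (simp add: red_mat_def)

lemma red_mat_mult_vec:
  assumes "v \<in> carrier_vec (length (reps P G))" "a < length (reps P G)"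
  shows "(red_mat P G q *\<^sub>v v) $ a = (\<Sum>b<length (reps P G). wt q (reps P G ! a) (reps P G ! b) * v $ b)"
  using assms by (auto simp: red_mat_def scalar_prod_def atLeast0LessThan intro!: sum.cong)

lemma det_imp_nondeg:
  assumes "unit_on P q" "finite G" "det (red_mat P G q) \<noteq> 0"
  shows "nondeg P G q"
  unfolding nondeg_def
proof (intro allI impI ballI)
  fix x C assume Sx: "\<forall>C\<in>Om G. S_app G q x C = 0" and C: "C \<in> Om G"
  let ?k = "length (reps P G)"
  define v where "v = vec ?k (\<lambda>b. psi P G q x (reps P G ! b))"
  have v: "v \<in> carrier_vec ?k" by (simp add: v_def)
  have "red_mat P G q *\<^sub>v v = 0\<^sub>v ?k"
  proof (rule eq_vecI)
    fix a assume "a < dim_vec (0\<^sub>v ?k)"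
    then have a: "a < ?k" by simp
    then have "reps P G ! a \<in> Om G" using set_reps_Om assms(2) nth_mem by blast
    then have "0 = (\<Sum>r\<in>set (reps P G). wt q (reps P G ! a) r * psi P G q x r)"
      using S_app_reps[OF assms(1,2)] Sx by metis
    also have "\<dots> = (red_mat P G q *\<^sub>v v) $ a"
      unfolding sum_reps_nth red_mat_mult_vec[OF v a] by (simp add: v_def)
    finally show "(red_mat P G q *\<^sub>v v) $ a = 0\<^sub>v ?k $ a" using a by simp
  qed (simp add: red_mat_def)
  then have "v = 0\<^sub>v ?k"
    using det_0_iff_vec_prod_zero_field[OF red_mat_carrier] assms(3) v by blast
  then have zero: "psi P G q x (reps P G ! b) = 0" if "b < ?k" for b
    using that by (metis index_vec index_zero_vec(1) v_def)
  have "psi P G q x (rep P G C) = 0"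
    using zero rep_in_reps[OF assms(2) C] by (metis in_set_conv_nth)
  then show "psi P G q x C = 0"
    using psi_gate[OF assms(1) C rep_Om[OF C] cls_rep[OF C, symmetric]] by simp
qed

lemma nondeg_imp_det:
  assumes "unit_on P q" "finite G" "nondeg P G q"
  shows "det (red_mat P G q) \<noteq> 0"
proof
  assume "det (red_mat P G q) = 0"
  let ?k = "length (reps P G)"
  obtain v where v: "v \<in> carrier_vec ?k" "v \<noteq> 0\<^sub>v ?k" "red_mat P G q *\<^sub>v v = 0\<^sub>v ?k"
    using det_0_iff_vec_prod_zero_field[OF red_mat_carrier] \<open>det (red_mat P G q) = 0\<close> by blast
  \<comment> \<open>The kernel vector placed on the representatives and zero elsewhere; on such
    functions \<open>psi\<close> returns the entries.\<close>
  define x where "x = (\<lambda>D. \<Sum>b<?k. if reps P G ! b = D then v $ b else 0)"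
  have x0: "x D = 0" if "D \<notin> set (reps P G)" for D
    unfolding x_def using that by (intro sum.neutral) auto
  have xb: "x (reps P G ! b) = v $ b" if "b < ?k" for b
  proof -
    have "x (reps P G ! b) = (\<Sum>c<?k. if c = b then v $ c else 0)"
      unfolding x_def using that distinct_reps[of P G] nth_eq_iff_index_eq
      by (intro sum.cong) auto
    then show ?thesis using that by simp
  qed
  have "S_app G q x C = 0" if C: "C \<in> Om G" for C
  proof -
    have "S_app G q x (rep P G C) = (\<Sum>r\<in>set (reps P G). wt q (rep P G C) r * psi P G q x r)"
      using S_app_reps[OF assms(1,2) rep_Om[OF C]] .
    also have "\<dots> = (\<Sum>r\<in>set (reps P G). wt q (rep P G C) r * x r)"
      by (intro sum.cong) (simp_all add: psi_reps_supported[OF assms(2) _ x0])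
    also obtain a where a: "a < ?k" "reps P G ! a = rep P G C"
      using rep_in_reps[OF assms(2) C] by (metis in_set_conv_nth)
    have "(\<Sum>r\<in>set (reps P G). wt q (rep P G C) r * x r) = (red_mat P G q *\<^sub>v v) $ a"
      unfolding sum_reps_nth red_mat_mult_vec[OF v(1) a(1)] a(2) by (simp add: xb)
    finally show ?thesis
      using S_app_gate[OF assms(1) C rep_Om[OF C] cls_rep[OF C, symmetric]] v(3) a(1) by simp
  qed
  then have "psi P G q x C = 0" if "C \<in> Om G" for C
    using assms(3) that unfolding nondeg_def by blast
  then have "v $ b = 0" if "b < ?k" for b
  proof -
    have b: "reps P G ! b \<in> set (reps P G)" using that by simp
    show ?thesis
      using psi_reps_supported[OF assms(2) b, of x q] x0 set_reps_Om[OF assms(2) b] xb[OF that]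
        \<open>\<And>C. C \<in> Om G \<Longrightarrow> psi P G q x C = 0\<close> by simp
  qed
  then show False using v by auto
qed

section \<open>Solving linear systems with the reduced matrix\<close>

lemma nondeg_inverse:
  assumes "unit_on P q" "finite G" "nondeg P G q"
  obtains N where
    "\<And>r t. r \<in> set (reps P G) \<Longrightarrow> t \<in> set (reps P G) \<Longrightarrow>
      (\<Sum>w\<in>set (reps P G). N r w * wt q w t) = (if r = t then 1 else 0)"
    "\<And>r t. r \<in> set (reps P G) \<Longrightarrow> t \<in> set (reps P G) \<Longrightarrow>
      (\<Sum>w\<in>set (reps P G). wt q r w * N w t) = (if r = t then 1 else 0)"
proof -
  let ?k = "length (reps P G)" and ?M = "red_mat P G q" and ?rs = "reps P G"
  have "?M \<in> Units (ring_mat TYPE(complex) ?k ())"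
    using det_non_zero_imp_unit[OF red_mat_carrier nondeg_imp_det[OF assms]] .
  then obtain B where B: "B \<in> carrier_mat ?k ?k" "B * ?M = 1\<^sub>m ?k" "?M * B = 1\<^sub>m ?k"
    unfolding Units_def by (auto simp: ring_mat_def)
  define idx where "idx = the_inv_into {..<?k} (\<lambda>b. ?rs ! b)"
  have idx: "idx (?rs ! b) = b" if "b < ?k" for b
    unfolding idx_def using that inj_on_nth[OF distinct_reps[of P G]]
    by (intro the_inv_into_f_f) auto
  have idx': "idx r < ?k \<and> ?rs ! (idx r) = r" if "r \<in> set ?rs" for r
    using that idx by (auto simp: in_set_conv_nth)
  define N where "N r t = B $$ (idx r, idx t)" for r t
  show ?thesis
  proof (rule that[of N])
    fix r t assume rt: "r \<in> set ?rs" "t \<in> set ?rs"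
    have eq: "idx r = idx t \<longleftrightarrow> r = t" using idx'[OF rt(1)] idx'[OF rt(2)] by metis
    have "(\<Sum>w\<in>set ?rs. N r w * wt q w t) = (B * ?M) $$ (idx r, idx t)"
      unfolding sum_reps_nth using idx'[OF rt(1)] idx'[OF rt(2)] B(1)
      by (auto simp: N_def idx red_mat_def scalar_prod_def atLeast0LessThan intro!: sum.cong)
    then show "(\<Sum>w\<in>set ?rs. N r w * wt q w t) = (if r = t then 1 else 0)"
      unfolding B(2) using idx'[OF rt(1)] idx'[OF rt(2)] eq by auto
    have "(\<Sum>w\<in>set ?rs. wt q r w * N w t) = (?M * B) $$ (idx r, idx t)"
      unfolding sum_reps_nth using idx'[OF rt(1)] idx'[OF rt(2)] B(1)
      by (auto simp: N_def idx red_mat_def scalar_prod_def atLeast0LessThan intro!: sum.cong)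
    then show "(\<Sum>w\<in>set ?rs. wt q r w * N w t) = (if r = t then 1 else 0)"
      unfolding B(3) using idx'[OF rt(1)] idx'[OF rt(2)] eq by auto
  qed
qed

lemma sum_Om_reps:
  assumes "finite G" "\<And>w. w \<notin> set (reps P G) \<Longrightarrow> f w = 0"
  shows "(\<Sum>w\<in>Om G. f w) = (\<Sum>w\<in>set (reps P G). f w)"
  using assms set_reps_Om by (intro sum.mono_neutral_right) auto

text \<open>Applied to the values \<open>S_app G q x w\<close>, the combination \<open>l\<close>
  extracts \<open>psi P G q x u\<close>. The support on representatives allows its size to be
  estimated in \<open>near_identity_solve\<close>.\<close>

lemma nondeg_solve_left:
  assumes q: "unit_on P q" and G: "finite G" and nd: "nondeg P G q" and u: "u \<in> Om G"
  obtains l where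
    "\<And>w. w \<notin> set (reps P G) \<Longrightarrow> l w = 0"
    "\<And>a. a \<in> Om G \<Longrightarrow>
      (\<Sum>w\<in>Om G. l w * wt q w a) = (if cls P a = cls P u then wt q u a else 0)"
proof -
  obtain N where N: "\<And>r t. r \<in> set (reps P G) \<Longrightarrow> t \<in> set (reps P G) \<Longrightarrow>
      (\<Sum>w\<in>set (reps P G). N r w * wt q w t) = (if r = t then 1 else 0)"
    using nondeg_inverse[OF q G nd] by metis
  \<comment> \<open>The row of the inverse at the class of \<open>u\<close>, rescaled from the
    representative to \<open>u\<close> itself.\<close>
  define l where "l w = (if w \<in> set (reps P G) then wt q u (rep P G u) * N (rep P G u) w else 0)" for w
  show ?thesis
  proof (rule that[of l])
    show l0: "l w = 0" if "w \<notin> set (reps P G)" for w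
      using that by (simp add: l_def)
    fix a assume a: "a \<in> Om G"
    have "(\<Sum>w\<in>Om G. l w * wt q w a) = (\<Sum>w\<in>set (reps P G). l w * wt q w a)"
      by (rule sum_Om_reps[OF G]) (simp add: l0)
    also have "\<dots> = wt q u (rep P G u) * (\<Sum>w\<in>set (reps P G). N (rep P G u) w * wt q w (rep P G a)) * wt q (rep P G a) a"
      unfolding sum_distrib_left sum_distrib_right
    proof (rule sum.cong[OF refl])
      fix w assume w: "w \<in> set (reps P G)"
      have "wt q w a = wt q w (rep P G a) * wt q (rep P G a) a"
        by (rule wt_gate_right[OF q set_reps_Om[OF G w] a rep_Om[OF a] cls_rep[OF a]])
      then show "l w * wt q w a = wt q u (rep P G u) * (N (rep P G u) w * wt q w (rep P G a)) * wt q (rep P G a) a"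
        using w by (simp add: l_def)
    qed
    also have "\<dots> = (if rep P G u = rep P G a then wt q u (rep P G u) * wt q (rep P G a) a else 0)"
      by (simp add: N rep_in_reps[OF G] u a)
    also have "\<dots> = (if cls P a = cls P u then wt q u a else 0)"
      using wt_gate_left[OF q u a rep_Om[OF u] cls_rep[OF u, symmetric]] rep_eq_iff[OF u a, of P] rep_eq[of P u a G] by (auto simp del: mult_cancel_left)
    finally show "(\<Sum>w\<in>Om G. l w * wt q w a) = (if cls P a = cls P u then wt q u a else 0)" .
  qed
qed

text \<open>The column version: an element whose image under \<open>S\<close> is concentrated on the
  class of \<open>C\<close>. It is the test element in \<open>degenerate_criterion\<close>.\<close>

lemma nondeg_solve_right:
  assumes q: "unit_on P q" and G: "finite G" and nd: "nondeg P G q" and C: "C \<in> Om G"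
  obtains x where
    "\<And>E. E \<in> Om G \<Longrightarrow> S_app G q x E = (if cls P E = cls P C then wt q E C else 0)"
proof -
  obtain N where N: "\<And>r t. r \<in> set (reps P G) \<Longrightarrow> t \<in> set (reps P G) \<Longrightarrow>
      (\<Sum>w\<in>set (reps P G). wt q r w * N w t) = (if r = t then 1 else 0)"
    using nondeg_inverse[OF q G nd] by metis
  define x where "x w = (if w \<in> set (reps P G) then N w (rep P G C) * wt q (rep P G C) C else 0)" for w
  show ?thesis
  proof (rule that[of x])
    fix E assume E: "E \<in> Om G"
    have "S_app G q x E = (\<Sum>w\<in>set (reps P G). wt q E w * x w)"
      unfolding S_app_def by (rule sum_Om_reps[OF G]) (simp add: x_def)
    also have "\<dots> = wt q E (rep P G E) * (\<Sum>w\<in>set (reps P G). wt q (rep P G E) w * N w (rep P G C)) * wt q (rep P G C) C"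
      unfolding sum_distrib_left sum_distrib_right
    proof (rule sum.cong[OF refl])
      fix w assume w: "w \<in> set (reps P G)"
      have "wt q E w = wt q E (rep P G E) * wt q (rep P G E) w"
        by (rule wt_gate_left[OF q E set_reps_Om[OF G w] rep_Om[OF E] cls_rep[OF E, symmetric]])
      then show "wt q E w * x w = wt q E (rep P G E) * (wt q (rep P G E) w * N w (rep P G C)) * wt q (rep P G C) C"
        using w by (simp add: x_def)
    qed
    also have "\<dots> = (if rep P G E = rep P G C then wt q E (rep P G E) * wt q (rep P G C) C else 0)"
      by (simp add: N rep_in_reps[OF G] C E)
    also have "\<dots> = (if cls P E = cls P C then wt q E C else 0)"
      using wt_gate_left[OF q E C rep_Om[OF E] cls_rep[OF E, symmetric]] rep_eq_iff[OF E C, of P] rep_eq[of P E C G] by (auto simp del: mult_cancel_left)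
    finally show "S_app G q x E = (if cls P E = cls P C then wt q E C else 0)" .
  qed
qed

section \<open>Tensor products and the antipode\<close>

text \<open>After division by \<open>k u w\<close>, the rows of the merged words
  \<open>m u w\<close> are a tensor product of the rows of the blocks, times a factor that depends
  on the column only. Hence a product of block solutions solves the system on \<open>G\<close>. It
  is used for concatenation, with \<open>k\<close> equal to 1, and for merging at a common
  vertex.\<close>

lemma tensor_solve:
  assumes G: "G = A \<union> B" "finite G" and AB: "A \<inter> B \<subseteq> {v}"
    and m: "\<And>u w. u \<in> Om A \<Longrightarrow> w \<in> Om B \<Longrightarrow> m u w \<in> Om G \<and> restr A (m u w) = u \<and> restr B (m u w) = w"
    and k: "\<And>u w D. u \<in> Om A \<Longrightarrow> w \<in> Om B \<Longrightarrow> D \<in> Om G \<Longrightarrow>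
      wt (cross A B q) (m u w) D = k u w * wt (cross A B q) C D"
    and k0: "\<And>u w. u \<in> Om A \<Longrightarrow> w \<in> Om B \<Longrightarrow> k u w \<noteq> 0"
    and C: "C \<in> Om G"
    and lA: "\<And>a. a \<in> Om A \<Longrightarrow> (\<Sum>u\<in>Om A. lA u * wt q u a) =
      (if cls P a = cls P (restr A C) then wt q (restr A C) a else 0)"
    and lB: "\<And>a. a \<in> Om B \<Longrightarrow> (\<Sum>w\<in>Om B. lB w * wt q w a) =
      (if cls P a = cls P (restr B C) then wt q (restr B C) a else 0)"
  shows "(\<Sum>u\<in>Om A. \<Sum>w\<in>Om B. lA u * lB w / k u w * S_app G q x (m u w)) =
    (\<Sum>D\<in>{D \<in> Om G. cls P (restr A D) = cls P (restr A C) \<and> cls P (restr B D) = cls P (restr B C)}.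
      wt q C D * x D)"
proof -
  let ?c = "wt (cross A B q) C"
  have "lA u * lB w / k u w * S_app G q x (m u w) =
      (\<Sum>D\<in>Om G. ?c D * x D * (lA u * wt q u (restr A D)) * (lB w * wt q w (restr B D)))"
    if "u \<in> Om A" "w \<in> Om B" for u w
    unfolding S_app_def sum_distrib_left
  proof (rule sum.cong[OF refl])
    fix D assume D: "D \<in> Om G"
    have "wt q (m u w) D = wt q u (restr A D) * wt q w (restr B D) * (k u w * ?c D)"
      using wt_factor[of "m u w" A B v q D] m[OF that] k[OF that D] AB G(1) by simp
    then show "lA u * lB w / k u w * (wt q (m u w) D * x D) =
        ?c D * x D * (lA u * wt q u (restr A D)) * (lB w * wt q w (restr B D))"
      using k0[OF that] by (simp add: field_simps)
  qed
  then have "(\<Sum>u\<in>Om A. \<Sum>w\<in>Om B. lA u * lB w / k u w * S_app G q x (m u w)) =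
      (\<Sum>u\<in>Om A. \<Sum>w\<in>Om B. \<Sum>D\<in>Om G.
        ?c D * x D * (lA u * wt q u (restr A D)) * (lB w * wt q w (restr B D)))"
    by simp
  also have "\<dots> = (\<Sum>u\<in>Om A. \<Sum>D\<in>Om G. \<Sum>w\<in>Om B.
        ?c D * x D * (lA u * wt q u (restr A D)) * (lB w * wt q w (restr B D)))"
    by (intro sum.cong refl sum.swap)
  also have "\<dots> = (\<Sum>D\<in>Om G. \<Sum>u\<in>Om A. \<Sum>w\<in>Om B.
        ?c D * x D * (lA u * wt q u (restr A D)) * (lB w * wt q w (restr B D)))"
    by (rule sum.swap)
  also have "\<dots> = (\<Sum>D\<in>Om G. ?c D * x D *
      (\<Sum>u\<in>Om A. lA u * wt q u (restr A D)) * (\<Sum>w\<in>Om B. lB w * wt q w (restr B D)))"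
    by (simp add: sum_distrib_left sum_distrib_right, intro sum.cong refl sum.swap)
  also have "\<dots> = (\<Sum>D\<in>Om G. if cls P (restr A D) = cls P (restr A C) \<and> cls P (restr B D) = cls P (restr B C)
      then wt q C D * x D else 0)"
  proof (rule sum.cong[OF refl])
    fix D assume D: "D \<in> Om G"
    have "restr A D \<in> Om A" "restr B D \<in> Om B"
      using D G restr_Om by auto
    then show "?c D * x D * (\<Sum>u\<in>Om A. lA u * wt q u (restr A D)) * (\<Sum>w\<in>Om B. lB w * wt q w (restr B D)) =
      (if cls P (restr A D) = cls P (restr A C) \<and> cls P (restr B D) = cls P (restr B C)
      then wt q C D * x D else 0)"
      using wt_factor[of C A B v q D] AB G(1) C by (simp add: lA lB)
  qed
  also have "\<dots> = (\<Sum>D\<in>{D \<in> Om G. cls P (restr A D) = cls P (restr A C) \<and> cls P (restr B D) = cls P (restr B C)}.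
      wt q C D * x D)"
    by (rule sum.inter_filter[symmetric]) simp
  finally show ?thesis .
qed

text \<open>In \<open>u @ w\<close> every pair across the blocks runs from \<open>A\<close> to
  \<open>B\<close>, whatever \<open>u\<close> and \<open>w\<close> are. The cross weight is
  therefore a function of \<open>D\<close> alone.\<close>

lemma wt_cross_append:
  assumes "u \<in> Om A" "w \<in> Om B" "A \<inter> B = {}" "D \<in> Om (A \<union> B)"
  shows "wt (cross A B q) (u @ w) D = (\<Prod>(a, b)\<in>A \<times> B \<inter> (ords D)\<inverse>. q a b)"
  unfolding wt_def
proof (rule prod.mono_neutral_cong_right)
  show "A \<times> B \<inter> (ords D)\<inverse> \<subseteq> invs (u @ w) D"
    using OmD(1)[OF assms(1)] OmD(1)[OF assms(2)] by (auto simp: invs_def ords_append)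
  show "\<forall>i\<in>invs (u @ w) D - A \<times> B \<inter> (ords D)\<inverse>. (case i of (a, b) \<Rightarrow> cross A B q a b) = 1"
    using OmD(1)[OF assms(1)] OmD(1)[OF assms(2)] Om_ordsD[OF assms(1)] Om_ordsD[OF assms(2)]
    by (auto simp: invs_def ords_append cross_def)
  show "(case i of (a, b) \<Rightarrow> cross A B q a b) = (case i of (a, b) \<Rightarrow> q a b)"
    if "i \<in> A \<times> B \<inter> (ords D)\<inverse>" for i
    using that assms(3) by (auto simp: cross_def)
qed simp

lemma restr_append_blocks:
  assumes "u \<in> Om A" "w \<in> Om B" "A \<inter> B = {}"
  shows "restr A (u @ w) = u" "restr B (u @ w) = w"
  using assms OmD(1)[OF assms(1)] OmD(1)[OF assms(2)]
  by (simp_all add: restr_append restr_id restr_empty Int_commute)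

lemma block_solve:
  assumes G: "finite G" and A: "A \<subseteq> G" and u: "u \<in> Om A" and w: "w \<in> Om (G - A)"
    and lA: "\<And>a. a \<in> Om A \<Longrightarrow> (\<Sum>u'\<in>Om A. lA u' * wt q u' a) = (if cls P a = cls P u then wt q u a else 0)"
    and lB: "\<And>a. a \<in> Om (G - A) \<Longrightarrow> (\<Sum>w'\<in>Om (G - A). lB w' * wt q w' a) =
      (if cls P a = cls P w then wt q w a else 0)"
  shows "(\<Sum>D\<in>{D \<in> Om G. cls P (restr A D) = cls P u \<and> cls P (restr (G - A) D) = cls P w}. wt q (u @ w) D * x D)
    = (\<Sum>u'\<in>Om A. \<Sum>w'\<in>Om (G - A). lA u' * lB w' * S_app G q x (u' @ w'))"
proof -
  have GA: "G = A \<union> (G - A)" and dis: "A \<inter> (G - A) = {}" using A by auto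
  note res = restr_append_blocks[OF _ _ dis]
  have "(\<Sum>u'\<in>Om A. \<Sum>w'\<in>Om (G - A). lA u' * lB w' / 1 * S_app G q x (u' @ w')) =
    (\<Sum>D\<in>{D \<in> Om G. cls P (restr A D) = cls P (restr A (u @ w)) \<and>
       cls P (restr (G - A) D) = cls P (restr (G - A) (u @ w))}. wt q (u @ w) D * x D)"
  proof (rule tensor_solve[OF GA G])
    \<comment> \<open>The blocks are disjoint, so their intersection lies in every singleton; 0 is
      an arbitrary choice.\<close>
    show "A \<inter> (G - A) \<subseteq> {0}" by auto
    show "u' @ w' \<in> Om G \<and> restr A (u' @ w') = u' \<and> restr (G - A) (u' @ w') = w'"
      if "u' \<in> Om A" "w' \<in> Om (G - A)" for u' w'
      using append_Om[OF that dis] res[OF that] GA by simp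
    show "wt (cross A (G - A) q) (u' @ w') D = 1 * wt (cross A (G - A) q) (u @ w) D"
      if "u' \<in> Om A" "w' \<in> Om (G - A)" "D \<in> Om G" for u' w' D
      using wt_cross_append[OF that(1,2) dis] wt_cross_append[OF u w dis] that(3) GA by simp
    show "u @ w \<in> Om G" using append_Om[OF u w dis] GA by simp
  qed (simp_all add: res[OF u w] lA lB)
  then show ?thesis by (simp add: res[OF u w])
qed

section \<open>Gluing along at most one vertex\<close>

text \<open>Disjoint words are concatenated. Otherwise both are cut at the common letter, and the
  two prefixes are put before it, the two suffixes after it.\<close>

lemma merge_exists:
  assumes "u \<in> Om A" "w \<in> Om B" and AB: "A \<inter> B \<subseteq> {v}"
  obtains C where "C \<in> Om (A \<union> B)" "restr A C = u" "restr B C = w"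
proof (cases "v \<in> A \<inter> B")
  case False
  then have "A \<inter> B = {}" using AB by auto
  then show ?thesis
    using that[of "u @ w"] append_Om[OF assms(1,2)] restr_append_blocks[OF assms(1,2)] by simp
next
  case True
  then have "v \<in> set u" "v \<in> set w" using OmD(1)[OF assms(1)] OmD(1)[OF assms(2)] by auto
  then obtain u1 u2 w1 w2 where split: "u = u1 @ v # u2" "w = w1 @ v # w2"
    by (metis split_list)
  have u: "set u = A" "distinct u" and w: "set w = B" "distinct w"
    using OmD[OF assms(1)] OmD[OF assms(2)] by auto
  have A: "set u1 \<subseteq> A" "set u2 \<subseteq> A" "v \<in> A" and B: "set w1 \<subseteq> B" "set w2 \<subseteq> B" "v \<in> B"
    using u(1) w(1) split by auto
  have dis: "set u1 \<inter> B = {}" "set u2 \<inter> B = {}" "set w1 \<inter> A = {}" "set w2 \<inter> A = {}"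
    using u(2) w(2) split A B AB by auto
  have "set (u1 @ w1 @ v # u2 @ w2) = A \<union> B"
    using u(1) w(1) split by auto
  moreover have "distinct (u1 @ w1 @ v # u2 @ w2)"
    using u(2) w(2) split dis A B by auto
  ultimately have "u1 @ w1 @ v # u2 @ w2 \<in> Om (A \<union> B)"
    by (simp add: permutations_of_set_def)
  moreover have "restr A (u1 @ w1 @ v # u2 @ w2) = u"
    using restr_id[OF A(1)] restr_id[OF A(2)] restr_empty[OF dis(3)] restr_empty[OF dis(4)] A(3)
    by (simp add: split(1) restr_def)
  moreover have "restr B (u1 @ w1 @ v # u2 @ w2) = w"
    using restr_id[OF B(1)] restr_id[OF B(2)] restr_empty[OF dis(1)] restr_empty[OF dis(2)] B(3)
    by (simp add: split(2) restr_def)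
  ultimately show ?thesis using that by blast
qed

text \<open>Pairs between \<open>A - B\<close> and \<open>B - A\<close> have sigma 1, so the cross
  weights form a matrix of rank one and \<open>tensor_solve\<close> applies to merged words. It
  extracts \<open>psi\<close> because a class on the union is determined by its
  restrictions.\<close>

lemma nondeg_union:
  assumes q: "unit_on P q" and fin: "finite A" "finite B" and AB: "A \<inter> B \<subseteq> {v}"
    and P: "\<And>a b. a \<in> A - B \<Longrightarrow> b \<in> B - A \<Longrightarrow> {a, b} \<in> P"
    and nd: "nondeg P A q" "nondeg P B q"
  shows "nondeg P (A \<union> B) q"
  unfolding nondeg_def
proof (intro allI impI ballI)
  fix x C assume Sx: "\<forall>C\<in>Om (A \<union> B). S_app (A \<union> B) q x C = 0" and C: "C \<in> Om (A \<union> B)"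
  have rC: "restr A C \<in> Om A" "restr B C \<in> Om B" using restr_Om[OF C] by auto
  obtain lA where lA: "\<And>a. a \<in> Om A \<Longrightarrow> (\<Sum>u\<in>Om A. lA u * wt q u a) =
      (if cls P a = cls P (restr A C) then wt q (restr A C) a else 0)"
    using nondeg_solve_left[OF q fin(1) nd(1) rC(1)] by metis
  obtain lB where lB: "\<And>a. a \<in> Om B \<Longrightarrow> (\<Sum>w\<in>Om B. lB w * wt q w a) =
      (if cls P a = cls P (restr B C) then wt q (restr B C) a else 0)"
    using nondeg_solve_left[OF q fin(2) nd(2) rC(2)] by metis
  have "\<exists>C. C \<in> Om (A \<union> B) \<and> restr A C = u \<and> restr B C = w" if "u \<in> Om A" "w \<in> Om B" for u w
    using merge_exists[OF that AB] by metis
  then obtain m where m: "\<And>u w. u \<in> Om A \<Longrightarrow> w \<in> Om B \<Longrightarrow>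
      m u w \<in> Om (A \<union> B) \<and> restr A (m u w) = u \<and> restr B (m u w) = w"
    by metis
  let ?c = "wt (cross A B q)"
  \<comment> \<open>With the parameters \<open>cross A B q\<close>, any two vertices have sigma 1:
    by definition inside a block, by the constraints across. So every \<open>F\<close> can serve as
    a gate.\<close>
  have gate: "?c E D = ?c E F * ?c F D"
    if E: "E \<in> Om (A \<union> B)" and D: "D \<in> Om (A \<union> B)" and F: "F \<in> Om (A \<union> B)" for E D F
  proof (rule wt_gate[OF E D F])
    fix a b assume "(a, b) \<in> invs E F"
    then have ab: "a \<in> A \<union> B" "b \<in> A \<union> B"
      using Om_ordsD[OF E] by (auto simp: invs_def)
    show "sigma (cross A B q) a b = 1"
    proof (cases "a \<in> A \<and> b \<in> A \<or> a \<in> B \<and> b \<in> B")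
      case False
      then have "{a, b} \<in> P"
        using ab P[of a b] P[of b a] by (auto simp: insert_commute)
      then show ?thesis using q False by (auto simp: unit_on_def sigma_def cross_def)
    qed (auto simp: sigma_def cross_def)
  qed
  \<comment> \<open>With \<open>D = E\<close> the gate rule factors \<open>?c E E = 1\<close>, so
    both factors are non-zero.\<close>
  have nz: "?c E F \<noteq> 0" if E: "E \<in> Om (A \<union> B)" and F: "F \<in> Om (A \<union> B)" for E F
    using gate[OF E E F] wt_self[OF E] by auto
  have "(\<Sum>u\<in>Om A. \<Sum>w\<in>Om B. lA u * lB w / ?c (m u w) C * S_app (A \<union> B) q x (m u w)) =
    (\<Sum>D\<in>{D \<in> Om (A \<union> B). cls P (restr A D) = cls P (restr A C) \<and> cls P (restr B D) = cls P (restr B C)}.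
      wt q C D * x D)"
  proof (rule tensor_solve[OF refl _ AB _ _ _ C])
    show "?c (m u w) D = ?c (m u w) C * ?c C D" if "u \<in> Om A" "w \<in> Om B" "D \<in> Om (A \<union> B)" for u w D
      using gate[of "m u w" D C] m[OF that(1,2)] that(3) C by blast
    show "?c (m u w) C \<noteq> 0" if "u \<in> Om A" "w \<in> Om B" for u w
      using nz[of "m u w" C] m[OF that] C by blast
  qed (fact lA lB | simp add: fin m)+
  \<comment> \<open>No edge joins \<open>A - B\<close> to \<open>B - A\<close>, so an orientation is
    the union of its restrictions to the blocks.\<close>
  moreover have "{D \<in> Om (A \<union> B). cls P (restr A D) = cls P (restr A C) \<and> cls P (restr B D) = cls P (restr B C)}
     = {D \<in> Om (A \<union> B). cls P D = cls P C}"
  proof -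
    have sub: "cls P D \<subseteq> A \<times> A \<union> B \<times> B" if "D \<in> Om (A \<union> B)" for D
    proof clarify
      fix a b assume ab: "(a, b) \<in> cls P D" "\<not> (a \<in> B \<and> b \<in> B)"
      then have "a \<in> A \<union> B" "b \<in> A \<union> B" "{a, b} \<notin> P" "{b, a} \<notin> P"
        using Om_ordsD[OF that, of a b] by (auto simp: cls_def insert_commute)
      then show "a \<in> A \<and> b \<in> A" using ab P[of a b] P[of b a] by blast
    qed
    have "cls P D = cls P D \<inter> A \<times> A \<union> cls P D \<inter> B \<times> B" if "D \<in> Om (A \<union> B)" for D
      using sub[OF that] by blast
    then have "cls P D = cls P C"
      if "D \<in> Om (A \<union> B)" "cls P D \<inter> A \<times> A = cls P C \<inter> A \<times> A" "cls P D \<inter> B \<times> B = cls P C \<inter> B \<times> B" for D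
      using that C by metis
    then show ?thesis unfolding cls_restr by auto
  qed
  moreover have "S_app (A \<union> B) q x (m u w) = 0" if "u \<in> Om A" "w \<in> Om B" for u w
    using Sx m[OF that] by blast
  ultimately show "psi P (A \<union> B) q x C = 0"
    unfolding psi_def by simp
qed

section \<open>The antipode identity\<close>

text \<open>The coproduct splits a word into its restrictions to \<open>A\<close> and to the
  complement; the antipode reverses a word up to sign and a scalar. Writing the complement as
  \<open>- A\<close> keeps \<open>phi\<close> independent of \<open>G\<close>.\<close>

definition phi :: "nat set \<Rightarrow> nat list \<Rightarrow> nat list" where
  "phi A D = rev (restr A D) @ restr (- A) D"

text \<open>The contribution of \<open>A\<close> to the convolution of the antipode with the identity, which vanishes in
  non-trivial degrees.\<close>

definition antip :: "nat set set \<Rightarrow> nat set \<Rightarrow> params \<Rightarrow> (nat list \<Rightarrow> complex) \<Rightarrow> nat set \<Rightarrow> nat list \<Rightarrow> complex" where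
  "antip P G q x A C = (\<Sum>D\<in>{D \<in> Om G. cls P (phi A D) = cls P C}. wt q C D * x D)"

text \<open>The first letter of \<open>D\<close> lies where the two parts meet, so it may belong to either.\<close>

lemma phi_toggle: "D \<noteq> [] \<Longrightarrow> distinct D \<Longrightarrow> hd D \<notin> A \<Longrightarrow> phi (insert (hd D) A) D = phi A D"
proof -
  assume D: "D \<noteq> []" "distinct D" "hd D \<notin> A"
  then obtain d D' where [simp]: "D = d # D'" by (cases D) auto
  have "restr (insert d A) D' = restr A D'" "restr (- insert d A) D' = restr (- A) D'"
    using D by (auto simp: restr_def intro!: filter_cong)
  then show ?thesis
    using D by (simp add: phi_def restr_def)
qed

lemma sum_alternating_toggle:
  fixes f :: "nat set \<Rightarrow> complex"
  assumes "finite G" "d \<in> G" "\<And>A. d \<notin> A \<Longrightarrow> f (insert d A) = f A"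
  shows "(\<Sum>A\<in>Pow G. (-1) ^ card A * f A) = 0"
proof -
  let ?G = "G - {d}"
  have "Pow G = Pow ?G \<union> insert d ` Pow ?G" "Pow ?G \<inter> insert d ` Pow ?G = {}"
    using assms(2) Pow_insert[of d ?G] by (auto simp: insert_absorb)
  then have "(\<Sum>A\<in>Pow G. (-1) ^ card A * f A) =
      (\<Sum>A\<in>Pow ?G. (-1) ^ card A * f A) + (\<Sum>A\<in>insert d ` Pow ?G. (-1) ^ card A * f A)"
    using assms(1) by (simp add: sum.union_disjoint)
  also have "(\<Sum>A\<in>insert d ` Pow ?G. (-1) ^ card A * f A) = (\<Sum>A\<in>Pow ?G. (-1) ^ card (insert d A) * f (insert d A))"
    by (subst sum.reindex) (auto simp: inj_on_def)
  also have "\<dots> = (\<Sum>A\<in>Pow ?G. - ((-1) ^ card A * f A))"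
  proof (rule sum.cong[OF refl])
    fix A assume A: "A \<in> Pow ?G"
    then have "finite A" "d \<notin> A" using assms(1) finite_subset by auto
    then show "(-1) ^ card (insert d A) * f (insert d A) = - ((-1) ^ card A * f A)"
      by (simp add: assms(3))
  qed
  finally show ?thesis by (simp add: sum_negf)
qed

text \<open>After exchanging the sums, \<open>D\<close> is fixed. Moving its first letter into or
  out of \<open>A\<close> changes the sign but not \<open>phi A D\<close>, so the terms cancel in
  pairs.\<close>

lemma antip_sum:
  assumes "finite G" "G \<noteq> {}"
  shows "(\<Sum>A\<in>Pow G. (-1) ^ card A * antip P G q x A C) = 0"
proof -
  have "antip P G q x A C = (\<Sum>D\<in>Om G. if cls P (phi A D) = cls P C then wt q C D * x D else 0)" for A
    unfolding antip_def by (rule sum.inter_filter) simp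
  then have "(\<Sum>A\<in>Pow G. (-1) ^ card A * antip P G q x A C) =
     (\<Sum>A\<in>Pow G. \<Sum>D\<in>Om G. (-1) ^ card A * (if cls P (phi A D) = cls P C then wt q C D * x D else 0))"
    by (simp only: sum_distrib_left)
  also have "\<dots> = (\<Sum>D\<in>Om G. \<Sum>A\<in>Pow G. (-1) ^ card A * (if cls P (phi A D) = cls P C then wt q C D * x D else 0))"
    by (rule sum.swap)
  also have "\<dots> = 0"
  proof (rule sum.neutral, rule ballI)
    fix D assume D: "D \<in> Om G"
    have "D \<noteq> []"
      using assms(2) OmD(1)[OF D] by auto
    then have "D \<noteq> []" "hd D \<in> G" "distinct D"
      using hd_in_set[of D] OmD[OF D] by blast+
    then show "(\<Sum>A\<in>Pow G. (-1) ^ card A * (if cls P (phi A D) = cls P C then wt q C D * x D else 0)) = 0"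
      by (intro sum_alternating_toggle[OF assms(1), of "hd D"]) (simp_all add: phi_toggle)
  qed
  finally show ?thesis .
qed

lemma antip_empty: "antip P G q x {} C = psi P G q x C"
  by (simp add: antip_def psi_def phi_def restr_def)

lemma antip_full:
  assumes q: "unit_on P q" and C: "C \<in> Om G"
  shows "antip P G q x G C = wt q C (rev C) * psi P G q x (rev C)"
proof -
  have "phi G D = rev D" if "D \<in> Om G" for D
    using OmD(1)[OF that] by (simp add: phi_def restr_id restr_empty)
  then have "cls P (phi G D) = cls P C \<longleftrightarrow> cls P D = cls P (rev C)" if "D \<in> Om G" for D
    using that cls_rev_eq[of P D C] by simp
  then have "{D \<in> Om G. cls P (phi G D) = cls P C} = {D \<in> Om G. cls P D = cls P (rev C)}"
    by blast
  then have "antip P G q x G C = (\<Sum>D\<in>{D \<in> Om G. cls P D = cls P (rev C)}. wt q C D * x D)"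
    by (simp add: antip_def)
  also have "\<dots> = wt q C (rev C) * psi P G q x (rev C)"
    unfolding psi_def sum_distrib_left
    by (rule sum.cong) (auto simp: wt_gate_right[OF q C _ rev_Om[OF C]])
  finally show ?thesis .
qed

lemma phi_Om: "D \<in> Om G \<Longrightarrow> A \<subseteq> G \<Longrightarrow> phi A D = rev (restr A D) @ restr (G - A) D"
proof -
  assume D: "D \<in> Om G"
  have "restr (- A) D = restr (G - A) D"
    using OmD(1)[OF D] by (auto simp: restr_def intro!: filter_cong)
  then show ?thesis by (simp add: phi_def)
qed

lemma cls_append_eq_iff:
  assumes u: "u \<in> Om A" "u' \<in> Om A" and w: "w \<in> Om B" "w' \<in> Om B" and dis: "A \<inter> B = {}"
  shows "cls P (u @ w) = cls P (u' @ w') \<longleftrightarrow> cls P u = cls P u' \<and> cls P w = cls P w'"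
proof
  assume *: "cls P (u @ w) = cls P (u' @ w')"
  show "cls P u = cls P u' \<and> cls P w = cls P w'"
    using arg_cong[OF *, of "\<lambda>X. X \<inter> A \<times> A"] arg_cong[OF *, of "\<lambda>X. X \<inter> B \<times> B"]
      restr_append_blocks[OF u(1) w(1) dis] restr_append_blocks[OF u(2) w(2) dis]
    unfolding cls_restr[symmetric] by simp
next
  assume "cls P u = cls P u' \<and> cls P w = cls P w'"
  then show "cls P (u @ w) = cls P (u' @ w')"
    using OmD(1)[OF u(1)] OmD(1)[OF u(2)] OmD(1)[OF w(1)] OmD(1)[OF w(2)] by (simp add: cls_append)
qed

text \<open>Edges between the blocks always leave \<open>A\<close> in \<open>phi A D\<close>, so its
  class is given by the classes of the two restrictions of \<open>D\<close>. The word
  \<open>u @ w\<close> is a gate between \<open>C\<close> and all these \<open>D\<close>, which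
  prepares for \<open>block_solve\<close>.\<close>

lemma antip_block:
  assumes q: "unit_on P q" and A: "A \<subseteq> G" and C: "C \<in> Om G"
    and u: "u \<in> Om A" and w: "w \<in> Om (G - A)" and eq: "cls P C = cls P (rev u @ w)"
  shows "antip P G q x A C = wt q C (u @ w) *
    (\<Sum>D\<in>{D \<in> Om G. cls P (restr A D) = cls P u \<and> cls P (restr (G - A) D) = cls P w}. wt q (u @ w) D * x D)"
proof -
  have dis: "A \<inter> (G - A) = {}" and GA: "G = A \<union> (G - A)" using A by auto
  have E: "u @ w \<in> Om G" using append_Om[OF u w dis] GA by simp
  have su: "set u = A" and sw: "set w = G - A" using OmD(1) u w by auto
  have eq2: "cls P (phi A D) = cls P C \<longleftrightarrow> cls P (restr A D) = cls P u \<and> cls P (restr (G - A) D) = cls P w"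
    if D: "D \<in> Om G" for D
  proof -
    have r: "rev (restr A D) \<in> Om A" "restr (G - A) D \<in> Om (G - A)"
      using restr_Om[OF D] A rev_Om by auto
    show ?thesis
      unfolding phi_Om[OF D A] eq cls_append_eq_iff[OF r(1) rev_Om[OF u] r(2) w dis]
      using cls_rev_eq[of P "restr A D" "rev u"] by simp
  qed
  have gate: "wt q C D = wt q C (u @ w) * wt q (u @ w) D"
    if D: "D \<in> Om G" and *: "cls P (restr A D) = cls P u \<and> cls P (restr (G - A) D) = cls P w" for D
  proof (rule wt_gate[OF C D E])
    fix a b assume CE: "(a, b) \<in> invs C (u @ w)" and DE: "(a, b) \<in> invs D (u @ w)"
    have ba: "(a, b) \<notin> ords (u @ w)"
      using CE Om_ords_asym[OF E] by (auto simp: invs_def)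
    have ab: "a \<in> G" "b \<in> G" using CE Om_ordsD[OF C] by (auto simp: invs_def)
    \<comment> \<open>An edge inside a block is ordered alike by \<open>D\<close> and
      \<open>u @ w\<close>; an edge between the blocks leaves \<open>A\<close> both in
      \<open>C\<close> and in \<open>u @ w\<close>. So \<open>u @ w\<close> cannot disagree with
      both on an edge.\<close>
    have "{a, b} \<in> P"
    proof (rule ccontr)
      assume nP: "{a, b} \<notin> P"
      have c: "(a, b) \<in> cls P (rev u @ w)" and d: "(a, b) \<in> cls P D"
        using CE DE nP eq by (auto simp: cls_def invs_def)
      show False
      proof (cases "a \<in> A")
        case True
        show False
        proof (cases "b \<in> A")
          case True
          then have "(a, b) \<in> cls P u"
            using d * \<open>a \<in> A\<close> by (auto simp: cls_restr)
          then show False using ba by (auto simp: cls_def ords_append)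
        next
          case False
          then show False using ba \<open>a \<in> A\<close> ab su sw by (auto simp: ords_append)
        qed
      next
        case False
        show False
        proof (cases "b \<in> A")
          case True
          then show False
            using c False Om_ordsD[OF u] Om_ordsD[OF w] su sw by (auto simp: cls_def ords_append ords_rev)
        next
          case False
          then have "(a, b) \<in> cls P w"
            using d * \<open>a \<notin> A\<close> ab by (auto simp: cls_restr)
          then show False using ba by (auto simp: cls_def ords_append)
        qed
      qed
    qed
    then show "sigma q a b = 1" using q by (auto simp: unit_on_def)
  qed
  have "{D \<in> Om G. cls P (phi A D) = cls P C} =
      {D \<in> Om G. cls P (restr A D) = cls P u \<and> cls P (restr (G - A) D) = cls P w}"
    using eq2 by blast
  then show ?thesis
    unfolding antip_def sum_distrib_left
    by (intro sum.cong) (auto simp: gate)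
qed

text \<open>A non-empty sum has some \<open>D\<close>, whose restrictions are taken as
  \<open>u\<close> and \<open>w\<close>. The last conclusion says in particular that
  \<open>A\<close> is a down-set of the orientation of \<open>C\<close>.\<close>

lemma antip_cases:
  assumes "A \<subseteq> G" "antip P G q x A C \<noteq> 0"
  obtains u w where "u \<in> Om A" "w \<in> Om (G - A)" "cls P C = cls P (rev u @ w)"
proof -
  have "{D \<in> Om G. cls P (phi A D) = cls P C} \<noteq> {}"
    using assms(2) unfolding antip_def by (metis sum.empty)
  then obtain D where D: "D \<in> Om G" "cls P (phi A D) = cls P C" by blast
  show ?thesis
    using that[of "restr A D" "restr (G - A) D"] restr_Om[OF D(1)] D(2) phi_Om[OF D(1) assms(1)] assms(1) by auto
qed

text \<open>Ordered pairs: each unordered pair contributes one factor \<^term>\<open>sigma q a b\<close>.\<close>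

definition sigma_prod :: "params \<Rightarrow> nat set \<Rightarrow> complex" where
  "sigma_prod q G = (\<Prod>(a, b)\<in>G \<times> G - Id. q a b)"

text \<open>Reversal inverts every pair, and the two factors count it in opposite directions. This
  is the scalar of the squared antipode.\<close>

lemma wt_rev_mult:
  assumes "C \<in> Om G"
  shows "wt q C (rev C) * wt q (rev C) C = sigma_prod q G"
proof -
  have "invs C (rev C) = ords C" "invs (rev C) C = (ords C)\<inverse>"
    by (auto simp: invs_def ords_rev)
  moreover have "G \<times> G - Id = ords C \<union> (ords C)\<inverse>"
    using Om_ords_total[OF assms] Om_ordsD[OF assms] Om_ords_irrefl[OF assms] by auto
  moreover have "ords C \<inter> (ords C)\<inverse> = {}"
    using Om_ords_asym[OF assms] by auto
  ultimately show ?thesis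
    unfolding sigma_prod_def wt_def by (simp add: prod.union_disjoint)
qed

lemma antip_boundary:
  assumes q: "unit_on P q" and G: "finite G" "G \<noteq> {}" and C: "C \<in> Om G"
  shows "psi P G q x C + (-1) ^ card G * (wt q C (rev C) * psi P G q x (rev C)) =
    - (\<Sum>A\<in>Pow G - {{}, G}. (-1) ^ card A * antip P G q x A C)"
proof -
  have "(\<Sum>A\<in>Pow G. (-1) ^ card A * antip P G q x A C) =
     (\<Sum>A\<in>{{}, G}. (-1) ^ card A * antip P G q x A C) + (\<Sum>A\<in>Pow G - {{}, G}. (-1) ^ card A * antip P G q x A C)"
    using G by (intro sum.subset_diff[THEN trans[OF _ add.commute]]) auto
  moreover have "(\<Sum>A\<in>{{}, G}. (-1) ^ card A * antip P G q x A C) =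
     psi P G q x C + (-1) ^ card G * (wt q C (rev C) * psi P G q x (rev C))"
    using G(2) by (simp add: antip_empty antip_full[OF q C])
  ultimately show ?thesis
    using antip_sum[OF G, of P q x C] by (simp add: eq_neg_iff_add_eq_0)
qed

text \<open>The condition is restricted to sets with an edge: on a set without edges the product is
  1, but there is only one class and \<open>psi\<close> coincides with \<open>S_app\<close>.\<close>

theorem nondeg_criterion:
  assumes q: "unit_on P q" and "finite G"
    and "\<And>H. H \<subseteq> G \<Longrightarrow> \<exists>a\<in>H. \<exists>b\<in>H. a \<noteq> b \<and> {a, b} \<notin> P \<Longrightarrow> sigma_prod q H \<noteq> 1"
  shows "nondeg P G q"
  using assms(2,3)
proof (induction G rule: finite_psubset_induct)
  case (psubset G)
  have IH: "nondeg P A q" if "A \<subset> G" for A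
    using psubset.IH[OF that] psubset.prems that by blast
  show ?case
    unfolding nondeg_def
  proof (intro allI impI ballI)
    fix x C assume Sx: "\<forall>C\<in>Om G. S_app G q x C = 0" and C: "C \<in> Om G"
    show "psi P G q x C = 0"
    proof (cases "\<exists>a\<in>G. \<exists>b\<in>G. a \<noteq> b \<and> {a, b} \<notin> P")
      case False
      then have "cls P D = cls P C" if "D \<in> Om G" for D
        using that C Om_ordsD[OF C] Om_ords_irrefl[OF C] unfolding cls_eq_iff[OF that C] invs_def
        by (metis IntE Om_ordsD Om_ords_irrefl)
      then have "{D \<in> Om G. cls P D = cls P C} = Om G" by blast
      then show ?thesis using Sx C by (simp add: psi_def S_app_def)
    next
      case True
      then have sig: "sigma_prod q G \<noteq> 1" and ne: "G \<noteq> {}" using psubset.prems by auto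
      \<comment> \<open>A proper non-empty \<open>A\<close> has nondegenerate blocks. Their
        solutions express \<open>antip\<close> through the values
        \<open>S_app G q x (u' @ w')\<close>, all of which vanish.\<close>
      have zero: "antip P G q x A E = 0" if A: "A \<in> Pow G - {{}, G}" and E: "E \<in> Om G" for A E
      proof (rule ccontr)
        assume "antip P G q x A E \<noteq> 0"
        have sub: "A \<subset> G" "G - A \<subset> G" using A by auto
        then obtain u w where uw: "u \<in> Om A" "w \<in> Om (G - A)" "cls P E = cls P (rev u @ w)"
          using antip_cases \<open>antip P G q x A E \<noteq> 0\<close> by blast
        have fA: "finite A" "finite (G - A)" using sub psubset.hyps finite_subset by auto
        obtain lA where lA: "\<And>a. a \<in> Om A \<Longrightarrow> (\<Sum>u'\<in>Om A. lA u' * wt q u' a) = (if cls P a = cls P u then wt q u a else 0)"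
          using nondeg_solve_left[OF q fA(1) IH[OF sub(1)] uw(1)] by metis
        obtain lB where lB: "\<And>a. a \<in> Om (G - A) \<Longrightarrow> (\<Sum>w'\<in>Om (G - A). lB w' * wt q w' a) =
            (if cls P a = cls P w then wt q w a else 0)"
          using nondeg_solve_left[OF q fA(2) IH[OF sub(2)] uw(2)] by metis
        have "u' @ w' \<in> Om G" if "u' \<in> Om A" "w' \<in> Om (G - A)" for u' w'
          using append_Om[OF that] sub by (simp add: Un_absorb1)
        then have "(\<Sum>u'\<in>Om A. \<Sum>w'\<in>Om (G - A). lA u' * lB w' * S_app G q x (u' @ w')) = 0"
          using Sx by (intro sum.neutral ballI) simp
        then show False
          using \<open>antip P G q x A E \<noteq> 0\<close> antip_block[OF q psubset_imp_subset[OF sub(1)] E uw, of x]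
            block_solve[OF psubset.hyps psubset_imp_subset[OF sub(1)] uw(1,2) lA lB, of x] by simp
      qed
      have rel: "psi P G q x E = - ((-1) ^ card G * (wt q E (rev E) * psi P G q x (rev E)))" if "E \<in> Om G" for E
        using antip_boundary[OF q psubset.hyps ne that, of x] zero[OF _ that]
        by (simp add: eq_neg_iff_add_eq_0)
      let ?s = "(-1) ^ card G :: complex"
      \<comment> \<open>Two applications of \<open>rel\<close> return to \<open>C\<close>: the signs
        cancel and the weights multiply to \<open>sigma_prod q G\<close>.\<close>
      have "psi P G q x C = - (?s * (wt q C (rev C) * psi P G q x (rev C)))"
        using rel[OF C] .
      also have "psi P G q x (rev C) = - (?s * (wt q (rev C) C * psi P G q x C))"
        using rel[OF rev_Om[OF C]] by simp
      also have "- (?s * (wt q C (rev C) * - (?s * (wt q (rev C) C * psi P G q x C)))) =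
          (?s * ?s) * ((wt q C (rev C) * wt q (rev C) C) * psi P G q x C)"
        by (simp only: mult_minus_right minus_minus mult_ac)
      also have "?s * ?s = 1" by (simp flip: power_mult_distrib)
      finally have "psi P G q x C = sigma_prod q G * psi P G q x C"
        unfolding wt_rev_mult[OF C] by simp
      then show ?thesis using sig by simp
    qed
  qed
qed

section \<open>Bipolar orientations\<close>

text \<open>An st-numbering of the vertices in \<open>L\<close>, that is, a linear extension of an
  acyclic orientation with unique source \<open>s\<close> and unique sink \<open>t\<close>.\<close>

definition bipolar :: "nat set set \<Rightarrow> nat \<Rightarrow> nat \<Rightarrow> nat list \<Rightarrow> bool" where
  "bipolar P s t L \<longleftrightarrow> distinct L \<and> s \<in> set L \<and> t \<in> set L \<and>
    (\<forall>c\<in>set L. c \<noteq> s \<longrightarrow> (\<exists>d. (d, c) \<in> ords L \<and> {d, c} \<notin> P)) \<and>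
    (\<forall>c\<in>set L. c \<noteq> t \<longrightarrow> (\<exists>d. (c, d) \<in> ords L \<and> {c, d} \<notin> P))"

text \<open>A separation of order at most one. On three or more vertices its absence means that
  \<Gamma> is 2-connected.\<close>

definition separable :: "nat set set \<Rightarrow> nat set \<Rightarrow> bool" where
  "separable P G \<longleftrightarrow> (\<exists>A B v. A \<union> B = G \<and> A \<noteq> G \<and> B \<noteq> G \<and> A \<inter> B \<subseteq> {v} \<and>
    (\<forall>a\<in>A - B. \<forall>b\<in>B - A. {a, b} \<in> P))"

lemma ords_trans: "distinct w \<Longrightarrow> (a, b) \<in> ords w \<Longrightarrow> (b, c) \<in> ords w \<Longrightarrow> (a, c) \<in> ords w"
  using ords_subset by (induction w) auto

lemma bipolar_rev: "bipolar P s t L \<Longrightarrow> bipolar P t s (rev L)"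
  unfolding bipolar_def by (auto simp: ords_rev insert_commute)

lemma rtrancl_path:
  assumes "(x, y) \<in> R\<^sup>*"
  obtains xs where "distinct xs" "xs \<noteq> []" "hd xs = x" "last xs = y"
    "successively (\<lambda>a b. (a, b) \<in> R) xs" "set xs \<subseteq> R\<^sup>* `` {x}"
proof -
  from assms have "\<exists>xs. distinct xs \<and> xs \<noteq> [] \<and> hd xs = x \<and> last xs = y \<and>
    successively (\<lambda>a b. (a, b) \<in> R) xs \<and> set xs \<subseteq> R\<^sup>* `` {x}"
  proof (induction rule: rtrancl_induct)
    case base
    then show ?case by (intro exI[of _ "[x]"]) auto
  next
    case (step y z)
    then obtain xs where xs: "distinct xs" "xs \<noteq> []" "hd xs = x" "last xs = y"
      "successively (\<lambda>a b. (a, b) \<in> R) xs" "set xs \<subseteq> R\<^sup>* `` {x}" by blast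
    show ?case
    proof (cases "z \<in> set xs")
      case False
      have "(x, z) \<in> R\<^sup>*" using step by auto
      then show ?thesis
        using xs False step.hyps(2) by (intro exI[of _ "xs @ [z]"]) (auto simp: successively_append_iff)
    next
      \<comment> \<open>The walk returns to a visited vertex and is cut at the earlier visit, which
        already ends in \<open>z\<close>.\<close>
      case True
      then obtain us vs where "xs = us @ z # vs" by (auto dest: split_list)
      then have "xs = (us @ [z]) @ vs" by simp
      then show ?thesis
        using xs by (intro exI[of _ "us @ [z]"]) (auto simp: successively_append_iff hd_append split: if_splits)
    qed
  qed
  then show ?thesis using that by blast
qed

text \<open>Ear insertion: a path outside \<open>L\<close> between two vertices of \<open>L\<close> may be inserted just after the
  earlier of the two.\<close>

lemma bipolar_insert:
  assumes L: "bipolar P s t (pre @ a # post)" and b: "b \<in> set post"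
    and xs: "distinct xs" "xs \<noteq> []" "set xs \<inter> set (pre @ a # post) = {}"
      "successively (\<lambda>x y. {x, y} \<notin> P) xs"
    and ends: "{a, hd xs} \<notin> P" "{last xs, b} \<notin> P"
  shows "bipolar P s t (pre @ a # xs @ post)"
proof -
  let ?L = "pre @ a # post" and ?M = "pre @ a # xs @ post"
  have sub: "ords ?L \<subseteq> ords ?M" by (auto simp: ords_append)
  have d: "distinct ?M" using L xs(1,3) unfolding bipolar_def by auto
  have st: "s \<in> set ?L" "t \<in> set ?L"
    and lo: "\<And>c. c \<in> set ?L \<Longrightarrow> c \<noteq> s \<Longrightarrow> \<exists>d. (d, c) \<in> ords ?L \<and> {d, c} \<notin> P"
    and hi: "\<And>c. c \<in> set ?L \<Longrightarrow> c \<noteq> t \<Longrightarrow> \<exists>d. (c, d) \<in> ords ?L \<and> {c, d} \<notin> P"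
    using L unfolding bipolar_def by blast+
  have lo': "\<exists>d. (d, c) \<in> ords ?M \<and> {d, c} \<notin> P" and hi': "\<exists>d. (c, d) \<in> ords ?M \<and> {c, d} \<notin> P"
    if c: "c \<in> set xs" for c
  proof -
    obtain us vs where us: "xs = us @ c # vs" using c by (auto dest: split_list)
    show "\<exists>d. (d, c) \<in> ords ?M \<and> {d, c} \<notin> P"
    proof (cases "us = []")
      case True
      then show ?thesis using ends(1) us by (intro exI[of _ a]) (auto simp: ords_append)
    next
      case False
      then have "{last us, c} \<notin> P"
        using xs(4) us by (auto simp: successively_append_iff)
      then show ?thesis using us False by (intro exI[of _ "last us"]) (auto simp: ords_append)
    qed
    show "\<exists>d. (c, d) \<in> ords ?M \<and> {c, d} \<notin> P"
    proof (cases "vs = []")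
      case True
      then show ?thesis using ends(2) us b by (intro exI[of _ b]) (auto simp: ords_append)
    next
      case False
      then obtain d ws where "vs = d # ws" by (cases vs) auto
      then have "{c, d} \<notin> P" "(c, d) \<in> ords ?M"
        using xs(4) us by (auto simp: successively_append_iff ords_append)
      then show ?thesis by blast
    qed
  qed
  have mem: "c \<in> set ?M \<longleftrightarrow> c \<in> set ?L \<or> c \<in> set xs" for c by auto
  have "\<exists>d. (d, c) \<in> ords ?M \<and> {d, c} \<notin> P" if "c \<in> set ?M" "c \<noteq> s" for c
    using that lo[of c] lo'[of c] sub unfolding mem by blast
  moreover have "\<exists>d. (c, d) \<in> ords ?M \<and> {c, d} \<notin> P" if "c \<in> set ?M" "c \<noteq> t" for c
    using that hi[of c] hi'[of c] sub unfolding mem by blast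
  ultimately show ?thesis
    using d st mem unfolding bipolar_def by blast
qed

text \<open>A longest bipolar ordering inside \<open>G\<close> misses no vertex. A component
  \<open>K\<close> of the remaining vertices has at least two neighbours in \<open>L\<close>, as
  otherwise they would separate it; a path through \<open>K\<close> between two of them is an ear,
  and its insertion gives a longer ordering.\<close>

lemma bipolar_exists:
  assumes G: "finite G" "s \<in> G" "t \<in> G" "s \<noteq> t" "{s, t} \<notin> P" and ns: "\<not> separable P G"
  obtains L where "bipolar P s t L" "set L = G"
proof -
  let ?Q = "\<lambda>L. bipolar P s t L \<and> set L \<subseteq> G"
  \<comment> \<open>The edge between \<open>s\<close> and \<open>t\<close> is the initial bipolar
    ordering.\<close>
  have "?Q [s, t]" using G by (auto simp: bipolar_def)
  moreover have "length L < Suc (card G)" if "?Q L" for L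
    using that G(1) card_mono[OF G(1), of "set L"] distinct_card[of L] by (auto simp: bipolar_def)
  ultimately have "\<exists>L. ?Q L \<and> (\<forall>L'. ?Q L' \<longrightarrow> length L' \<le> length L)"
    using ex_has_greatest_nat[of ?Q "[s, t]" length "Suc (card G)"] by blast
  then obtain L where L: "?Q L" and max: "\<And>L'. ?Q L' \<Longrightarrow> length L' \<le> length L" by blast
  have "set L = G"
  proof (rule ccontr)
    assume "set L \<noteq> G"
    then obtain k where k: "k \<in> G" "k \<notin> set L" using L by auto
    define R where "R = {(a, b). a \<in> G - set L \<and> b \<in> G - set L \<and> {a, b} \<notin> P}"
    define K where "K = R\<^sup>* `` {k}"
    define U where "U = {a \<in> set L. \<exists>c\<in>K. {a, c} \<notin> P}"
    have KG: "K \<subseteq> G - set L"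
    proof
      fix c assume "c \<in> K"
      then have "(k, c) \<in> R\<^sup>*" by (simp add: K_def)
      then show "c \<in> G - set L" using k by (induction rule: rtrancl_induct) (auto simp: R_def)
    qed
    have kK: "k \<in> K" by (simp add: K_def)
    \<comment> \<open>\<open>U\<close> consists of the neighbours of \<open>K\<close> in
      \<open>L\<close>. If it had at most one element, \<open>K \<union> U\<close> and
      \<open>G - K\<close> would be a separation; the first is proper since \<open>s\<close> and
      \<open>t\<close> cannot both belong to \<open>U\<close>.\<close>
    have "\<not> (\<exists>v. U \<subseteq> {v})"
    proof
      assume "\<exists>v. U \<subseteq> {v}"
      then obtain v where v: "U \<subseteq> {v}" by blast
      have "{a, b} \<in> P" if "a \<in> K" "b \<in> G - K - U" for a b
      proof (cases "b \<in> set L")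
        case True
        then show ?thesis using that by (auto simp: U_def insert_commute)
      next
        case False
        show ?thesis
        proof (rule ccontr)
          assume "{a, b} \<notin> P"
          then have "(a, b) \<in> R" using that KG False by (auto simp: R_def)
          then have "b \<in> K" using that by (auto simp: K_def intro: rtrancl_into_rtrancl)
          then show False using that by auto
        qed
      qed
      moreover have "(K \<union> U) \<inter> (G - K) \<subseteq> {v}" using v by auto
      moreover have "(K \<union> U) \<union> (G - K) = G" "G - K \<noteq> G" using KG kK L k by (auto simp: U_def)
      moreover have "K \<union> U \<noteq> G"
      proof
        assume "K \<union> U = G"
        then have "s \<in> U" "t \<in> U" using L KG by (auto simp: bipolar_def)
        then show False using v G(4) by auto
      qed
      moreover have "(K \<union> U) - (G - K) \<subseteq> K" using KG L by (auto simp: U_def)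
      ultimately have "separable P G"
        unfolding separable_def by (intro exI[of _ "K \<union> U"] exI[of _ "G - K"] exI[of _ v]) auto
      then show False using ns by simp
    qed
    then have "U \<noteq> {}" by auto
    then obtain a0 where "a0 \<in> U" by auto
    then obtain b0 where "b0 \<in> U" "a0 \<noteq> b0"
      using \<open>\<not> (\<exists>v. U \<subseteq> {v})\<close> by (metis singletonD singletonI subsetI)
    then have "\<exists>a b. a \<in> U \<and> b \<in> U \<and> (a, b) \<in> ords L"
      using \<open>a0 \<in> U\<close> ords_total[of a0 L b0] by (auto simp: U_def)
    then obtain a b where ab: "a \<in> U" "b \<in> U" "(a, b) \<in> ords L" by blast
    then obtain c d where cd: "c \<in> K" "{a, c} \<notin> P" "d \<in> K" "{b, d} \<notin> P"
      by (auto simp: U_def)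
    have "sym R" by (auto simp: sym_def R_def insert_commute)
    then have "(c, d) \<in> R\<^sup>*"
      using cd(1,3) symD[OF sym_rtrancl[OF \<open>sym R\<close>], of k c] by (auto simp: K_def)
    then obtain xs where xs: "distinct xs" "xs \<noteq> []" "hd xs = c" "last xs = d"
      "successively (\<lambda>a b. (a, b) \<in> R) xs" "set xs \<subseteq> R\<^sup>* `` {c}"
      by (rule rtrancl_path)
    have "R\<^sup>* `` {c} \<subseteq> K" using cd by (auto simp: K_def intro: rtrancl_trans)
    then have xK: "set xs \<subseteq> G - set L" using xs(6) KG by blast
    have "successively (\<lambda>x y. {x, y} \<notin> P) xs"
      by (rule successively_mono[OF xs(5)]) (auto simp: R_def)
    moreover obtain pre post where split: "L = pre @ a # post"
      using ab(1) by (auto simp: U_def dest: split_list)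
    moreover have "b \<in> set post"
      using ab(3) L ords_subset[of pre] ords_subset[of post] unfolding split
      by (auto simp: bipolar_def ords_append)
    ultimately have "bipolar P s t (pre @ a # xs @ post)"
      using L xs cd xK by (intro bipolar_insert) (auto simp: insert_commute)
    moreover have "set (pre @ a # xs @ post) \<subseteq> G" using L xK split by auto
    ultimately have "length (pre @ a # xs @ post) \<le> length L" using max by blast
    then show False using split xs(2) by simp
  qed
  then show ?thesis using that L by blast
qed

section \<open>Paths from source to sink\<close>

text \<open>Each vertex other than \<open>t\<close> has a later neighbour; the induction runs over
  suffixes of \<open>L\<close>, in which that neighbour lies further to the right.\<close>

lemma bipolar_ascending_path:
  assumes "bipolar P s t L" "c \<in> set L"
  obtains xs where "xs \<noteq> []" "hd xs = c" "last xs = t" "set xs \<subseteq> set L"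
    "successively (\<lambda>a b. (a, b) \<in> ords L \<and> {a, b} \<notin> P) xs"
proof -
  let ?E = "\<lambda>a b. (a, b) \<in> ords L \<and> {a, b} \<notin> P"
  have "\<exists>xs. xs \<noteq> [] \<and> hd xs = c \<and> last xs = t \<and> set xs \<subseteq> set L \<and> successively ?E xs"
    if "L = pre @ suf" "c \<in> set suf" for pre suf c
    using that
  proof (induction suf arbitrary: pre c)
    case (Cons e suf)
    show ?case
    proof (cases "c = t \<or> c \<in> set suf")
      case True
      then show ?thesis
      proof
        assume "c = t"
        then show ?thesis using assms(1) by (intro exI[of _ "[t]"]) (auto simp: bipolar_def)
      next
        assume "c \<in> set suf"
        then show ?thesis using Cons.IH[of "pre @ [e]" c] Cons.prems by simp
      qed
    next
      case False
      then have c: "c = e" "c \<noteq> t" "c \<in> set L" using Cons.prems by auto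
      then obtain d where d: "(c, d) \<in> ords L" "{c, d} \<notin> P" using assms(1) by (auto simp: bipolar_def)
      have "d \<in> set suf"
        using d(1) assms(1) ords_subset[of pre] ords_subset[of suf] unfolding Cons.prems(1) c(1)
        by (auto simp: bipolar_def ords_append)
      then obtain xs where "xs \<noteq> []" "hd xs = d" "last xs = t" "set xs \<subseteq> set L" "successively ?E xs"
        using Cons.IH[of "pre @ [e]" d] Cons.prems by auto
      then show ?thesis
        using d c by (intro exI[of _ "c # xs"]) (auto simp: successively_Cons)
    qed
  qed simp
  from this[of "[]" L c] show ?thesis using assms(2) that by auto
qed

text \<open>Ascend from \<open>c\<close> to \<open>t\<close>, and in the reversed ordering from
  \<open>c\<close> to \<open>s\<close>. The joined walk is increasing along \<open>L\<close>, which
  makes its vertices distinct.\<close>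

lemma bipolar_path:
  assumes L: "bipolar P s t L" and c: "c \<in> set L"
  obtains xs where "distinct xs" "set xs \<subseteq> set L" "xs \<noteq> []" "hd xs = s" "last xs = t" "c \<in> set xs"
    "successively (\<lambda>a b. {a, b} \<notin> P) xs"
proof -
  let ?E = "\<lambda>a b. (a, b) \<in> ords L \<and> {a, b} \<notin> P"
  obtain xs where xs: "xs \<noteq> []" "hd xs = c" "last xs = t" "set xs \<subseteq> set L" "successively ?E xs"
    using bipolar_ascending_path[OF L c] by blast
  have "c \<in> set (rev L)" using c by simp
  then obtain ys where ys: "ys \<noteq> []" "hd ys = c" "last ys = s" "set ys \<subseteq> set (rev L)"
      "successively (\<lambda>a b. (a, b) \<in> ords (rev L) \<and> {a, b} \<notin> P) ys"
    by (rule bipolar_ascending_path[OF bipolar_rev[OF L]])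
  obtain xs' where xs': "xs = c # xs'" using xs by (cases xs) auto
  let ?zs = "rev ys @ xs'"
  have "successively ?E (rev ys)"
    unfolding successively_rev by (rule successively_mono[OF ys(5)]) (auto simp: ords_rev insert_commute)
  then have zs: "successively ?E ?zs"
    using xs(5) ys unfolding xs' by (auto simp: successively_append_iff successively_Cons last_rev)
  have d: "distinct L" using L by (simp add: bipolar_def)
  have "successively (\<lambda>a b. (a, b) \<in> ords L) ?zs"
    by (rule successively_mono[OF zs]) auto
  moreover have "transp (\<lambda>a b. (a, b) \<in> ords L)"
    using ords_trans[OF d] by (auto simp: transp_def)
  ultimately have "sorted_wrt (\<lambda>a b. (a, b) \<in> ords L) ?zs"
    using successively_conv_sorted_wrt by blast
  moreover have "(a, a) \<notin> ords L" for a using ords_asym[OF d] by blast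
  ultimately have "distinct ?zs"
    unfolding distinct_conv_nth sorted_wrt_iff_nth_less by (metis nat_neq_iff)
  moreover have "successively (\<lambda>a b. {a, b} \<notin> P) ?zs"
    by (rule successively_mono[OF zs]) auto
  moreover have "hd ?zs = s" "last ?zs = t" "c \<in> set ?zs" "?zs \<noteq> []" "set ?zs \<subseteq> set L"
    using xs ys unfolding xs' by (auto simp: hd_append hd_rev last_rev last_append)
  ultimately show ?thesis using that by blast
qed

text \<open>Read backwards from \<open>i\<close>, the path can leave \<open>A - B\<close> only into
  \<open>A \<inter> B\<close>, since no edge leads to \<open>B - A\<close>.\<close>

lemma path_enters_cut:
  assumes "successively (\<lambda>a b. {a, b} \<notin> P) (zs @ [i])" "set zs \<subseteq> A \<union> B" "zs \<noteq> []" "hd zs \<in> B"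
    "i \<in> A - B" "\<And>a b. a \<in> A - B \<Longrightarrow> b \<in> B - A \<Longrightarrow> {a, b} \<in> P"
  shows "set zs \<inter> (A \<inter> B) \<noteq> {}"
  using assms(1-5)
proof (induction zs arbitrary: i rule: rev_induct)
  case (snoc z zs)
  have zi: "{z, i} \<notin> P" using snoc.prems(1) by (simp add: successively_append_iff)
  then have zA: "z \<in> A"
    using snoc.prems assms(6)[of i z] by (auto simp: insert_commute)
  show ?case
  proof (cases "z \<in> B")
    case True
    then show ?thesis using zA by auto
  next
    case False
    then have "zs \<noteq> []" using snoc.prems by auto
    then have "set zs \<inter> (A \<inter> B) \<noteq> {}"
      using snoc.IH[of z] snoc.prems zA False by (auto simp: successively_append_iff)
    then show ?thesis by auto
  qed
qed simp

text \<open>The edge between \<open>s\<close> and \<open>t\<close> puts both on one side of a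
  separation. A path through a vertex strictly on the other side crosses the cut before and after
  it, so it would visit the only cut vertex twice.\<close>

lemma paths_imp_not_separable:
  assumes st: "s \<in> G" "t \<in> G" "{s, t} \<notin> P"
    and paths: "\<And>i. i \<in> G \<Longrightarrow> \<exists>xs. distinct xs \<and> set xs \<subseteq> G \<and> xs \<noteq> [] \<and> hd xs = s \<and> last xs = t \<and>
      i \<in> set xs \<and> successively (\<lambda>a b. {a, b} \<notin> P) xs"
  shows "\<not> separable P G"
proof
  assume "separable P G"
  then obtain A B v where AB: "A \<union> B = G" "A \<noteq> G" "B \<noteq> G" "A \<inter> B \<subseteq> {v}"
    and cross: "\<And>a b. a \<in> A - B \<Longrightarrow> b \<in> B - A \<Longrightarrow> {a, b} \<in> P"
    unfolding separable_def by blast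
  have main: False if AB: "A \<union> B = G" "B \<noteq> G" "A \<inter> B \<subseteq> {v}"
    and cross: "\<And>a b. a \<in> A - B \<Longrightarrow> b \<in> B - A \<Longrightarrow> {a, b} \<in> P" and stB: "s \<in> B" "t \<in> B" for A B
  proof -
    obtain i where i: "i \<in> A - B" "i \<in> G" using AB by blast
    obtain xs where xs: "distinct xs" "set xs \<subseteq> G" "xs \<noteq> []" "hd xs = s" "last xs = t" "i \<in> set xs"
      and E: "successively (\<lambda>a b. {a, b} \<notin> P) xs"
      using paths[OF i(2)] by blast
    obtain us vs where split: "xs = us @ i # vs" using xs(6) by (auto dest: split_list)
    have ne: "us \<noteq> []" "vs \<noteq> []" using xs(4,5) stB i split by auto
    have "successively (\<lambda>a b. {a, b} \<notin> P) (us @ [i])"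
      using E unfolding split by (auto simp: successively_append_iff)
    then have "set us \<inter> (A \<inter> B) \<noteq> {}"
      using xs(2,4) ne stB i(1) AB(1) split by (intro path_enters_cut[OF _ _ _ _ i(1) cross]) auto
    moreover have "successively (\<lambda>a b. {a, b} \<notin> P) (rev vs @ [i])"
    proof -
      have "successively (\<lambda>a b. {a, b} \<notin> P) (i # vs)"
        using E unfolding split by (auto simp: successively_append_iff)
      then have "successively (\<lambda>a b. {b, a} \<notin> P) (i # vs)"
        by (rule successively_mono) (auto simp: insert_commute)
      then have "successively (\<lambda>a b. {a, b} \<notin> P) (rev (i # vs))"
        by (simp only: successively_rev)
      then show ?thesis by simp
    qed
    then have "set (rev vs) \<inter> (A \<inter> B) \<noteq> {}"
      using xs(2,5) ne stB i(1) AB(1) split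
      by (intro path_enters_cut[OF _ _ _ _ i(1) cross]) (auto simp: hd_rev)
    ultimately have "v \<in> set us" "v \<in> set vs" using AB(3) by auto
    then show False using xs(1) split by auto
  qed
  have cross': "\<And>a b. a \<in> B - A \<Longrightarrow> b \<in> A - B \<Longrightarrow> {a, b} \<in> P"
    using cross by (metis insert_commute)
  have "s \<in> B \<and> t \<in> B \<or> s \<in> A \<and> t \<in> A"
    using st AB(1) cross[of s t] cross'[of s t] by blast
  then show False
    using main[OF AB(1,3,4) cross] main[of B A] AB cross' by (auto simp: Un_commute Int_commute)
qed

section \<open>Degeneracy where the product is one\<close>

lemma norm_prod_small:
  fixes f :: "'a \<Rightarrow> complex"
  assumes "finite X" "i \<in> X" "norm (f i) \<le> d" "\<And>j. j \<in> X \<Longrightarrow> norm (f j) \<le> 1"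
  shows "norm (prod f X) \<le> d"
proof -
  have "norm (prod f X) = norm (f i) * norm (prod f (X - {i}))"
    using assms(1,2) by (simp add: prod.remove norm_mult)
  also have "norm (prod f (X - {i})) \<le> 1"
    unfolding prod_norm[symmetric] by (intro prod_le_1) (use assms(4) in auto)
  then have "norm (f i) * norm (prod f (X - {i})) \<le> d * 1"
    using assms(3) by (intro mult_mono) (auto intro: order_trans[OF norm_ge_zero])
  finally show ?thesis by simp
qed

lemma wt_small:
  assumes d: "0 < d" "d \<le> 1"
    and q: "\<And>a b. (a, b) \<in> invs X Y \<Longrightarrow> q a b = (if {a, b} \<in> P then 1 else complex_of_real d)"
    and ab: "(a, b) \<in> invs X Y" "{a, b} \<notin> P"
  shows "norm (wt q X Y) \<le> d"
  unfolding wt_def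
  by (rule norm_prod_small[OF _ ab(1)]) (use q ab d in auto)

text \<open>The reduced matrix has diagonal 1 and small other entries, so \<open>l\<close> is close
  to a unit vector. If \<mu> is its largest absolute value, the deviation is at most \<mu>/4; hence
  \<mu> \<le> 1 + \<mu>/4, that is \<mu> \<le> 4/3, and the deviation is at most 1/3.\<close>

lemma near_identity_solve:
  fixes d :: real
  assumes fin: "finite A" and u: "u \<in> Om A"
    and q1: "\<And>w a. w \<in> Om A \<Longrightarrow> a \<in> Om A \<Longrightarrow> cls P w = cls P a \<Longrightarrow> wt q w a = 1"
    and qd: "\<And>w a. w \<in> Om A \<Longrightarrow> a \<in> Om A \<Longrightarrow> cls P w \<noteq> cls P a \<Longrightarrow> norm (wt q w a) \<le> d"
    and d: "0 < d" "card (Om A) * d \<le> 1 / 4"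
    and l0: "\<And>w. w \<notin> set (reps P A) \<Longrightarrow> l w = 0"
    and l: "\<And>a. a \<in> Om A \<Longrightarrow> (\<Sum>w\<in>Om A. l w * wt q w a) = (if cls P a = cls P u then wt q u a else 0)"
    and z: "z \<in> Om A"
  shows "norm ((\<Sum>w\<in>{w \<in> Om A. cls P w = cls P z}. l w) - (if cls P z = cls P u then 1 else 0)) \<le> 1 / 3"
proof -
  let ?R = "set (reps P A)"
  define \<mu> where "\<mu> = Max ((\<lambda>w. norm (l w)) ` ?R)"
  have ne: "?R \<noteq> {}" using rep_in_reps[OF fin u, of P] by auto
  have \<mu>: "norm (l w) \<le> \<mu>" if "w \<in> ?R" for w
    unfolding \<mu>_def using that by (intro Max_ge) auto
  have RO: "r \<in> Om A" if "r \<in> ?R" for r using set_reps_Om[OF fin that] .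
  obtain r0 where "r0 \<in> ?R" using ne by (meson ex_in_conv)
  then have "0 \<le> \<mu>" using order_trans[OF norm_ge_zero \<mu>] by blast
  have dev: "norm (l r - (if cls P r = cls P u then 1 else 0)) \<le> card (Om A) * d * \<mu>" if r: "r \<in> ?R" for r
  proof -
    have rO: "r \<in> Om A" using RO[OF r] .
    have "(\<Sum>w\<in>Om A. l w * wt q w r) = (\<Sum>w\<in>?R. l w * wt q w r)"
      by (rule sum_Om_reps[OF fin]) (simp add: l0)
    also have "\<dots> = l r + (\<Sum>w\<in>?R - {r}. l w * wt q w r)"
      using r rO by (simp add: sum.remove wt_self)
    finally have "l r - (if cls P r = cls P u then 1 else 0) = - (\<Sum>w\<in>?R - {r}. l w * wt q w r)"
      using l[OF rO] q1[OF u rO] by (simp add: algebra_simps split: if_splits)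
    also have "norm \<dots> \<le> (\<Sum>w\<in>?R - {r}. \<mu> * d)"
      unfolding norm_minus_cancel
    proof (rule sum_norm_le)
      fix w assume w: "w \<in> ?R - {r}"
      then have "cls P w \<noteq> cls P r"
        using rep_reps[OF fin, of _ P] r by (metis DiffD1 DiffD2 rep_eq singletonI)
      then have "norm (wt q w r) \<le> d" using qd RO w rO by auto
      then show "norm (l w * wt q w r) \<le> \<mu> * d"
        unfolding norm_mult using \<mu> w \<open>0 \<le> \<mu>\<close> by (intro mult_mono) auto
    qed
    also have "\<dots> = card (?R - {r}) * (\<mu> * d)" by simp
    also have "\<dots> \<le> card (Om A) * (\<mu> * d)"
      using RO d \<open>0 \<le> \<mu>\<close> by (intro mult_right_mono) (auto intro!: card_mono)
    finally show ?thesis by (simp add: mult_ac)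
  qed
  have "\<mu> \<in> (\<lambda>w. norm (l w)) ` ?R" unfolding \<mu>_def using ne by (intro Max_in) auto
  then obtain r where r: "r \<in> ?R" "\<mu> = norm (l r)" by auto
  have "card (Om A) * d * \<mu> \<le> 1 / 4 * \<mu>"
    using d \<open>0 \<le> \<mu>\<close> by (intro mult_right_mono) auto
  moreover have "norm (l r) \<le> 1 + norm (l r - (if cls P r = cls P u then 1 else 0))"
    using norm_triangle_sub[of "l r" "if cls P r = cls P u then 1 else 0"] by (auto split: if_splits)
  ultimately have "card (Om A) * d * \<mu> \<le> 1 / 3"
    using dev[OF r(1)] r(2) by auto
  moreover have "(\<Sum>w\<in>{w \<in> Om A. cls P w = cls P z}. l w) = l (rep P A z)"
  proof -
    have "l w = 0" if "w \<in> Om A" "cls P w = cls P z" "w \<noteq> rep P A z" for w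
      using that l0 rep_reps[OF fin] rep_eq by metis
    then have "(\<Sum>w\<in>{w \<in> Om A. cls P w = cls P z}. l w) = (\<Sum>w\<in>{rep P A z}. l w)"
      using rep_Om[OF z] cls_rep[OF z] by (intro sum.mono_neutral_right) auto
    then show ?thesis by simp
  qed
  ultimately show ?thesis
    using dev[OF rep_in_reps[OF fin z]] cls_rep[OF z, of P] by simp
qed

section \<open>Down-sets of a bipolar orientation\<close>

lemma bipolar_hd:
  assumes "bipolar P s t C" shows "\<exists>C'. C = s # C'"
proof (cases C)
  case (Cons c C')
  have "c = s"
  proof (rule ccontr)
    assume "c \<noteq> s"
    then obtain d where "(d, c) \<in> ords C" using assms Cons by (auto simp: bipolar_def)
    then show False
      using assms Cons ords_subset[of C'] by (auto simp: bipolar_def)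
  qed
  then show ?thesis using Cons by simp
qed (use assms in \<open>auto simp: bipolar_def\<close>)

text \<open>The first vertex of \<open>C\<close> in \<open>A\<close> is not \<open>s\<close>, so it
  has an earlier neighbour, which by minimality lies outside \<open>A\<close>.\<close>

lemma bipolar_first_in:
  assumes C: "bipolar P s t C" and A: "A \<inter> set C \<noteq> {}" "s \<notin> A"
  obtains b d where "b \<in> A" "d \<in> set C - A" "(d, b) \<in> ords C" "{d, b} \<notin> P"
proof -
  obtain us b vs where split: "C = us @ b # vs" "b \<in> A" "\<forall>x\<in>set us. x \<notin> A"
    using split_list_first_prop[of C "\<lambda>x. x \<in> A"] A(1) by blast
  then obtain d where d: "(d, b) \<in> ords C" "{d, b} \<notin> P"
    using C A(2) by (fastforce simp: bipolar_def)
  have "d \<in> set us"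
    using d(1) C ords_subset[of us] ords_subset[of vs] unfolding split(1) by (auto simp: bipolar_def ords_append)
  then show ?thesis using that[of b d] split d by auto
qed

text \<open>\<open>bipolar_first_in\<close> is applied to whichever of \<open>A\<close> and its
  complement does not contain \<open>s\<close>.\<close>

lemma bipolar_connected:
  assumes C: "bipolar P s t C" and A: "A \<subseteq> set C" "A \<noteq> {}" "A \<noteq> set C"
  obtains a b where "a \<in> A" "b \<in> set C - A" "{a, b} \<notin> P"
proof (cases "s \<in> A")
  case True
  have "(set C - A) \<inter> set C \<noteq> {}" "s \<notin> set C - A" using A True by auto
  then obtain b d where "b \<in> set C - A" "d \<in> set C - (set C - A)" "{d, b} \<notin> P"
    using bipolar_first_in[OF C] by metis
  then show ?thesis using that[of d b] by auto
next
  case False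
  have "A \<inter> set C \<noteq> {}" using A by auto
  then obtain b d where "b \<in> A" "d \<in> set C - A" "{d, b} \<notin> P"
    using bipolar_first_in[OF C _ False] by metis
  then show ?thesis using that[of b d] by (simp add: insert_commute)
qed

text \<open>A down-set without the source would receive an edge from outside; reversal gives the
  dual for the sink. Any vertex of \<open>A\<close> other than \<open>s\<close> brings an earlier
  neighbour into \<open>A\<close>, hence an edge.\<close>

lemma bipolar_downset:
  assumes C: "bipolar P s t C" and A: "A \<subseteq> set C" "A \<noteq> {}" "A \<noteq> set C"
    and down: "\<And>a b. a \<in> A \<Longrightarrow> b \<in> set C - A \<Longrightarrow> {a, b} \<notin> P \<Longrightarrow> (a, b) \<in> ords C"
  shows "s \<in> A" "t \<notin> A" "A \<noteq> {s} \<Longrightarrow> \<exists>a\<in>A. \<exists>b\<in>A. (a, b) \<in> ords C \<and> {a, b} \<notin> P"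
proof -
  have asym: "(a, b) \<in> ords C \<Longrightarrow> (b, a) \<notin> ords C" for a b
    using ords_asym C by (auto simp: bipolar_def)
  show s: "s \<in> A"
  proof (rule ccontr)
    assume "s \<notin> A"
    then obtain b d where "b \<in> A" "d \<in> set C - A" "(d, b) \<in> ords C" "{d, b} \<notin> P"
      using bipolar_first_in[OF C, of A] A by (metis inf.absorb1)
    then show False using down[of b d] asym by (auto simp: insert_commute)
  qed
  show "t \<notin> A"
  proof
    assume "t \<in> A"
    have "(set C - A) \<inter> set (rev C) \<noteq> {}" using A by auto
    then obtain b d where "b \<in> set C - A" "d \<in> set (rev C) - (set C - A)" "(d, b) \<in> ords (rev C)" "{d, b} \<notin> P"
      using bipolar_first_in[OF bipolar_rev[OF C], of "set C - A"] \<open>t \<in> A\<close> by blast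
    then show False using down[of d b] asym[of b d] by (auto simp: ords_rev)
  qed
  show "\<exists>a\<in>A. \<exists>b\<in>A. (a, b) \<in> ords C \<and> {a, b} \<notin> P" if "A \<noteq> {s}"
  proof -
    have "A - {s} \<noteq> {}" using that A(2) by (simp add: subset_singleton_iff)
    then obtain b where b: "b \<in> A" "b \<noteq> s" by auto
    then have "b \<in> set C" using A(1) by auto
    then obtain d where d: "(d, b) \<in> ords C" "{d, b} \<notin> P"
      using C b(2) unfolding bipolar_def by blast
    have "d \<in> set C" using d ords_subset[of C] by auto
    moreover have "{b, d} \<notin> P" using d(2) by (simp add: insert_commute)
    ultimately have "d \<in> A" using down[of b d] b(1) asym[OF d(1)] by blast
    then show ?thesis using b(1) d by blast
  qed
qed

text \<open>In the bound on \<open>d\<close>, the factorial bounds the number of orderings in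
  \<open>near_identity_solve\<close>, the power of 2 the number of subsets \<open>A\<close>, and 8
  leaves a margin in both estimates. The edge between \<open>s\<close> and \<open>t\<close> is
  exempt from smallness: a proper non-empty down-set contains \<open>s\<close> but not
  \<open>t\<close>, so neither it nor its complement contains this edge.\<close>

theorem degenerate_criterion:
  assumes C: "bipolar P s t C" and s: "s \<noteq> t"
    and unit: "\<And>a b. {a, b} \<in> P \<Longrightarrow> q a b = 1"
    and small: "\<And>a b. a \<in> set C \<Longrightarrow> b \<in> set C \<Longrightarrow> a \<noteq> b \<Longrightarrow> {a, b} \<notin> P \<Longrightarrow> {a, b} \<noteq> {s, t} \<Longrightarrow>
      q a b = complex_of_real d"
    and d: "0 < d" "8 * 2 ^ length C * fact (length C) * d \<le> 1"
    and sig: "sigma_prod q (set C) = 1"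
    and nd: "\<And>H. H \<subset> set C \<Longrightarrow> nondeg P H q"
  shows "\<not> nondeg P (set C) q"
proof
  define G where "G = set C"
  assume "nondeg P (set C) q"
  then have ndG: "nondeg P G q" by (simp add: G_def)
  have q: "unit_on P q" using unit by (auto simp: unit_on_def sigma_def insert_commute)
  have G: "finite G" "G \<noteq> {}" and st: "s \<in> G" "t \<in> G"
    using C by (auto simp: G_def bipolar_def)
  have CO: "C \<in> Om G" using C by (simp add: G_def bipolar_def permutations_of_set_def)
  have cG: "card G = length C" using C by (simp add: G_def bipolar_def distinct_card)
  have wt1: "wt q X Y = 1" if "X \<in> Om H" "Y \<in> Om H" "cls P X = cls P Y" for X Y H
    using that unit by (intro wt_one) (auto simp: cls_eq_iff)
  have d1: "real (card (Om H)) * d \<le> 1 / 4" "2 ^ card G * d \<le> 1 / 8" "d \<le> 1" if "H \<subseteq> G" for H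
  proof -
    have fH: "finite H" "card H \<le> length C"
      using that G(1) card_mono[OF G(1) that] cG finite_subset by auto
    have "fact (card H) \<le> (fact (length C) :: real)" using fH(2) by (rule fact_mono)
    then have "real (card (Om H)) \<le> fact (length C)" using fH(1) by simp
    then have c: "real (card (Om H)) * d \<le> fact (length C) * d"
      using d(1) by (intro mult_right_mono) simp_all
    have "(1::real) * (fact (length C) * d) \<le> 2 ^ length C * (fact (length C) * d)"
      using d(1) by (intro mult_right_mono) simp_all
    then have one: "fact (length C) * d \<le> 2 ^ length C * (fact (length C) * d)" by simp
    have e: "8 * (2 ^ length C * (fact (length C) * d)) \<le> 1" using d(2) by (simp add: mult_ac)
    have "(1::real) * d \<le> fact (length C) * d" using d(1) by (intro mult_right_mono) simp_all
    then have f: "d \<le> fact (length C) * d" by simp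
    then have g: "2 ^ length C * d \<le> 2 ^ length C * (fact (length C) * d)"
      by (intro mult_left_mono) simp_all
    show "real (card (Om H)) * d \<le> 1 / 4" "d \<le> 1"
      using c one e f d(1) by linarith+
    show "2 ^ card G * d \<le> 1 / 8" unfolding cG using g e by linarith
  qed
  obtain x where x: "\<And>E. E \<in> Om G \<Longrightarrow> S_app G q x E = (if cls P E = cls P C then wt q E C else 0)"
    using nondeg_solve_right[OF q G(1) ndG CO] by metis
  have x1: "S_app G q x E = (if cls P E = cls P C then 1 else 0)" if "E \<in> Om G" for E
    using x[OF that] wt1[OF that CO] by simp
  have block: "\<exists>lA lB. antip P G q x A E = wt q E (u @ w) * (\<Sum>u'\<in>Om A. \<Sum>w'\<in>Om (G - A). lA u' * lB w' * S_app G q x (u' @ w'))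
      \<and> (\<forall>r. r \<notin> set (reps P A) \<longrightarrow> lA r = 0) \<and> (\<forall>r. r \<notin> set (reps P (G - A)) \<longrightarrow> lB r = 0)
      \<and> (\<forall>a\<in>Om A. (\<Sum>u'\<in>Om A. lA u' * wt q u' a) = (if cls P a = cls P u then wt q u a else 0))
      \<and> (\<forall>a\<in>Om (G - A). (\<Sum>w'\<in>Om (G - A). lB w' * wt q w' a) = (if cls P a = cls P w then wt q w a else 0))"
    if A: "A \<in> Pow G - {{}, G}" and E: "E \<in> Om G" and uw: "u \<in> Om A" "w \<in> Om (G - A)" "cls P E = cls P (rev u @ w)"
    for A E u w
  proof -
    have sub: "A \<subset> G" "G - A \<subset> G" and fA: "finite A" "finite (G - A)"
      using A G(1) finite_subset by auto
    obtain lA where lA: "\<And>r. r \<notin> set (reps P A) \<Longrightarrow> lA r = 0"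
      "\<And>a. a \<in> Om A \<Longrightarrow> (\<Sum>u'\<in>Om A. lA u' * wt q u' a) = (if cls P a = cls P u then wt q u a else 0)"
      using nondeg_solve_left[OF q fA(1) nd[folded G_def, OF sub(1)] uw(1)] by metis
    obtain lB where lB: "\<And>r. r \<notin> set (reps P (G - A)) \<Longrightarrow> lB r = 0"
      "\<And>a. a \<in> Om (G - A) \<Longrightarrow> (\<Sum>w'\<in>Om (G - A). lB w' * wt q w' a) = (if cls P a = cls P w then wt q w a else 0)"
      using nondeg_solve_left[OF q fA(2) nd[folded G_def, OF sub(2)] uw(2)] by metis
    have "antip P G q x A E = wt q E (u @ w) * (\<Sum>u'\<in>Om A. \<Sum>w'\<in>Om (G - A). lA u' * lB w' * S_app G q x (u' @ w'))"
      using antip_block[OF q psubset_imp_subset[OF sub(1)] E uw, of x]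
        block_solve[OF G(1) psubset_imp_subset[OF sub(1)] uw(1,2) lA(2) lB(2), of x] by simp
    then show ?thesis using lA lB by blast
  qed
  have app: "u' @ w' \<in> Om G" if "A \<in> Pow G - {{}, G}" "u' \<in> Om A" "w' \<in> Om (G - A)" for u' w' A
    using append_Om[OF that(2,3)] that(1) by (simp add: Un_absorb1)
  \<comment> \<open>Some edge joins \<open>A\<close> to its complement. It is oriented alike in
    \<open>rev C\<close> and in every \<open>u' @ w'\<close>, so no \<open>u' @ w'\<close> lies in
    the class of \<open>C\<close>, where the image of \<open>x\<close> is concentrated.\<close>
  have zero: "antip P G q x A (rev C) = 0" if A: "A \<in> Pow G - {{}, G}" for A
  proof (rule ccontr)
    assume nz: "antip P G q x A (rev C) \<noteq> 0"
    obtain u w where uw: "u \<in> Om A" "w \<in> Om (G - A)" "cls P (rev C) = cls P (rev u @ w)"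
      using antip_cases[of A G P q x "rev C"] A nz by blast
    obtain a b where ab: "a \<in> A" "b \<in> G - A" "{a, b} \<notin> P"
      using bipolar_connected[OF C, of A] A by (auto simp: G_def)
    have eq: "(a, b) \<in> cls P (u' @ w')" if "u' \<in> Om A" "w' \<in> Om (G - A)" for u' w'
      using ab OmD(1)[OF that(1)] OmD(1)[OF that(2)] by (auto simp: cls_def ords_append)
    have "(a, b) \<in> cls P (rev C)" using eq[OF rev_Om[OF uw(1)] uw(2)] uw(3) by simp
    then have "(a, b) \<notin> cls P C"
      using Om_ords_asym[OF CO] by (auto simp: cls_def ords_rev)
    then have "S_app G q x (u' @ w') = 0" if "u' \<in> Om A" "w' \<in> Om (G - A)" for u' w'
      using x1[OF app[OF A that]] eq[OF that] by auto
    then have "(\<Sum>u'\<in>Om A. \<Sum>w'\<in>Om (G - A). lA u' * lB w' * S_app G q x (u' @ w')) = 0" for lA lB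
      by (intro sum.neutral ballI) simp
    then show False
      using block[OF A rev_Om[OF CO] uw] nz by (elim exE conjE) simp
  qed
  have estimate: "\<exists>\<alpha> \<beta>. antip P G q x A C = wt q C (u @ w) * \<alpha> * \<beta> \<and>
      norm (\<alpha> - (if cls P (rev u) = cls P u then 1 else 0)) \<le> 1 / 3 \<and> norm (\<beta> - 1) \<le> 1 / 3 \<and>
      (A \<noteq> {s} \<longrightarrow> norm (wt q C (u @ w)) \<le> d)"
    if A: "A \<in> Pow G - {{}, G}" and uw: "u \<in> Om A" "w \<in> Om (G - A)" "cls P C = cls P (rev u @ w)" for A u w
  proof -
    have dis: "A \<inter> (G - A) = {}" and sub: "A \<subseteq> G" "A \<noteq> {}" "A \<noteq> G" using A by auto
    have fA: "finite A" "finite (G - A)" using sub G(1) finite_subset by auto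
    have down_AB: "(a, b) \<in> ords C" if "a \<in> A" "b \<in> G - A" "{a, b} \<notin> P" for a b
    proof -
      have "(a, b) \<in> cls P (rev u @ w)"
        using that OmD(1)[OF uw(1)] OmD(1)[OF uw(2)] by (auto simp: cls_def ords_append)
      then show ?thesis using uw(3) by (auto simp: cls_def)
    qed
    have down: "s \<in> A" "t \<notin> A" "A \<noteq> {s} \<Longrightarrow> \<exists>a\<in>A. \<exists>b\<in>A. (a, b) \<in> ords C \<and> {a, b} \<notin> P"
      by (rule bipolar_downset[OF C sub[unfolded G_def]]; use down_AB in \<open>simp add: G_def\<close>)+
    have entry: "norm (wt q X Y) \<le> d"
      if H: "H \<subseteq> G" "\<not> {s, t} \<subseteq> H" and XY: "X \<in> Om H" "Y \<in> Om H" "cls P X \<noteq> cls P Y" for X Y H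
    proof -
      obtain a b where ab: "(a, b) \<in> invs X Y" "{a, b} \<notin> P" using XY cls_eq_iff by blast
      have "q a b = (if {a, b} \<in> P then 1 else complex_of_real d)" if "(a, b) \<in> invs X Y" for a b
      proof -
        have "a \<in> H" "b \<in> H" "a \<noteq> b"
          using that Om_ordsD[OF XY(1)] Om_ords_irrefl[OF XY(1)] by (auto simp: invs_def)
        moreover have "a \<in> set C" "b \<in> set C" "{a, b} \<noteq> {s, t}"
          using H \<open>a \<in> H\<close> \<open>b \<in> H\<close> by (auto simp: G_def doubleton_eq_iff)
        ultimately show ?thesis using unit[of a b] small[of a b] by simp
      qed
      then show ?thesis using wt_small[OF d(1) d1(3)[OF H(1)] _ ab] by blast
    qed
    obtain lA lB where
      val: "antip P G q x A C = wt q C (u @ w) * (\<Sum>u'\<in>Om A. \<Sum>w'\<in>Om (G - A). lA u' * lB w' * S_app G q x (u' @ w'))"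
      and lA: "\<And>r. r \<notin> set (reps P A) \<Longrightarrow> lA r = 0"
        "\<And>a. a \<in> Om A \<Longrightarrow> (\<Sum>u'\<in>Om A. lA u' * wt q u' a) = (if cls P a = cls P u then wt q u a else 0)"
      and lB: "\<And>r. r \<notin> set (reps P (G - A)) \<Longrightarrow> lB r = 0"
        "\<And>a. a \<in> Om (G - A) \<Longrightarrow> (\<Sum>w'\<in>Om (G - A). lB w' * wt q w' a) = (if cls P a = cls P w then wt q w a else 0)"
      using block[OF A CO uw] by blast
    \<comment> \<open>\<open>S_app G q x\<close> is the indicator of the class of \<open>C\<close>,
      which among the words \<open>u' @ w'\<close> selects those with \<open>u'\<close> equivalent
      to \<open>rev u\<close> and \<open>w'\<close> equivalent to \<open>w\<close>. So the double
      sum is a product of two coefficient sums.\<close>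
    let ?\<alpha> = "\<Sum>u'\<in>{u' \<in> Om A. cls P u' = cls P (rev u)}. lA u'"
    let ?\<beta> = "\<Sum>w'\<in>{w' \<in> Om (G - A). cls P w' = cls P w}. lB w'"
    have "lA u' * lB w' * S_app G q x (u' @ w') =
        (if cls P u' = cls P (rev u) then lA u' else 0) * (if cls P w' = cls P w then lB w' else 0)"
      if "u' \<in> Om A" "w' \<in> Om (G - A)" for u' w'
      using x1[OF app[OF A that]] cls_append_eq_iff[OF that(1) rev_Om[OF uw(1)] that(2) uw(2) dis] uw(3) by simp
    then have "(\<Sum>u'\<in>Om A. \<Sum>w'\<in>Om (G - A). lA u' * lB w' * S_app G q x (u' @ w')) =
        (\<Sum>u'\<in>Om A. if cls P u' = cls P (rev u) then lA u' else 0) *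
        (\<Sum>w'\<in>Om (G - A). if cls P w' = cls P w then lB w' else 0)"
      by (simp only: sum_product cong: sum.cong)
    also have "\<dots> = ?\<alpha> * ?\<beta>"
      by (simp only: sum.inter_filter finite_permutations_of_set)
    finally have "antip P G q x A C = wt q C (u @ w) * ?\<alpha> * ?\<beta>"
      using val by (simp add: mult.assoc)
    moreover have "norm (?\<alpha> - (if cls P (rev u) = cls P u then 1 else 0)) \<le> 1 / 3"
    proof (rule near_identity_solve[OF fA(1) uw(1) wt1 entry[OF sub(1)] d(1) d1(1)[OF sub(1)] lA rev_Om[OF uw(1)]])
      show "\<not> {s, t} \<subseteq> A" using down(2) by blast
    qed
    moreover have "norm (?\<beta> - (if cls P w = cls P w then 1 else 0)) \<le> 1 / 3"
    proof (rule near_identity_solve[OF fA(2) uw(2) wt1 entry[OF Diff_subset] d(1) d1(1)[OF Diff_subset] lB uw(2)])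
      show "\<not> {s, t} \<subseteq> G - A" using down(1) by blast
    qed
    \<comment> \<open>\<open>C\<close> orders edges as \<open>rev u @ w\<close> does, so the edges
      inverted between \<open>C\<close> and \<open>u @ w\<close> are precisely those inside
      \<open>A\<close>. There is at least one, and none is the exempt edge.\<close>
    moreover have "norm (wt q C (u @ w)) \<le> d" if As: "A \<noteq> {s}"
    proof -
      obtain a b where ab: "a \<in> A" "b \<in> A" "(a, b) \<in> ords C" "{a, b} \<notin> P" using down(3)[OF As] by blast
      have "(a, b) \<in> cls P (rev u @ w)" using ab uw(3) by (auto simp: cls_def)
      then have "(b, a) \<in> ords u"
        using ab(1,2) OmD(1)[OF uw(2)] ords_subset[of w] by (auto simp: cls_def ords_append ords_rev)
      then have inv: "(a, b) \<in> invs C (u @ w)" using ab(3) by (auto simp: invs_def ords_append)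
      have "q a b = (if {a, b} \<in> P then 1 else complex_of_real d)" if "(a, b) \<in> invs C (u @ w)" for a b
      proof (cases "{a, b} \<in> P")
        case True
        then show ?thesis using unit by simp
      next
        case False
        have c: "(a, b) \<in> ords C" "(b, a) \<in> ords (u @ w)" using that by (auto simp: invs_def)
        then have "(a, b) \<in> cls P (rev u @ w)" using False uw(3) by (auto simp: cls_def)
        then have "a \<in> A" "b \<in> A"
          using c(2) Om_ords_asym[OF uw(2)] ords_subset[of w] ords_subset[of u] OmD(1)[OF uw(1)] OmD(1)[OF uw(2)]
          by (auto simp: cls_def ords_append ords_rev)
        moreover have "a \<noteq> b" using c(1) Om_ords_irrefl[OF CO] by auto
        ultimately show ?thesis
          using small[of a b] False sub(1) down(2) by (auto simp: G_def doubleton_eq_iff)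
      qed
      then show ?thesis using wt_small[OF d(1) d1(3)[OF sub(1)] _ inv ab(4)] by blast
    qed
    ultimately show ?thesis by (intro exI[of _ ?\<alpha>] exI[of _ ?\<beta>]) simp
  qed
  have upper: "norm \<gamma> \<le> 4 / 3" if "norm (\<gamma> - (if b then 1 else 0)) \<le> 1 / 3" for \<gamma> :: complex and b
    using that norm_triangle_sub[of \<gamma> "if b then 1 else 0"] by (auto split: if_splits)
  have lower: "norm \<gamma> \<ge> 2 / 3" if "norm (\<gamma> - 1) \<le> 1 / 3" for \<gamma> :: complex
    using that norm_triangle_sub[of 1 \<gamma>] by (simp add: norm_minus_commute)
  have bound: "norm (antip P G q x A C) \<le> d * (16 / 9)" if A: "A \<in> Pow G - {{}, G}" "A \<noteq> {s}" for A
  proof (cases "antip P G q x A C = 0")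
    case False
    then obtain u w where uw: "u \<in> Om A" "w \<in> Om (G - A)" "cls P C = cls P (rev u @ w)"
      using antip_cases[of A G P q x C] A by blast
    obtain \<alpha> \<beta> where v: "antip P G q x A C = wt q C (u @ w) * \<alpha> * \<beta>"
      "norm (\<alpha> - (if cls P (rev u) = cls P u then 1 else 0)) \<le> 1 / 3" "norm (\<beta> - 1) \<le> 1 / 3"
      "norm (wt q C (u @ w)) \<le> d"
      using estimate[OF A(1) uw] A(2) by blast
    have "norm \<alpha> \<le> 4 / 3" "norm \<beta> \<le> 4 / 3" using upper[OF v(2)] upper[of \<beta> True] v(3) by simp_all
    then have "norm (wt q C (u @ w)) * norm \<alpha> * norm \<beta> \<le> d * (4 / 3) * (4 / 3)"
      using v(4) d(1) by (intro mult_mono) auto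
    then show ?thesis unfolding v(1) norm_mult by simp
  qed (use d(1) in simp)
  \<comment> \<open>\<open>C\<close> starts with \<open>s\<close>, so for \<open>A = {s}\<close> the
    word \<open>u @ w\<close> can be \<open>C\<close> itself, of weight 1; a single letter equals
    its reversal, so \<alpha> is close to 1 as well.\<close>
  have main: "norm (antip P G q x {s} C) \<ge> 4 / 9"
  proof -
    obtain C' where C': "C = s # C'" using bipolar_hd[OF C] by blast
    have uw: "[s] \<in> Om {s}" "C' \<in> Om (G - {s})" "cls P C = cls P (rev [s] @ C')"
      using C C' by (auto simp: permutations_of_set_def G_def bipolar_def)
    have A: "{s} \<in> Pow G - {{}, G}" using st s by auto
    obtain \<alpha> \<beta> where v: "antip P G q x {s} C = wt q C ([s] @ C') * \<alpha> * \<beta>"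
      "norm (\<alpha> - 1) \<le> 1 / 3" "norm (\<beta> - 1) \<le> 1 / 3"
      using estimate[OF A uw] by auto
    have "wt q C ([s] @ C') = 1" using C' wt_self[OF CO] by simp
    moreover have "(2 / 3) * (2 / 3) \<le> norm \<alpha> * norm \<beta>"
      using lower[OF v(2)] lower[OF v(3)] by (intro mult_mono) auto
    ultimately show ?thesis unfolding v(1) by (simp add: norm_mult)
  qed
  have "psi P G q x (rev C) + (-1) ^ card G * (wt q (rev C) C * psi P G q x C) = 0"
    using antip_boundary[OF q G rev_Om[OF CO], of x] zero by simp
  then have rev_eq: "psi P G q x (rev C) = - ((-1) ^ card G * (wt q (rev C) C * psi P G q x C))"
    by (simp add: eq_neg_iff_add_eq_0)
  \<comment> \<open>As \<open>sigma_prod\<close> is 1, the terms of the empty and of the full set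
    cancel at \<open>C\<close>, and the remaining ones must sum to zero.\<close>
  have "psi P G q x C + (-1) ^ card G * (wt q C (rev C) * psi P G q x (rev C)) =
     psi P G q x C - ((-1) ^ card G * (-1) ^ card G) * ((wt q C (rev C) * wt q (rev C) C) * psi P G q x C)"
    unfolding rev_eq by (simp only: mult_minus_right add_uminus_conv_diff mult_ac)
  also have "\<dots> = 0"
    unfolding wt_rev_mult[OF CO] sig[folded G_def] by (simp flip: power_mult_distrib)
  finally have zero_sum: "(\<Sum>A\<in>Pow G - {{}, G}. (-1) ^ card A * antip P G q x A C) = 0"
    using antip_boundary[OF q G CO, of x] by simp
  have sG: "{s} \<in> Pow G - {{}, G}" using st s by auto
  have "(\<Sum>A\<in>Pow G - {{}, G}. (-1) ^ card A * antip P G q x A C) = - antip P G q x {s} C +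
      (\<Sum>A\<in>Pow G - {{}, G} - {{s}}. (-1) ^ card A * antip P G q x A C)"
    using G(1) by (subst sum.remove[OF _ sG]) simp_all
  then have "antip P G q x {s} C = (\<Sum>A\<in>Pow G - {{}, G} - {{s}}. (-1) ^ card A * antip P G q x A C)"
    unfolding zero_sum by simp
  then have "norm (antip P G q x {s} C) = norm (\<Sum>A\<in>Pow G - {{}, G} - {{s}}. (-1) ^ card A * antip P G q x A C)"
    by simp
  also have "\<dots> \<le> (\<Sum>A\<in>Pow G - {{}, G} - {{s}}. d * (16 / 9))"
    using bound by (intro sum_norm_le) (simp add: norm_mult norm_power)
  also have "\<dots> \<le> card (Pow G) * (d * (16 / 9))"
    using G(1) d(1) unfolding sum_constant by (intro mult_right_mono) (auto intro!: card_mono)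
  also have "\<dots> = (2 ^ card G * d) * (16 / 9)" using G(1) by (simp add: card_Pow)
  \<comment> \<open>The other terms sum to at most 16/9 times 1/8, which is 2/9.\<close>
  also have "\<dots> < 4 / 9" using d1(2)[OF subset_refl] by linarith
  finally show False using main by simp
qed

section \<open>Parameter spaces and general position\<close>

lemma param_polys_sum:
  "finite A \<Longrightarrow> (\<And>a. a \<in> A \<Longrightarrow> f a \<in> param_polys N) \<Longrightarrow> (\<lambda>q. \<Sum>a\<in>A. f a q) \<in> param_polys N"
  by (induction A rule: finite_induct) (auto intro: param_polys.intros)

lemma param_polys_prod:
  "finite A \<Longrightarrow> (\<And>a. a \<in> A \<Longrightarrow> f a \<in> param_polys N) \<Longrightarrow> (\<lambda>q. \<Prod>a\<in>A. f a q) \<in> param_polys N"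
  by (induction A rule: finite_induct) (auto intro: param_polys.intros)

lemma wt_param_poly:
  assumes "C \<in> Om G" "G \<subseteq> {1..N}"
  shows "(\<lambda>q. wt q C D) \<in> param_polys N"
proof -
  have "(\<lambda>q. case i of (a, b) \<Rightarrow> q a b) \<in> param_polys N" if "i \<in> invs C D" for i
  proof -
    obtain a b where i: "i = (a, b)" by (cases i)
    then have "a \<in> {1..N}" "b \<in> {1..N}"
      using that Om_ordsD[OF assms(1), of a b] assms(2) by (auto simp: invs_def)
    then show ?thesis unfolding i by (simp add: param_polys.coord)
  qed
  then show ?thesis unfolding wt_def by (intro param_polys_prod) auto
qed

lemma det_red_mat_param_poly:
  assumes "finite G" "G \<subseteq> {1..N}"
  shows "(\<lambda>q. det (red_mat P G q)) \<in> param_polys N"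
proof -
  let ?k = "length (reps P G)"
  have "det (red_mat P G q) = (\<Sum>p\<in>{p. p permutes {0..<?k}}. signof p * (\<Prod>i\<in>{0..<?k}.
      wt q (reps P G ! i) (reps P G ! (p i))))" for q
  proof -
    have "det (red_mat P G q) = (\<Sum>p\<in>{p. p permutes {0..<?k}}. signof p * (\<Prod>i\<in>{0..<?k}. red_mat P G q $$ (i, p i)))"
      by (rule det_def'[OF red_mat_carrier])
    also have "\<dots> = (\<Sum>p\<in>{p. p permutes {0..<?k}}. signof p * (\<Prod>i\<in>{0..<?k}.
      wt q (reps P G ! i) (reps P G ! (p i))))"
    proof (rule sum.cong[OF refl])
      fix p assume "p \<in> {p. p permutes {0..<?k}}"
      then have "p i < ?k" if "i < ?k" for i using that permutes_in_image[of p "{0..<?k}" i] by auto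
      then show "signof p * (\<Prod>i\<in>{0..<?k}. red_mat P G q $$ (i, p i)) =
          signof p * (\<Prod>i\<in>{0..<?k}. wt q (reps P G ! i) (reps P G ! (p i)))"
        by (auto simp: red_mat_def intro!: prod.cong arg_cong[of _ _ "\<lambda>z. signof p * z"])
    qed
    finally show ?thesis .
  qed
  moreover have "(\<lambda>q. \<Sum>p\<in>{p. p permutes {0..<?k}}. signof p * (\<Prod>i\<in>{0..<?k}.
      wt q (reps P G ! i) (reps P G ! (p i)))) \<in> param_polys N"
  proof (intro param_polys_sum param_polys.mult param_polys.const param_polys_prod)
    fix p i assume "i \<in> {0..<?k}"
    then show "(\<lambda>q. wt q (reps P G ! i) (reps P G ! (p i))) \<in> param_polys N"
      using set_reps_Om[OF assms(1), of "reps P G ! i" P] assms(2) by (intro wt_param_poly) auto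
  qed (auto simp: finite_permutations)
  ultimately show ?thesis by simp
qed

text \<open>The coordinates are joined by the affine line on one side of the diagonal; on the other side the
  constrained coordinates are reciprocals, so that the curve stays in the constrained torus.\<close>

definition seg :: "nat set set \<Rightarrow> params \<Rightarrow> params \<Rightarrow> nat \<Rightarrow> nat \<Rightarrow> complex poly" where
  "seg P p p' i j = [:p i j, p' i j - p i j:]"

definition curve :: "nat \<Rightarrow> nat set set \<Rightarrow> params \<Rightarrow> params \<Rightarrow> complex \<Rightarrow> params" where
  "curve N P p p' t = (\<lambda>i\<in>{1..N}. \<lambda>j\<in>{1..N}.
     if {i, j} \<in> P \<and> j < i then inverse (poly (seg P p p' j i) t) else poly (seg P p p' i j) t)"

lemma constrained_params_iff:
  "q \<in> constrained_params N P \<longleftrightarrow> q \<in> param_space N \<and> unit_on P q"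
  by (auto simp: constrained_params_def unit_on_def)

text \<open>Along the curve from \<open>p\<close> to \<open>p'\<close> both functions are rational
  with powers of \<open>W\<close> as denominators. One numerator is non-zero at 0, the other at 1,
  so all but finitely many \<open>t\<close> avoid the zeros of both and of \<open>W\<close>.\<close>

lemma constrained_irreducible:
  assumes P: "\<And>i j. {i, j} \<in> P \<Longrightarrow> i \<in> {1..N} \<and> j \<in> {1..N} \<and> i \<noteq> j"
    and f: "f \<in> param_polys N" and g: "g \<in> param_polys N"
    and p: "p \<in> constrained_params N P" "f p \<noteq> 0" and p': "p' \<in> constrained_params N P" "g p' \<noteq> 0"
  obtains r where "r \<in> constrained_params N P" "f r \<noteq> 0" "g r \<noteq> 0"
proof -
  define W where "W = (\<Prod>(i, j)\<in>{1..N} \<times> {1..N}. seg P p p' i j)"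
  let ?c = "curve N P p p'"
  have nz: "q i j \<noteq> 0" if "q \<in> constrained_params N P" "i \<in> {1..N}" "j \<in> {1..N}" for q i j
    using that by (auto simp: constrained_params_def param_space_def PiE_def Pi_def)
  have W: "poly W t = (\<Prod>(i, j)\<in>{1..N} \<times> {1..N}. poly (seg P p p' i j) t)" for t
    by (simp add: W_def poly_prod case_prod_unfold)
  have W0: "poly W 0 \<noteq> 0"
    unfolding W using nz[OF p(1)] by (auto simp: prod_zero_iff seg_def)
  have segnz: "poly (seg P p p' i j) t \<noteq> 0" if "poly W t \<noteq> 0" "i \<in> {1..N}" "j \<in> {1..N}" for i j t
    using that unfolding W by (auto simp: prod_zero_iff)
  have cV: "?c t \<in> constrained_params N P" if "poly W t \<noteq> 0" for t
  proof -
    have "?c t \<in> param_space N"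
      using segnz[OF that] unfolding param_space_def curve_def by auto
    moreover have "sigma (?c t) i j = 1" if ij: "{i, j} \<in> P" for i j
    proof -
      have "{j, i} \<in> P" using ij by (simp add: insert_commute)
      then show ?thesis
        using P[OF ij] ij segnz[OF \<open>poly W t \<noteq> 0\<close>, of i j] segnz[OF \<open>poly W t \<noteq> 0\<close>, of j i]
        by (cases i j rule: linorder_cases) (auto simp: sigma_def curve_def)
    qed
    ultimately show ?thesis by (auto simp: constrained_params_iff unit_on_def)
  qed
  have ends: "?c t = q" if q: "q \<in> constrained_params N P" and e: "\<And>i j. poly (seg P p p' i j) t = q i j" for t q
  proof (intro ext)
    fix i j
    have "inverse (q j i) = q i j" if "{i, j} \<in> P" for i j
    proof -
      have "q i j * q j i = 1" using q that by (auto simp: constrained_params_def sigma_def)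
      then show ?thesis by (metis inverse_unique mult.commute)
    qed
    moreover have "q i j = undefined" if "i \<in> {1..N}" "j \<notin> {1..N}"
      using q that unfolding constrained_params_def param_space_def by (auto simp: PiE_def Pi_def extensional_def)
    moreover have "q i = undefined" if "i \<notin> {1..N}"
      using q that unfolding constrained_params_def param_space_def by (auto simp: PiE_def extensional_def)
    ultimately show "?c t i j = q i j"
      using e by (auto simp: curve_def restrict_def)
  qed
  \<comment> \<open>The only denominators are single segments, each a factor of \<open>W\<close>; a
    power of \<open>W\<close> clears them.\<close>
  have rational: "\<exists>F m. \<forall>t. poly W t \<noteq> 0 \<longrightarrow> h (?c t) * poly W t ^ m = poly F t" if "h \<in> param_polys N" for h
    using that
  proof induction
    case (const c)
    show ?case by (intro exI[of _ "[:c:]"] exI[of _ 0]) simp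
  next
    case (coord i j)
    show ?case
    proof (cases "{i, j} \<in> P \<and> j < i")
      case False
      then show ?thesis
        using coord by (intro exI[of _ "seg P p p' i j"] exI[of _ 0]) (auto simp: curve_def)
    next
      case True
      have ji: "(j, i) \<in> {1..N} \<times> {1..N}" using coord by auto
      define F where "F = (\<Prod>(i, j)\<in>{1..N} \<times> {1..N} - {(j, i)}. seg P p p' i j)"
      have "W = seg P p p' j i * F"
        unfolding W_def F_def by (subst prod.remove[OF _ ji]) simp_all
      then have "?c t i j * poly W t ^ 1 = poly F t" if "poly W t \<noteq> 0" for t
        using True coord segnz[OF that, of j i] by (simp add: curve_def)
      then show ?thesis by blast
    qed
  next
    case (add f g)
    then obtain F m F' m' where FF: "\<And>t. poly W t \<noteq> 0 \<Longrightarrow> f (?c t) * poly W t ^ m = poly F t"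
      "\<And>t. poly W t \<noteq> 0 \<Longrightarrow> g (?c t) * poly W t ^ m' = poly F' t" by blast
    have "(f (?c t) + g (?c t)) * poly W t ^ (m + m') = poly (F * W ^ m' + F' * W ^ m) t" if "poly W t \<noteq> 0" for t
      by (simp add: FF[OF that, symmetric] power_add algebra_simps)
    then show ?case by blast
  next
    case (mult f g)
    then obtain F m F' m' where FF: "\<And>t. poly W t \<noteq> 0 \<Longrightarrow> f (?c t) * poly W t ^ m = poly F t"
      "\<And>t. poly W t \<noteq> 0 \<Longrightarrow> g (?c t) * poly W t ^ m' = poly F' t" by blast
    have "(f (?c t) * g (?c t)) * poly W t ^ (m + m') = poly (F * F') t" if "poly W t \<noteq> 0" for t
      by (simp add: FF[OF that, symmetric] power_add algebra_simps)
    then show ?case by blast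
  qed
  obtain F m where F: "\<And>t. poly W t \<noteq> 0 \<Longrightarrow> f (?c t) * poly W t ^ m = poly F t" using rational[OF f] by blast
  obtain F' m' where F': "\<And>t. poly W t \<noteq> 0 \<Longrightarrow> g (?c t) * poly W t ^ m' = poly F' t" using rational[OF g] by blast
  have "?c 0 = p" using p(1) by (intro ends) (auto simp: seg_def)
  then have "poly F 0 \<noteq> 0" using F[OF W0] p(2) W0 by auto
  moreover have "?c 1 = p'" using p'(1) by (intro ends) (auto simp: seg_def)
  moreover have W1: "poly W 1 \<noteq> 0"
    unfolding W using nz[OF p'(1)] by (auto simp: prod_zero_iff seg_def)
  ultimately have "poly F' 1 \<noteq> 0" using F'[OF W1] p'(2) by auto
  then have "F * F' * W \<noteq> 0" using \<open>poly F 0 \<noteq> 0\<close> W0 by auto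
  then have "finite {t. poly (F * F' * W) t = 0}" by (rule poly_roots_finite)
  then obtain t where t: "poly (F * F' * W) t \<noteq> 0"
    using ex_new_if_finite[OF infinite_UNIV_char_0] by blast
  then have "poly W t \<noteq> 0" "poly F t \<noteq> 0" "poly F' t \<noteq> 0" by auto
  then have "f (?c t) \<noteq> 0" "g (?c t) \<noteq> 0" using F[of t] F'[of t] by (metis mult_zero_left)+
  then show ?thesis using that[OF cV[OF \<open>poly W t \<noteq> 0\<close>]] by blast
qed

section \<open>The quotient algebra\<close>

lemma scal_scal: "scal c * (scal d * x) = scal (c * d) * x"
  by (simp only: mult.assoc[symmetric] scal_mult)

lemma scal_left_commute: "scal c * (scal d * x) = scal d * (scal c * x)"
  by (simp add: scal_scal mult.commute)

lemma mon_scal_left: "mon x * (scal c * y) = scal c * (mon x * y)"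
  by (simp only: mult.assoc[symmetric] scal_commute[of c "mon x"])

lemma mon_Cons: "mon (c # w) = gen c * mon w"
  using mon_append[of "[c]" w] by simp

lemma scal_minus: "scal (- c) = - scal c"
  by (simp add: scal_def single_uminus)

lemma deriv_word_notin: "c \<notin> set z \<Longrightarrow> deriv_word q c z = 0"
  by (induction z) auto

lemma deriv_word_split:
  "c \<notin> set y \<Longrightarrow> c \<notin> set z \<Longrightarrow> distinct y \<Longrightarrow>
    deriv_word q c (y @ c # z) = scal (\<Prod>d\<in>set y. q c d) * mon (y @ z)"
proof (induction y)
  case Nil
  then show ?case by (simp add: deriv_word_notin scal_1)
next
  case (Cons d y)
  then have "deriv_word q c ((d # y) @ c # z) = scal (q c d) * (gen d * (scal (\<Prod>d\<in>set y. q c d) * mon (y @ z)))"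
    by (simp add: mult.assoc)
  also have "\<dots> = scal (q c d * (\<Prod>d\<in>set y. q c d)) * (gen d * mon (y @ z))"
    by (simp only: mon_scal_left scal_scal)
  finally show ?case using Cons.prems by (simp add: mon_Cons[of d "y @ z"])
qed

lemma fold_deriv_scal: "fold (deriv q) C (scal k * x) = scal k * fold (deriv q) C x"
  by (induction C arbitrary: x) (simp_all add: deriv_scal)

lemma fold_deriv_add: "fold (deriv q) C (x + y) = fold (deriv q) C x + fold (deriv q) C y"
  by (induction C arbitrary: x y) (simp_all add: deriv_add)

lemma fold_deriv_0: "fold (deriv q) C 0 = 0"
  by (induction C) (simp_all add: deriv_0)

lemma fold_deriv_sum: "fold (deriv q) C (\<Sum>a\<in>A. f a) = (\<Sum>a\<in>A. fold (deriv q) C (f a))"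
  by (induction A rule: infinite_finite_induct) (simp_all add: fold_deriv_0 fold_deriv_add)

section \<open>Entries of \<open>S\<close> as weights\<close>

lemma wt_Cons:
  assumes "c # C \<in> Om G" "y @ c # z \<in> Om G"
  shows "wt q (c # C) (y @ c # z) = (\<Prod>d\<in>set y. q c d) * wt q C (y @ z)"
proof -
  have C: "set C = G - {c}" "set (y @ z) = G - {c}" "c \<notin> set y" "c \<notin> set z"
    using OmD[OF assms(1)] OmD[OF assms(2)] by auto
  have "invs (c # C) (y @ c # z) = {c} \<times> set y \<union> invs C (y @ z)"
    using C ords_subset[of C] ords_subset[of y] ords_subset[of z]
    unfolding invs_def ords_append by auto
  moreover have "({c} \<times> set y) \<inter> invs C (y @ z) = {}"
    using C ords_subset[of C] unfolding invs_def by auto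
  ultimately have "wt q (c # C) (y @ c # z) = (\<Prod>(a, b)\<in>{c} \<times> set y. q a b) * wt q C (y @ z)"
    unfolding wt_def by (simp add: prod.union_disjoint)
  also have "(\<Prod>(a, b)\<in>{c} \<times> set y. q a b) = (\<Prod>d\<in>set y. q c d)"
    by (rule prod.reindex_bij_witness[of _ "\<lambda>d. (c, d)" snd]) auto
  finally show ?thesis .
qed

lemma Om_Cons_split:
  assumes "c # C \<in> Om G" "D \<in> Om G"
  obtains y z where "D = y @ c # z" "c \<notin> set y" "c \<notin> set z" "distinct y" "C \<in> Om (G - {c})" "y @ z \<in> Om (G - {c})"
proof -
  have "c \<in> set D" using OmD(1)[OF assms(1)] OmD(1)[OF assms(2)] by auto
  then obtain y z where D: "D = y @ c # z" by (auto dest: split_list)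
  show ?thesis
    using that[OF D] OmD[OF assms(1)] OmD[OF assms(2)] unfolding D by (auto simp: permutations_of_set_def)
qed

text \<open>The derivation for the first letter \<open>c\<close> of \<open>C\<close> removes
  \<open>c\<close> from \<open>D\<close> and picks up \<open>q c d\<close> for every
  \<open>d\<close> in front of it, which are the inversions that involve \<open>c\<close>.\<close>

lemma S_entry_eq_wt: "C \<in> Om G \<Longrightarrow> D \<in> Om G \<Longrightarrow> S_entry q C D = wt q C D"
proof (induction C arbitrary: D G)
  case Nil
  then have "D = []" by (auto simp: permutations_of_set_def)
  then show ?case by (simp add: S_entry_def mon_Nil wt_def invs_def)
next
  case (Cons c C)
  obtain y z where s: "D = y @ c # z" "c \<notin> set y" "c \<notin> set z" "distinct y" "C \<in> Om (G - {c})" "y @ z \<in> Om (G - {c})"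
    using Om_Cons_split[OF Cons.prems] by blast
  have "S_entry q (c # C) D = (\<Prod>d\<in>set y. q c d) * S_entry q C (y @ z)"
    unfolding S_entry_def s(1)
    by (simp add: deriv_mon deriv_word_split s(2-4) fold_deriv_scal lookup_scal_mult)
  then show ?case
    using Cons.IH[OF s(5,6)] wt_Cons[OF Cons.prems(1)] Cons.prems(2) s(1) by simp
qed

lemma homog_expand:
  assumes "x \<in> homog G"
  shows "x = (\<Sum>D\<in>Om G. scal (Poly_Mapping.lookup x D) * mon D)"
proof -
  have "x = (\<Sum>w\<in>Poly_Mapping.keys x. scal (Poly_Mapping.lookup x w) * mon w)" by (rule elt_expand)
  also have "\<dots> = (\<Sum>D\<in>Om G. scal (Poly_Mapping.lookup x D) * mon D)"
    by (rule sum.mono_neutral_left) (use assms in \<open>auto simp: homog_def in_keys_iff scal_0\<close>)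
  finally show ?thesis .
qed

lemma fold_deriv_homog:
  assumes "x \<in> homog G" "C \<in> Om G"
  shows "Poly_Mapping.lookup (fold (deriv q) C x) 0 = S_app G q (Poly_Mapping.lookup x) C"
proof -
  have "fold (deriv q) C x = (\<Sum>D\<in>Om G. scal (Poly_Mapping.lookup x D) * fold (deriv q) C (mon D))"
    by (subst homog_expand[OF assms(1)]) (simp only: fold_deriv_sum fold_deriv_scal)
  then have "Poly_Mapping.lookup (fold (deriv q) C x) 0 =
      (\<Sum>D\<in>Om G. Poly_Mapping.lookup x D * S_entry q C D)"
    by (simp add: lookup_sum lookup_scal_mult S_entry_def)
  then show ?thesis
    unfolding S_app_def by (simp add: S_entry_eq_wt[OF assms(2)] mult.commute)
qed

lemma homog_0: "0 \<in> homog G"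
  by (simp add: homog_def)

lemma homog_add: "x \<in> homog G \<Longrightarrow> y \<in> homog G \<Longrightarrow> x + y \<in> homog G"
  using Poly_Mapping.keys_add[of x y] by (auto simp: homog_def)

lemma homog_scal: "x \<in> homog G \<Longrightarrow> scal c * x \<in> homog G"
  by (auto simp: homog_def in_keys_iff lookup_scal_mult)

lemma homog_uminus: "x \<in> homog G \<Longrightarrow> - x \<in> homog G"
  by (simp add: homog_def)

lemma homog_sum: "(\<And>a. a \<in> A \<Longrightarrow> f a \<in> homog G) \<Longrightarrow> (\<Sum>a\<in>A. f a) \<in> homog G"
  by (induction A rule: infinite_finite_induct) (auto intro: homog_add homog_0)

lemma homog_mon: "D \<in> Om G \<Longrightarrow> mon D \<in> homog G"
  by (simp add: homog_def mon_def)

lemma deriv_homog: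
  assumes "x \<in> homog G" "i \<in> G"
  shows "deriv q i x \<in> homog (G - {i})"
proof -
  have "deriv q i x = (\<Sum>D\<in>Om G. scal (Poly_Mapping.lookup x D) * deriv_word q i D)"
    by (subst homog_expand[OF assms(1)]) (simp only: deriv_sum deriv_scal deriv_mon)
  moreover have "deriv_word q i D \<in> homog (G - {i})" if D: "D \<in> Om G" for D
  proof -
    have "i \<in> set D" using OmD(1)[OF D] assms(2) by simp
    then obtain y z where s: "D = y @ i # z" by (auto dest: split_list)
    have "distinct D" "set D = G" using OmD[OF D] by auto
    then have "deriv_word q i D = scal (\<Prod>d\<in>set y. q i d) * mon (y @ z)" "y @ z \<in> Om (G - {i})"
      unfolding s by (auto simp: permutations_of_set_def intro!: deriv_word_split)
    then show ?thesis by (simp add: homog_scal homog_mon)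
  qed
  ultimately show ?thesis by (simp add: homog_sum homog_scal)
qed

lemma deriv_homog_notin:
  assumes "x \<in> homog G" "i \<notin> G"
  shows "deriv q i x = 0"
proof -
  have "deriv q i x = (\<Sum>D\<in>Om G. scal (Poly_Mapping.lookup x D) * deriv_word q i D)"
    by (subst homog_expand[OF assms(1)]) (simp only: deriv_sum deriv_scal deriv_mon)
  also have "\<dots> = 0"
    using assms(2) OmD(1) by (intro sum.neutral ballI) (simp add: deriv_word_notin)
  finally show ?thesis .
qed

lemma deriv_diff: "deriv q i (x - y) = deriv q i x - deriv q i y"
  using deriv_add[of q i "x - y" y] by simp

section \<open>The commutation ideal and the derivations\<close>

definition comm_gen :: "params \<Rightarrow> nat \<Rightarrow> nat \<Rightarrow> elt" where
  "comm_gen q i j = gen i * gen j - scal (q j i) * gen j * gen i"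

text \<open>Left factors are words, so that a derivation can be pushed through letter by letter;
  scalars are absorbed into \<open>z\<close>.\<close>

inductive_set comm_span :: "nat \<Rightarrow> nat set set \<Rightarrow> params \<Rightarrow> elt set" for N P q where
  zero: "0 \<in> comm_span N P q"
| step: "y \<in> comm_span N P q \<Longrightarrow> {i, j} \<in> P \<Longrightarrow> u \<in> lists {1..N} \<Longrightarrow> z \<in> carrier (free_alg N) \<Longrightarrow>
    y + mon u * comm_gen q i j * z \<in> comm_span N P q"

lemma mon_carrier: "u \<in> lists {1..N} \<Longrightarrow> mon u \<in> carrier (free_alg N)"
  by (simp add: free_alg_def mon_def)

lemma scal_carrier: "scal c \<in> carrier (free_alg N)"
  by (auto simp: free_alg_def scal_def zero_list_def)

lemma sum_carrier: "(\<And>a. a \<in> A \<Longrightarrow> f a \<in> carrier (free_alg N)) \<Longrightarrow> (\<Sum>a\<in>A. f a) \<in> carrier (free_alg N)"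
  by (induction A rule: infinite_finite_induct) (auto intro: free_alg_add_closed free_alg_0_1)

lemma deriv_word_carrier: "w \<in> lists {1..N} \<Longrightarrow> deriv_word q k w \<in> carrier (free_alg N)"
proof (induction w)
  case (Cons j w)
  then show ?case
    using mon_carrier[of w N] mon_carrier[of "[j]" N]
    by (auto intro!: free_alg_add_closed free_alg_mult_closed scal_carrier free_alg_0_1)
qed (simp add: free_alg_0_1)

lemma deriv_carrier: "z \<in> carrier (free_alg N) \<Longrightarrow> deriv q k z \<in> carrier (free_alg N)"
  unfolding deriv_def
  by (intro sum_carrier free_alg_mult_closed scal_carrier deriv_word_carrier)
    (auto simp: free_alg_def simp del: in_lists_conv_set)

lemma comm_span_add:
  assumes "x \<in> comm_span N P q" "y \<in> comm_span N P q"
  shows "x + y \<in> comm_span N P q"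
  using assms(2)
proof induction
  case (step y i j u z)
  then have "(x + y) + mon u * comm_gen q i j * z \<in> comm_span N P q"
    by (intro comm_span.step)
  then show ?case by (simp add: add.assoc)
qed (use assms(1) in simp)

lemma comm_span_sum: "(\<And>a. a \<in> A \<Longrightarrow> f a \<in> comm_span N P q) \<Longrightarrow> (\<Sum>a\<in>A. f a) \<in> comm_span N P q"
  by (induction A rule: infinite_finite_induct) (auto intro: comm_span_add comm_span.zero)

lemma comm_span_single:
  "{i, j} \<in> P \<Longrightarrow> u \<in> lists {1..N} \<Longrightarrow> z \<in> carrier (free_alg N) \<Longrightarrow> mon u * comm_gen q i j * z \<in> comm_span N P q"
  using comm_span.step[OF comm_span.zero, of i j P u N z q] by simp

lemma comm_span_mult_right: "x \<in> comm_span N P q \<Longrightarrow> a \<in> carrier (free_alg N) \<Longrightarrow> x * a \<in> comm_span N P q"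
proof (induction x rule: comm_span.induct)
  case (step y i j u z)
  then have "y * a + mon u * comm_gen q i j * (z * a) \<in> comm_span N P q"
    by (intro comm_span.step free_alg_mult_closed) auto
  then show ?case by (simp add: distrib_right mult.assoc)
qed (simp add: comm_span.zero)

lemma comm_span_scal: "x \<in> comm_span N P q \<Longrightarrow> scal c * x \<in> comm_span N P q"
  unfolding scal_commute[of c x] by (rule comm_span_mult_right[OF _ scal_carrier])

lemma comm_span_mon: "x \<in> comm_span N P q \<Longrightarrow> v \<in> lists {1..N} \<Longrightarrow> mon v * x \<in> comm_span N P q"
proof (induction x rule: comm_span.induct)
  case (step y i j u z)
  then have "mon v * y + mon (v @ u) * comm_gen q i j * z \<in> comm_span N P q"
    by (intro comm_span.step) auto
  then show ?case by (simp add: distrib_left mult.assoc mon_append)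
qed (simp add: comm_span.zero)

lemma comm_span_mult_left:
  assumes "x \<in> comm_span N P q" "a \<in> carrier (free_alg N)"
  shows "a * x \<in> comm_span N P q"
proof -
  have "a * x = (\<Sum>w\<in>Poly_Mapping.keys a. scal (Poly_Mapping.lookup a w) * mon w) * x"
    using elt_expand[of a] by metis
  also have "\<dots> = (\<Sum>w\<in>Poly_Mapping.keys a. scal (Poly_Mapping.lookup a w) * (mon w * x))"
    by (simp add: sum_distrib_right mult.assoc)
  also have "\<dots> \<in> comm_span N P q"
    using assms by (intro comm_span_sum comm_span_scal comm_span_mon)
      (auto simp: free_alg_def simp del: in_lists_conv_set)
  finally show ?thesis .
qed

lemma gens_carrier: "{i, j} \<subseteq> {1..N} \<Longrightarrow> comm_gen q i j \<in> carrier (free_alg N)"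
  unfolding comm_gen_def diff_conv_add_uminus
  using mon_carrier[of "[i]" N] mon_carrier[of "[j]" N]
  by (intro free_alg_add_closed free_alg_uminus_closed free_alg_mult_closed scal_carrier) auto

lemma comm_span_carrier:
  assumes "\<And>i j. {i, j} \<in> P \<Longrightarrow> {i, j} \<subseteq> {1..N}" "x \<in> comm_span N P q"
  shows "x \<in> carrier (free_alg N)"
  using assms(2)
proof induction
  case (step y i j u z)
  show ?case
    by (intro free_alg_add_closed free_alg_mult_closed step.IH step.hyps(4)
        mon_carrier[OF step.hyps(3)] gens_carrier[OF assms(1)[OF step.hyps(2)]])
qed (rule free_alg_0_1)

lemma comm_span_ideal:
  assumes "\<And>i j. {i, j} \<in> P \<Longrightarrow> {i, j} \<subseteq> {1..N}"
  shows "ideal (comm_span N P q) (free_alg N)"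
proof (rule idealI[OF ring_free_alg])
  interpret ring "free_alg N" by (rule ring_free_alg)
  show "subgroup (comm_span N P q) (add_monoid (free_alg N))"
  proof (rule add.subgroupI)
    show "comm_span N P q \<subseteq> carrier (free_alg N)"
      using comm_span_carrier[OF assms] by blast
    show "comm_span N P q \<noteq> {}" using comm_span.zero by blast
    fix x assume x: "x \<in> comm_span N P q"
    have "\<ominus>\<^bsub>free_alg N\<^esub> x = - x"
      using comm_span_carrier[OF assms x] by (intro minus_equality) (simp_all add: free_alg_uminus_closed)
    then show "\<ominus>\<^bsub>free_alg N\<^esub> x \<in> comm_span N P q"
      using comm_span_scal[OF x, of "-1"] by (simp add: scal_minus scal_1)
  next
    fix x y assume "x \<in> comm_span N P q" "y \<in> comm_span N P q"
    then show "x \<oplus>\<^bsub>free_alg N\<^esub> y \<in> comm_span N P q" by (simp add: comm_span_add)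
  qed
qed (simp_all add: comm_span_mult_left comm_span_mult_right)

lemma comm_ideal_eq:
  "comm_ideal N P q = Idl\<^bsub>free_alg N\<^esub> {comm_gen q i j | i j. {i, j} \<in> P}"
  by (simp add: comm_ideal_def comm_gen_def)

lemma comm_ideal_subset_span:
  assumes "\<And>i j. {i, j} \<in> P \<Longrightarrow> {i, j} \<subseteq> {1..N}"
  shows "comm_ideal N P q \<subseteq> comm_span N P q"
  unfolding comm_ideal_eq
proof (rule ring.genideal_minimal[OF ring_free_alg comm_span_ideal[OF assms]])
  show "{comm_gen q i j |i j. {i, j} \<in> P} \<subseteq> comm_span N P q"
    using comm_span_single[of _ _ P "[]" N 1 q] by (auto simp: mon_Nil free_alg_0_1)
qed

lemma comm_ideal_ideal:
  assumes "\<And>i j. {i, j} \<in> P \<Longrightarrow> {i, j} \<subseteq> {1..N}"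
  shows "ideal (comm_ideal N P q) (free_alg N)"
  unfolding comm_ideal_eq
  by (rule ring.genideal_ideal[OF ring_free_alg]) (use gens_carrier assms in auto)

text \<open>A twisted Leibniz rule whose first term is absent because the generator is a constant:
  for \<open>k = j\<close> the coefficient \<open>q j i\<close> cancels it, for \<open>k = i\<close>
  the relation \<open>sigma q i j = 1\<close> does.\<close>

lemma deriv_comm_gen:
  assumes "unit_on P q" "{i, j} \<in> P" "i \<noteq> j"
  shows "deriv q k (comm_gen q i j * z) = scal (q k i * q k j) * (comm_gen q i j * deriv q k z)"
proof -
  have s: "q j i * q i j = 1" using assms by (auto simp: unit_on_def sigma_def mult.commute)
  have eq: "comm_gen q i j * z = gen i * (gen j * z) - scal (q j i) * (gen j * (gen i * z))" for z
    by (simp add: comm_gen_def left_diff_distrib mult.assoc)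
  have s': "scal (q j i) * (scal (q i j) * x) = x" "scal (q i j) * (scal (q j i) * x) = x" for x
    by (simp_all add: scal_scal s mult.commute[of "q i j"] scal_1)
  consider "k = i" | "k = j" | "k \<noteq> i" "k \<noteq> j" by blast
  then show ?thesis
    using assms(3) unfolding eq deriv_diff deriv_scal deriv_gen_mult
    by cases (simp_all add: distrib_left right_diff_distrib mult.assoc mon_scal_left s' scal_mult[symmetric] scal_left_commute)
qed

lemma deriv_comm_span:
  assumes q: "unit_on P q" and P: "\<And>i j. {i, j} \<in> P \<Longrightarrow> i \<noteq> j" and y: "y \<in> comm_span N P q"
  shows "deriv q k y \<in> comm_span N P q"
  using y
proof induction
  case zero
  then show ?case by (simp add: deriv_0 comm_span.zero)
next
  case (step y i j u z)
  have "deriv q k (mon u * (comm_gen q i j * z)) \<in> comm_span N P q"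
    using step.hyps(3)
  proof (induction u rule: list.induct)
    case Nil
    have "comm_gen q i j * deriv q k z \<in> comm_span N P q"
      using comm_span_single[OF step.hyps(2), of "[]" N "deriv q k z" q] deriv_carrier[OF step.hyps(4)]
      by (simp add: mon_Nil)
    then show ?case
      by (simp add: mon_Nil deriv_comm_gen[OF q step.hyps(2) P[OF step.hyps(2)]] comm_span_scal)
  next
    case (Cons a u)
    have au: "a \<in> {1..N}" "u \<in> lists {1..N}"
      using Cons.prems by auto
    have "mon u * (comm_gen q i j * z) \<in> comm_span N P q"
      using comm_span_single[OF step.hyps(2) au(2) step.hyps(4), of q] by (simp only: mult.assoc)
    moreover have "gen a * deriv q k (mon u * (comm_gen q i j * z)) \<in> comm_span N P q"
      using au by (intro comm_span_mon Cons.IH) simp_all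
    ultimately show ?case
      unfolding mon_Cons[of a u] mult.assoc deriv_gen_mult
      by (auto intro!: comm_span_add comm_span_scal comm_span.zero)
  qed
  then show ?case
    using step by (simp add: deriv_add comm_span_add mult.assoc)
qed

lemma lookup_gen_mult: "Poly_Mapping.lookup (gen i * x) 0 = 0"
proof -
  have "0 \<notin> Poly_Mapping.keys (gen i * x)"
    using keys_mult[of "gen i" x] by (auto simp: mon_def zero_list_def plus_list_def)
  then show ?thesis by (simp add: in_keys_iff)
qed

lemma lookup_comm_span: "y \<in> comm_span N P q \<Longrightarrow> Poly_Mapping.lookup y 0 = 0"
proof (induction rule: comm_span.induct)
  case (step y i j u z)
  have "Poly_Mapping.lookup (mon u * (comm_gen q i j * z)) 0 = 0"
  proof (cases u)
    case Nil
    have "comm_gen q i j * z = gen i * (gen j * z) - scal (q j i) * (gen j * (gen i * z))"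
      by (simp add: comm_gen_def left_diff_distrib mult.assoc)
    then show ?thesis
      using Nil by (simp add: mon_Nil lookup_minus lookup_scal_mult lookup_gen_mult)
  next
    case (Cons a v)
    then show ?thesis by (simp add: mon_Cons[of a v] mult.assoc lookup_gen_mult)
  qed
  then show ?case using step by (simp add: lookup_add mult.assoc)
qed simp

lemma fold_deriv_comm_span:
  assumes "unit_on P q" "\<And>i j. {i, j} \<in> P \<Longrightarrow> i \<noteq> j" "y \<in> comm_span N P q"
  shows "Poly_Mapping.lookup (fold (deriv q) C y) 0 = 0"
  using assms(3)
  by (induction C arbitrary: y) (simp_all add: lookup_comm_span deriv_comm_span[OF assms(1,2)])

lemma scal_sum: "scal (\<Sum>a\<in>A. f a) = (\<Sum>a\<in>A. scal (f a))"
  by (induction A rule: infinite_finite_induct) (simp_all add: scal_0 scal_add)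

section \<open>Normal forms modulo the ideal\<close>

locale comm_setting =
  fixes N :: nat and P :: "nat set set" and q :: params
  assumes pairs: "\<And>i j. {i, j} \<in> P \<Longrightarrow> i \<in> {1..N} \<and> j \<in> {1..N} \<and> i \<noteq> j"
begin

abbreviation "I \<equiv> comm_ideal N P q"

lemma I_ideal: "ideal I (free_alg N)"
  by (rule comm_ideal_ideal) (use pairs in blast)

lemma I_span: "I \<subseteq> comm_span N P q"
  by (rule comm_ideal_subset_span) (use pairs in blast)

lemma I_0: "0 \<in> I"
  using additive_subgroup.zero_closed[OF ideal.axioms(1)[OF I_ideal]] by simp

lemma I_add: "x \<in> I \<Longrightarrow> y \<in> I \<Longrightarrow> x + y \<in> I"
  using additive_subgroup.a_closed[OF ideal.axioms(1)[OF I_ideal]] by simp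

lemma I_left: "x \<in> I \<Longrightarrow> a \<in> carrier (free_alg N) \<Longrightarrow> a * x \<in> I"
  using ideal.I_l_closed[OF I_ideal] by simp

lemma I_right: "x \<in> I \<Longrightarrow> a \<in> carrier (free_alg N) \<Longrightarrow> x * a \<in> I"
  using ideal.I_r_closed[OF I_ideal] by simp

lemma I_scal: "x \<in> I \<Longrightarrow> scal c * x \<in> I"
  by (rule I_left[OF _ scal_carrier])

lemma I_uminus: "x \<in> I \<Longrightarrow> - x \<in> I"
  using I_scal[of x "-1"] by (simp add: scal_minus scal_1)

lemma I_sum: "(\<And>a. a \<in> A \<Longrightarrow> f a \<in> I) \<Longrightarrow> (\<Sum>a\<in>A. f a) \<in> I"
  by (induction A rule: infinite_finite_induct) (auto intro: I_add I_0)

lemma I_gen: "{i, j} \<in> P \<Longrightarrow> gen i * gen j - scal (q j i) * (gen j * gen i) \<in> I"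
proof -
  assume ij: "{i, j} \<in> P"
  have "{comm_gen q i j | i j. {i, j} \<in> P} \<subseteq> carrier (free_alg N)"
    using gens_carrier pairs by auto
  then have "comm_gen q i j \<in> I"
    unfolding comm_ideal_eq using ring.genideal_self[OF ring_free_alg] ij by blast
  then show ?thesis by (simp add: comm_gen_def mult.assoc)
qed

lemma I_trans: "x - scal c * y \<in> I \<Longrightarrow> y - scal d * z \<in> I \<Longrightarrow> x - scal (c * d) * z \<in> I"
proof -
  assume *: "x - scal c * y \<in> I" "y - scal d * z \<in> I"
  have "x - scal (c * d) * z = (x - scal c * y) + scal c * (y - scal d * z)"
    by (simp add: right_diff_distrib scal_scal)
  then show ?thesis using I_add[OF *(1) I_scal[OF *(2)]] by metis
qed

lemma I_mon_left: "x - scal c * y \<in> I \<Longrightarrow> u \<in> lists {1..N} \<Longrightarrow> mon u * x - scal c * (mon u * y) \<in> I"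
  using I_left[OF _ mon_carrier, of "x - scal c * y" u] by (simp add: right_diff_distrib mon_scal_left)

lemma I_mon_right: "x - scal c * y \<in> I \<Longrightarrow> u \<in> lists {1..N} \<Longrightarrow> x * mon u - scal c * (y * mon u) \<in> I"
  using I_right[OF _ mon_carrier, of "x - scal c * y" u] by (simp add: left_diff_distrib mult.assoc)

lemma I_move_left:
  assumes "c \<in> {1..N}" "y \<in> lists {1..N}" "distinct y" "\<And>d. d \<in> set y \<Longrightarrow> {c, d} \<in> P"
  shows "mon (y @ [c]) - scal (\<Prod>d\<in>set y. q c d) * mon (c # y) \<in> I"
  using assms(2-4)
proof (induction y rule: list.induct)
  case Nil
  then show ?case by (simp add: scal_1 I_0)
next
  case (Cons d y)
  have d: "d \<in> {1..N}" "[d] \<in> lists {1..N}" "y \<in> lists {1..N}" using Cons.prems(1) by auto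
  have "mon (y @ [c]) - scal (\<Prod>d\<in>set y. q c d) * mon (c # y) \<in> I"
    using Cons.IH Cons.prems(2,3) d by auto
  from I_mon_left[OF this d(2)]
  have 1: "mon (d # y @ [c]) - scal (\<Prod>d\<in>set y. q c d) * mon (d # c # y) \<in> I"
    by (simp add: mon_append[symmetric])
  have "gen d * gen c - scal (q c d) * (gen c * gen d) \<in> I"
    using Cons.prems(3)[of d] by (intro I_gen) (simp add: insert_commute)
  from I_mon_right[OF this d(3)]
  have 2: "mon (d # c # y) - scal (q c d) * mon (c # d # y) \<in> I"
    by (simp add: mon_append[symmetric])
  show ?case
    using I_trans[OF 1 2] Cons.prems(2) by (simp add: mult.commute)
qed

text \<open>Letters in front of \<open>c\<close> in \<open>D\<close> are inverted with
  \<open>c\<close>, hence paired with it in \<open>P\<close> as the classes agree. So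
  \<open>c\<close> commutes to the front at the cost of its factors in \<open>wt\<close>, and the
  tails are again equivalent.\<close>

lemma I_mon_equiv:
  assumes "C \<in> Om G" "D \<in> Om G" "cls P C = cls P D" "G \<subseteq> {1..N}"
  shows "mon D - scal (wt q C D) * mon C \<in> I"
  using assms
proof (induction C arbitrary: D G)
  case Nil
  then have "D = []" by (auto simp: permutations_of_set_def)
  then show ?case by (simp add: wt_def invs_def scal_1 I_0)
next
  case (Cons c C)
  obtain y z where s: "D = y @ c # z" "c \<notin> set y" "c \<notin> set z" "distinct y" "C \<in> Om (G - {c})" "y @ z \<in> Om (G - {c})"
    using Om_Cons_split[OF Cons.prems(1,2)] by blast
  have inP: "{a, b} \<in> P" if "(a, b) \<in> invs (c # C) D" for a b
    using that Cons.prems(3) unfolding cls_eq_iff[OF Cons.prems(1,2)] by blast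
  have "(c, d) \<in> invs (c # C) D" if "d \<in> set y" for d
    using that OmD(1)[OF s(5)] OmD(1)[OF s(6)] unfolding s(1) by (auto simp: invs_def ords_append)
  then have yP: "{c, d} \<in> P" if "d \<in> set y" for d using that inP by blast
  have "invs C (y @ z) \<subseteq> invs (c # C) D"
    unfolding s(1) by (auto simp: invs_def ords_append)
  then have eq: "cls P C = cls P (y @ z)"
    unfolding cls_eq_iff[OF s(5,6)] using inP by blast
  have sub: "set D \<subseteq> {1..N}" using OmD(1)[OF Cons.prems(2)] Cons.prems(4) by simp
  then have lists: "c \<in> {1..N}" "[c] \<in> lists {1..N}" "y \<in> lists {1..N}" "z \<in> lists {1..N}"
    unfolding s(1) by auto
  from I_mon_right[OF I_move_left[OF lists(1,3) s(4) yP] lists(4)]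
  have 1: "mon D - scal (\<Prod>d\<in>set y. q c d) * mon (c # y @ z) \<in> I"
    by (simp add: mon_append[symmetric] s(1))
  have "G - {c} \<subseteq> {1..N}" using Cons.prems(4) by auto
  from I_mon_left[OF Cons.IH[OF s(5,6) eq this] lists(2)]
  have 2: "mon (c # y @ z) - scal (wt q C (y @ z)) * mon (c # C) \<in> I"
    by (simp add: mon_append[symmetric])
  show ?case
    using I_trans[OF 1 2] wt_Cons[OF Cons.prems(1), of y z q] Cons.prems(2) by (simp add: s(1))
qed

text \<open>Modulo \<open>I\<close> every word is a multiple of its representative \<open>r\<close>,
  and the coefficient collected at \<open>r\<close> is \<open>psi\<close> at
  \<open>r\<close>.\<close>

lemma psi_zero_imp_I:
  assumes G: "finite G" "G \<subseteq> {1..N}" and x: "x \<in> homog G"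
    and psi: "\<And>C. C \<in> Om G \<Longrightarrow> psi P G q (Poly_Mapping.lookup x) C = 0"
  shows "x \<in> I"
proof -
  let ?x = "Poly_Mapping.lookup x" and ?r = "rep P G"
  have "(\<Sum>D\<in>Om G. scal (?x D * wt q (?r D) D) * mon (?r D)) =
      (\<Sum>r\<in>set (reps P G). \<Sum>D\<in>{D \<in> Om G. ?r D = r}. scal (?x D * wt q (?r D) D) * mon (?r D))"
    using G(1) by (intro sum.group[symmetric]) (auto simp: set_reps)
  also have "\<dots> = (\<Sum>r\<in>set (reps P G). scal (psi P G q ?x r) * mon r)"
  proof (rule sum.cong[OF refl])
    fix r assume r: "r \<in> set (reps P G)"
    then have rO: "r \<in> Om G" and rr: "?r r = r" using G(1) set_reps_Om rep_reps by auto
    have set: "{D \<in> Om G. ?r D = r} = {D \<in> Om G. cls P D = cls P r}"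
      using rO rr rep_eq_iff by metis
    have "(\<Sum>D\<in>{D \<in> Om G. ?r D = r}. scal (?x D * wt q (?r D) D) * mon (?r D)) =
        (\<Sum>D\<in>{D \<in> Om G. ?r D = r}. scal (wt q r D * ?x D)) * mon r"
      unfolding sum_distrib_right by (intro sum.cong) (auto simp: mult.commute)
    also have "(\<Sum>D\<in>{D \<in> Om G. ?r D = r}. scal (wt q r D * ?x D)) = scal (psi P G q ?x r)"
      unfolding set psi_def by (simp add: scal_sum)
    finally show "(\<Sum>D\<in>{D \<in> Om G. ?r D = r}. scal (?x D * wt q (?r D) D) * mon (?r D)) =
        scal (psi P G q ?x r) * mon r" .
  qed
  also have "\<dots> = 0" using psi set_reps_Om[OF G(1)] by (intro sum.neutral) (simp add: scal_0)
  finally have zero: "(\<Sum>D\<in>Om G. scal (?x D * wt q (?r D) D) * mon (?r D)) = 0" .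
  have "x = (\<Sum>D\<in>Om G. scal (?x D) * mon D)" by (rule homog_expand[OF x])
  also have "\<dots> = (\<Sum>D\<in>Om G. scal (?x D) * (mon D - scal (wt q (?r D) D) * mon (?r D)))"
    by (simp add: right_diff_distrib sum_subtractf scal_scal zero)
  also have "\<dots> \<in> I"
    by (intro I_sum I_scal I_mon_equiv[OF rep_Om _ cls_rep G(2)])
  finally show ?thesis .
qed

section \<open>Constants in the quotient\<close>

lemma ideal_part_0: "0 \<in> ideal_part N P q G"
  by (simp add: ideal_part_def I_0 homog_0)

lemma quot_class_iff: "y \<in> quot_class N P q G x \<longleftrightarrow> (\<exists>h\<in>ideal_part N P q G. y = h + x)"
  by (auto simp: quot_class_def a_r_coset_def r_coset_def)

lemma quot_class_self: "x \<in> quot_class N P q G x"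
  using ideal_part_0 by (auto simp: quot_class_iff)

lemma quot_class_0: "quot_class N P q G 0 = ideal_part N P q G"
  by (auto simp: quot_class_iff)

lemma quot_class_ideal_part: "x \<in> ideal_part N P q G \<Longrightarrow> quot_class N P q G x = ideal_part N P q G"
proof -
  assume x: "x \<in> ideal_part N P q G"
  have sub: "y + - x \<in> ideal_part N P q G" if "y \<in> ideal_part N P q G" for y
    using that x I_add[OF _ I_uminus] homog_add[OF _ homog_uminus] unfolding ideal_part_def by blast
  show ?thesis
  proof (intro equalityI subsetI)
    fix y assume "y \<in> quot_class N P q G x"
    then obtain h where "h \<in> ideal_part N P q G" "y = h + x" unfolding quot_class_iff by blast
    then show "y \<in> ideal_part N P q G" using x by (simp add: ideal_part_def I_add homog_add)
  next
    fix y assume "y \<in> ideal_part N P q G"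
    then show "y \<in> quot_class N P q G x"
      unfolding quot_class_iff by (intro bexI[of _ "y + - x"] sub) simp
  qed
qed

text \<open>The first letter of an ordering acts first, so removing it from the row index means
  differentiating the element.\<close>

lemma S_app_deriv:
  assumes "x \<in> homog G" "i # C \<in> Om G"
  shows "S_app G q (Poly_Mapping.lookup x) (i # C) = S_app (G - {i}) q (Poly_Mapping.lookup (deriv q i x)) C"
proof -
  have "i \<in> G" "C \<in> Om (G - {i})" using assms(2) by (auto simp: permutations_of_set_def)
  then show ?thesis
    using fold_deriv_homog[OF assms, of q] fold_deriv_homog[OF deriv_homog[OF assms(1)], of i C q q] by simp
qed

end

locale unit_setting = comm_setting +
  assumes unit: "unit_on P q"
begin

lemma I_S_app_zero:
  assumes "x \<in> I" "x \<in> homog G" "C \<in> Om G"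
  shows "S_app G q (Poly_Mapping.lookup x) C = 0"
proof -
  have "x \<in> comm_span N P q" using assms(1) I_span by blast
  then have "Poly_Mapping.lookup (fold (deriv q) C x) 0 = 0"
    by (rule fold_deriv_comm_span[OF unit, rotated]) (use pairs in blast)
  then show ?thesis using fold_deriv_homog[OF assms(2,3)] by simp
qed

lemma nondeg_ideal_iff:
  assumes "nondeg P G q" "finite G" "G \<subseteq> {1..N}" "x \<in> homog G"
  shows "x \<in> I \<longleftrightarrow> (\<forall>C\<in>Om G. S_app G q (Poly_Mapping.lookup x) C = 0)"
  using assms I_S_app_zero psi_zero_imp_I unfolding nondeg_def by blast

text \<open>The derivatives of a representative of a constant lie in the ideal, which
  \<open>S\<close> kills. So all rows of \<open>S\<close> vanish on the representative, and
  nondegeneracy puts it into the ideal.\<close>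

lemma nondeg_imp_no_constant:
  assumes G: "finite G" "G \<subseteq> {1..N}" "G \<noteq> {}" and nd: "nondeg P G q"
    and X: "X \<in> quot_constants N P q G"
  shows "X = quot_class N P q G 0"
proof -
  obtain x where x: "x \<in> homog G" "X = quot_class N P q G x"
    and const: "\<And>i. i \<in> {1..N} \<Longrightarrow> quot_deriv N P q G i X = quot_class N P q (G - {i}) 0"
    using X by (auto simp: quot_constants_def quot_homog_def)
  have dI: "deriv q i x \<in> I" "deriv q i x \<in> homog (G - {i})" if "i \<in> G" for i
  proof -
    have "deriv q i x \<in> quot_deriv N P q G i X"
      unfolding quot_deriv_def x(2) using quot_class_self by blast
    then show "deriv q i x \<in> I" "deriv q i x \<in> homog (G - {i})"
      using const[of i] that G(2) unfolding quot_class_0 ideal_part_def by blast+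
  qed
  have "S_app G q (Poly_Mapping.lookup x) C = 0" if C: "C \<in> Om G" for C
  proof -
    have "C \<noteq> []" using OmD(1)[OF C] G(3) by auto
    then obtain i C' where iC: "C = i # C'" by (cases C) auto
    then have "i \<in> G" "C' \<in> Om (G - {i})" using C by (auto simp: permutations_of_set_def)
    then show ?thesis
      using S_app_deriv[OF x(1)] C dI I_S_app_zero unfolding iC by simp
  qed
  then have "x \<in> I" using nondeg_ideal_iff[OF nd G(1,2) x(1)] by blast
  then have "x \<in> ideal_part N P q G" using x(1) by (simp add: ideal_part_def)
  then show ?thesis unfolding x(2) quot_class_0 by (rule quot_class_ideal_part)
qed

text \<open>A derivative of a kernel element is in the kernel one degree lower, where nondegeneracy
  makes the kernel equal to the ideal. The argument covers every \<open>y\<close> in the class,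
  since \<open>quot_deriv\<close> unites over all of them.\<close>

lemma kernel_imp_constant:
  assumes G: "finite G" "G \<subseteq> {1..N}" and x: "x \<in> homog G" "x \<notin> I"
    and Sx: "\<And>C. C \<in> Om G \<Longrightarrow> S_app G q (Poly_Mapping.lookup x) C = 0"
    and nd: "\<And>i. i \<in> G \<Longrightarrow> nondeg P (G - {i}) q"
  shows "\<exists>X\<in>quot_constants N P q G. X \<noteq> quot_class N P q G 0"
proof (intro bexI)
  show "quot_class N P q G x \<noteq> quot_class N P q G 0"
    using quot_class_self[of x G] x(2) unfolding quot_class_0 ideal_part_def by blast
  have "quot_deriv N P q G i (quot_class N P q G x) = quot_class N P q (G - {i}) 0" for i
  proof -
    have "deriv q i y \<in> ideal_part N P q (G - {i})" if y: "y \<in> quot_class N P q G x" for y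
    proof -
      obtain h where h: "h \<in> I" "h \<in> homog G" "y = h + x"
        using y by (auto simp: quot_class_iff ideal_part_def)
      then have yh: "y \<in> homog G" using x(1) homog_add by simp
      have Sy: "S_app G q (Poly_Mapping.lookup y) C = 0" if C: "C \<in> Om G" for C
        using I_S_app_zero[OF h(1,2) C] Sx[OF C] unfolding h(3) S_app_def lookup_add distrib_left sum.distrib by simp
      show ?thesis
      proof (cases "i \<in> G")
        case False
        then show ?thesis using deriv_homog_notin[OF yh] ideal_part_0 by simp
      next
        case True
        have "S_app (G - {i}) q (Poly_Mapping.lookup (deriv q i y)) C = 0" if C: "C \<in> Om (G - {i})" for C
        proof -
          have iC: "i # C \<in> Om G" using C True by (auto simp: permutations_of_set_def)
          then show ?thesis using S_app_deriv[OF yh iC] Sy by simp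
        qed
        moreover have Gi: "finite (G - {i})" "G - {i} \<subseteq> {1..N}" using G by auto
        moreover have dh: "deriv q i y \<in> homog (G - {i})" by (rule deriv_homog[OF yh True])
        ultimately show ?thesis
          using nondeg_ideal_iff[OF nd[OF True] Gi dh] unfolding ideal_part_def by blast
      qed
    qed
    then have "quot_class N P q (G - {i}) (deriv q i y) = ideal_part N P q (G - {i})"
      if "y \<in> quot_class N P q G x" for y
      using that quot_class_ideal_part by blast
    then show ?thesis
      unfolding quot_deriv_def quot_class_0 using quot_class_self[of x G] by blast
  qed
  then show "quot_class N P q G x \<in> quot_constants N P q G"
    using x(1) by (auto simp: quot_constants_def quot_homog_def)
qed

end

lemma elt_of_function:
  assumes "finite G"
  obtains x where "x \<in> homog G" "\<And>D. D \<in> Om G \<Longrightarrow> Poly_Mapping.lookup x D = f D"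
proof
  let ?x = "\<Sum>D\<in>Om G. scal (f D) * mon D"
  show "?x \<in> homog G" by (intro homog_sum homog_scal homog_mon)
  fix D assume D: "D \<in> Om G"
  have "Poly_Mapping.lookup (scal (f E) * mon E) D = (if E = D then f E else 0)" for E
    by (simp add: lookup_scal_mult mon_def lookup_single when_def)
  then have "Poly_Mapping.lookup ?x D = (\<Sum>E\<in>Om G. if E = D then f E else 0)"
    by (simp add: lookup_sum)
  then show "Poly_Mapping.lookup ?x D = f D" using D by simp
qed

section \<open>The rank of \<open>S\<close>\<close>

lemma cols_map: "cols (mat nr nc (\<lambda>(a, b). f a b)) = map (\<lambda>b. vec nr (\<lambda>a. f a b)) [0..<nc]"
  by (rule nth_equalityI) (auto simp: cols_def)

text \<open>The columns of \<open>S\<close> are multiples of the columns indexed by the representatives.\<close>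

lemma rank_iff_nondeg:
  assumes q: "unit_on P q" and G: "finite G"
  shows "S_rank q G = length (reps P G) \<longleftrightarrow> nondeg P G q"
proof -
  define os where "os = orderings G"
  define rs where "rs = reps P G"
  let ?m = "length os" and ?k = "length rs"
  interpret vec_space "TYPE(complex)" ?m .
  have os: "set os = Om G" using set_orderings[OF G] by (simp add: os_def)
  have rsO: "r \<in> Om G" if "r \<in> set rs" for r using that set_reps_Om[OF G] by (simp add: rs_def)
  have drs: "distinct rs" by (simp add: rs_def distinct_reps)
  define cv where "cv D = vec ?m (\<lambda>a. wt q (os ! a) D)" for D
  define T where "T = mat ?m ?k (\<lambda>(a, b). wt q (os ! a) (rs ! b))"
  have S: "S_mat q G = mat ?m ?m (\<lambda>(a, b). wt q (os ! a) (os ! b))"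
    unfolding S_mat_def Let_def os_def[symmetric]
    using os nth_mem[of _ os] by (intro cong_mat) (auto intro!: S_entry_eq_wt)
  have Tc: "T \<in> carrier_mat ?m ?k" by (simp add: T_def)
  have colsS: "set (cols (S_mat q G)) = cv ` Om G"
  proof -
    have "map (\<lambda>b. cv (os ! b)) [0..<?m] = map cv os" by (rule nth_equalityI) auto
    then show ?thesis unfolding S cols_map cv_def[symmetric] os[symmetric] by simp
  qed
  have colsT: "cols T = map cv rs"
    unfolding T_def cols_map cv_def[symmetric] by (rule nth_equalityI) auto
  have cvc: "cv D \<in> carrier_vec ?m" for D by (simp add: cv_def)
  have span_eq: "span (cv ` Om G) = span (cv ` set rs)"
  proof
    show "span (cv ` set rs) \<subseteq> span (cv ` Om G)"
      using rsO by (intro span_is_monotone) auto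
    show "span (cv ` Om G) \<subseteq> span (cv ` set rs)"
    proof (rule span_is_subset[OF _ span_is_submodule], clarify)
      fix D assume D: "D \<in> Om G"
      have "cv D = wt q (rep P G D) D \<cdot>\<^sub>v cv (rep P G D)"
      proof (rule eq_vecI)
        fix a assume "a < dim_vec (wt q (rep P G D) D \<cdot>\<^sub>v cv (rep P G D))"
        then have a: "a < ?m" by (simp add: cv_def)
        then have "os ! a \<in> Om G" using os nth_mem by blast
        then show "cv D $ a = (wt q (rep P G D) D \<cdot>\<^sub>v cv (rep P G D)) $ a"
          using a wt_gate_right[OF q _ D rep_Om[OF D] cls_rep[OF D]] by (simp add: cv_def mult.commute)
      qed (simp add: cv_def)
      moreover have "cv (rep P G D) \<in> span (cv ` set rs)"
        using rep_in_reps[OF G D] cvc in_own_span[of "cv ` set rs"] by (auto simp: rs_def)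
      ultimately show "cv D \<in> span (cv ` set rs)"
        using smult_in_span[of "cv ` set rs"] cvc by auto
    qed (use cvc in auto)
  qed
  have rank_eq: "S_rank q G = rank T"
  proof -
    have "dim_row (S_mat q G) = ?m" by (simp add: S)
    then have "S_rank q G = rank (S_mat q G)" by (simp add: S_rank_def)
    also have "\<dots> = rank T"
      unfolding rank_def colsS colsT set_map span_eq ..
    finally show ?thesis .
  qed
  \<comment> \<open>\<open>T\<close> has a row for every ordering, \<open>red_mat\<close> only for
    representatives; rows of one class are proportional, so both have the same kernel.\<close>
  have kernel: "red_mat P G q *\<^sub>v v = 0\<^sub>v ?k \<longleftrightarrow> T *\<^sub>v v = 0\<^sub>v ?m" if v: "v \<in> carrier_vec ?k" for v
  proof -
    let ?f = "\<lambda>C. \<Sum>b<?k. wt q C (rs ! b) * v $ b"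
    have T: "(T *\<^sub>v v) $ a = ?f (os ! a)" if "a < ?m" for a
      using v that by (auto simp: T_def scalar_prod_def atLeast0LessThan intro!: sum.cong)
    have R: "(red_mat P G q *\<^sub>v v) $ a = ?f (rs ! a)" if "a < ?k" for a
      using red_mat_mult_vec[of v P G a q] v that by (simp add: rs_def)
    have "T *\<^sub>v v = 0\<^sub>v ?m \<longleftrightarrow> (\<forall>a<?m. ?f (os ! a) = 0)"
      using T by (auto simp: vec_eq_iff T_def)
    also have "\<dots> \<longleftrightarrow> (\<forall>C\<in>Om G. ?f C = 0)"
      unfolding os[symmetric] all_set_conv_all_nth ..
    also have "\<dots> \<longleftrightarrow> (\<forall>r\<in>set rs. ?f r = 0)"
    proof (intro iffI ballI)
      fix C assume *: "\<forall>r\<in>set rs. ?f r = 0" and C: "C \<in> Om G"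
      have "?f C = (\<Sum>b<?k. wt q C (rep P G C) * (wt q (rep P G C) (rs ! b) * v $ b))"
        using wt_gate_left[OF q C rsO rep_Om[OF C] cls_rep[OF C, symmetric]]
        by (intro sum.cong) auto
      also have "\<dots> = 0"
        unfolding sum_distrib_left[symmetric] using * rep_in_reps[OF G C, of P] by (simp add: rs_def)
      finally show "?f C = 0" .
    qed (use rsO in auto)
    also have "\<dots> \<longleftrightarrow> (\<forall>a<?k. ?f (rs ! a) = 0)" unfolding all_set_conv_all_nth ..
    also have "\<dots> \<longleftrightarrow> red_mat P G q *\<^sub>v v = 0\<^sub>v ?k"
      using R by (auto simp: vec_eq_iff red_mat_def rs_def)
    finally show ?thesis by simp
  qed
  have det0: "det (red_mat P G q) = 0 \<longleftrightarrow> (\<exists>v. v \<in> carrier_vec ?k \<and> v \<noteq> 0\<^sub>v ?k \<and> T *\<^sub>v v = 0\<^sub>v ?m)"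
    using det_0_iff_vec_prod_zero_field[OF red_mat_carrier, of P G q] kernel unfolding rs_def by blast
  \<comment> \<open>Linear independence is stated for the set of columns, which forgets repetitions;
    both directions therefore prove first that the columns are distinct.\<close>
  have "rank T = ?k \<longleftrightarrow> det (red_mat P G q) \<noteq> 0"
  proof
    assume rk: "rank T = ?k"
    have dist: "distinct (cols T)"
    proof (rule ccontr)
      assume "\<not> distinct (cols T)"
      then have "card (set (cols T)) < ?k"
        using card_distinct[of "cols T"] card_length[of "cols T"] by (fastforce simp: colsT)
      moreover obtain U where U: "maximal U (\<lambda>T'. T' \<subseteq> set (cols T) \<and> lin_indpt T')"
        using maximal_exists_superset[of "set (cols T)" "\<lambda>T'. T' \<subseteq> set (cols T) \<and> lin_indpt T'" "{}"]
        by (auto simp: finite_lin_indpt2)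
      moreover have "card U \<le> card (set (cols T))"
        using U by (intro card_mono) (auto simp: maximal_def)
      ultimately show False using rank_card_indpt[OF Tc U] rk by simp
    qed
    then have "lin_indpt (set (cols T))" using full_rank_lin_indpt[OF Tc rk] by simp
    then show "det (red_mat P G q) \<noteq> 0"
      unfolding det0 using lin_depI[OF Tc _ _ _ dist] by blast
  next
    assume d: "det (red_mat P G q) \<noteq> 0"
    have dist: "distinct (cols T)"
    proof (rule ccontr)
      assume "\<not> distinct (cols T)"
      then obtain b c where bc: "b < ?k" "c < ?k" "b \<noteq> c" "cv (rs ! b) = cv (rs ! c)"
        unfolding colsT by (auto simp: distinct_conv_nth)
      have eq: "wt q C (rs ! b) = wt q C (rs ! c)" if "C \<in> Om G" for C
      proof -
        have "C \<in> set os" using that os by simp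
        then obtain a where "a < ?m" "os ! a = C" by (auto simp: in_set_conv_nth)
        then show ?thesis using arg_cong[OF bc(4), of "\<lambda>w. w $ a"] by (simp add: cv_def)
      qed
      have "col (red_mat P G q) b = col (red_mat P G q) c"
        using bc(1,2) rsO eq by (intro eq_vecI) (auto simp: red_mat_def rs_def)
      then show False
        using det_identical_cols[OF red_mat_carrier bc(3)] bc(1,2) d by (simp add: rs_def)
    qed
    then have "lin_indpt (set (cols T))"
      using lin_depE[OF Tc _ dist] d unfolding det0 by blast
    then show "rank T = ?k" using lin_indpt_full_rank[OF Tc dist] by simp
  qed
  then show ?thesis
    using rank_eq det_imp_nondeg[OF q G] nondeg_imp_det[OF q G] by (auto simp: rs_def)
qed

section \<open>The primitive boundary\<close>

text \<open>Pairs in \<open>P\<close> get the value 1 in each direction, stronger than a product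
  equal to 1; thus two orderings of one class with letters in \<open>{1..N}\<close> have weight
  1.\<close>

definition edge_params :: "nat \<Rightarrow> nat set set \<Rightarrow> params \<Rightarrow> params" where
  "edge_params N P f = (\<lambda>i\<in>{1..N}. \<lambda>j\<in>{1..N}. if {i, j} \<in> P \<or> i = j then 1 else f i j)"

lemma edge_params_apply:
  "i \<in> {1..N} \<Longrightarrow> j \<in> {1..N} \<Longrightarrow> edge_params N P f i j = (if {i, j} \<in> P \<or> i = j then 1 else f i j)"
  by (simp add: edge_params_def)

lemma edge_params_constrained:
  assumes "\<And>i j. {i, j} \<in> P \<Longrightarrow> i \<in> {1..N} \<and> j \<in> {1..N} \<and> i \<noteq> j" "\<And>i j. f i j \<noteq> 0"
  shows "edge_params N P f \<in> constrained_params N P"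
proof -
  have "sigma (edge_params N P f) i j = 1" if "{i, j} \<in> P" for i j
    using assms(1)[OF that] that by (simp add: sigma_def edge_params_apply insert_commute)
  moreover have "edge_params N P f \<in> param_space N"
    unfolding param_space_def edge_params_def using assms(2) by auto
  ultimately show ?thesis by (auto simp: constrained_params_def)
qed

lemma prod_if_power:
  assumes "finite X"
  shows "(\<Prod>i\<in>X. if Q i then c else 1) = (c :: complex) ^ card {i \<in> X. Q i}"
proof -
  have "(\<Prod>i\<in>X. if Q i then c else 1) = (\<Prod>i\<in>{i \<in> X. Q i}. c)"
    using assms by (rule prod.inter_filter[symmetric])
  then show ?thesis by simp
qed

text \<open>Every product tested by the criterion is a positive power of 2. This single point shows
  that nondegeneracy is the generic case on the constrained torus.\<close>

lemma nondeg_edge_params: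
  assumes H: "H \<subseteq> {1..N}" and P: "\<And>i j. {i, j} \<in> P \<Longrightarrow> i \<in> {1..N} \<and> j \<in> {1..N} \<and> i \<noteq> j"
  shows "nondeg P H (edge_params N P (\<lambda>_ _. 2))"
proof (rule nondeg_criterion)
  let ?q = "edge_params N P (\<lambda>_ _. 2)"
  show "unit_on P ?q" using edge_params_constrained[OF P, where f = "\<lambda>_ _. 2"] by (simp add: constrained_params_iff)
  show "finite H" using H finite_subset by blast
  fix K assume K: "K \<subseteq> H" "\<exists>a\<in>K. \<exists>b\<in>K. a \<noteq> b \<and> {a, b} \<notin> P"
  then obtain a b where ab: "a \<in> K" "b \<in> K" "a \<noteq> b" "{a, b} \<notin> P" by blast
  have KN: "K \<subseteq> {1..N}" using K(1) H by (rule subset_trans)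
  then have fK: "finite K" by (rule finite_subset) simp
  let ?E = "{i \<in> K \<times> K - Id. {fst i, snd i} \<notin> P}"
  have "sigma_prod ?q K = (\<Prod>i\<in>K \<times> K - Id. if {fst i, snd i} \<notin> P then 2 else 1)"
    unfolding sigma_prod_def
  proof (rule prod.cong[OF refl])
    fix i assume i: "i \<in> K \<times> K - Id"
    then have "fst i \<in> {1..N}" "snd i \<in> {1..N}" "fst i \<noteq> snd i" using KN by auto
    then show "(case i of (a, b) \<Rightarrow> ?q a b) = (if {fst i, snd i} \<notin> P then 2 else 1)"
      by (simp add: case_prod_unfold edge_params_apply)
  qed
  also have "\<dots> = 2 ^ card ?E" using fK by (intro prod_if_power) simp
  finally have eq: "sigma_prod ?q K = 2 ^ card ?E" .
  have "(a, b) \<in> ?E" using ab by auto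
  then have "card ?E \<noteq> 0" using fK by (auto simp: card_eq_0_iff)
  then have "norm ((2::complex) ^ card ?E) > 1" by (simp add: norm_power)
  then show "sigma_prod ?q K \<noteq> 1" unfolding eq by auto
qed

text \<open>By irreducibility the open set of the definition meets the one where the determinant is
  non-zero. So the generic rank is the number of classes, which is attained exactly at nondegenerate
  points.\<close>

lemma general_position_iff_nondeg:
  assumes H: "H \<subseteq> {1..N}" and P: "\<And>i j. {i, j} \<in> P \<Longrightarrow> i \<in> {1..N} \<and> j \<in> {1..N} \<and> i \<noteq> j"
    and q: "q \<in> constrained_params N P"
  shows "in_general_position N (constrained_params N P) (\<lambda>p. S_rank q H = S_rank p H) \<longleftrightarrow> nondeg P H q"
proof -
  let ?V = "constrained_params N P" and ?g = "\<lambda>p. det (red_mat P H p)"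
  have fH: "finite H" using H finite_subset by blast
  have g: "?g \<in> param_polys N" by (rule det_red_mat_param_poly[OF fH H])
  have unit: "unit_on P p" if "p \<in> ?V" for p using that by (simp add: constrained_params_iff)
  have nd: "nondeg P H p \<longleftrightarrow> ?g p \<noteq> 0" if "p \<in> ?V" for p
    using det_imp_nondeg[OF unit[OF that] fH] nondeg_imp_det[OF unit[OF that] fH] by blast
  have rk: "S_rank p H = length (reps P H) \<longleftrightarrow> ?g p \<noteq> 0" if "p \<in> ?V" for p
    using rank_iff_nondeg[OF unit[OF that] fH] nd[OF that] by simp
  show ?thesis
  proof
    assume "in_general_position N ?V (\<lambda>p. S_rank q H = S_rank p H)"
    then obtain f p where f: "f \<in> param_polys N" "p \<in> ?V" "f p \<noteq> 0"
      "\<forall>p\<in>?V. f p \<noteq> 0 \<longrightarrow> S_rank q H = S_rank p H"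
      unfolding in_general_position_def by blast
    let ?p = "edge_params N P (\<lambda>_ _. 2)"
    have p0: "?p \<in> ?V" using edge_params_constrained[OF P, where f = "\<lambda>_ _. 2"] by simp
    have "?g ?p \<noteq> 0" using nondeg_edge_params[OF H P] nd[OF p0] by simp
    then obtain r where "r \<in> ?V" "f r \<noteq> 0" "?g r \<noteq> 0"
      using constrained_irreducible[OF P f(1) g f(2,3) p0] by blast
    then show "nondeg P H q" using f(4) rk nd q by metis
  next
    assume "nondeg P H q"
    then have gq: "?g q \<noteq> 0" using nd q by blast
    show "in_general_position N ?V (\<lambda>p. S_rank q H = S_rank p H)"
      unfolding in_general_position_def
    proof (rule bexI[OF _ g], intro conjI ballI impI)
      show "\<exists>p\<in>?V. ?g p \<noteq> 0" using gq q by blast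
      show "S_rank q H = S_rank p H" if "p \<in> ?V" "?g p \<noteq> 0" for p
        using rk[OF that(1)] rk[OF q] that(2) gq by simp
    qed
  qed
qed

lemma boundary_imp_not_separable:
  assumes P: "\<And>i j. {i, j} \<in> P \<Longrightarrow> i \<in> {1..N} \<and> j \<in> {1..N} \<and> i \<noteq> j"
    and G: "G \<subseteq> {1..N}" "G \<noteq> {}" and q: "q \<in> primitive_boundary N P G"
  shows "\<not> separable P G"
proof
  assume "separable P G"
  then obtain A B v where AB: "A \<union> B = G" "A \<noteq> G" "B \<noteq> G" "A \<inter> B \<subseteq> {v}"
    "\<And>a b. a \<in> A - B \<Longrightarrow> b \<in> B - A \<Longrightarrow> {a, b} \<in> P"
    unfolding separable_def by blast
  have qV: "q \<in> constrained_params N P" using q by (simp add: primitive_boundary_def)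
  interpret unit_setting N P q
    using P qV by unfold_locales (auto simp: constrained_params_iff)
  have nd: "nondeg P H q" if "H \<subset> G" for H
    using that q G general_position_iff_nondeg[OF _ P qV, of H] unfolding primitive_boundary_def by blast
  have fG: "finite G" using G finite_subset by blast
  have "A \<subset> G" "B \<subset> G" using AB by auto
  moreover have "finite A" "finite B" using fG AB(1) by auto
  ultimately have "nondeg P (A \<union> B) q"
    using AB nd by (intro nondeg_union[OF unit]) auto
  then have "nondeg P G q" using AB(1) by simp
  then show False
    using nondeg_imp_no_constant[OF fG G] q unfolding primitive_boundary_def by blast
qed

lemma not_separable_imp_boundary:
  assumes P: "\<And>i j. {i, j} \<in> P \<Longrightarrow> i \<in> G \<and> j \<in> G \<and> i \<noteq> j"
    and G: "G \<subseteq> {1..N}" and C: "bipolar P s t C" "set C = G" and st: "s \<noteq> t" "{s, t} \<notin> P"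
  shows "primitive_boundary N P G \<noteq> {}"
proof -
  have fG: "finite G" using G finite_subset by blast
  have PN: "i \<in> {1..N} \<and> j \<in> {1..N} \<and> i \<noteq> j" if "{i, j} \<in> P" for i j using P[OF that] G by blast
  have stG: "s \<in> G" "t \<in> G" using C by (auto simp: bipolar_def)
  \<comment> \<open>The largest value that \<open>degenerate_criterion\<close> admits.\<close>
  define d :: real where "d = 1 / (8 * 2 ^ length C * fact (length C))"
  have "(1::real) * 1 \<le> 2 ^ length C * fact (length C)" by (intro mult_mono) simp_all
  then have d: "0 < d" "d < 1" "8 * 2 ^ length C * fact (length C) * d \<le> 1"
    by (simp_all add: d_def field_simps)
  \<comment> \<open>\<open>E H\<close> collects ordered pairs, as \<open>sigma_prod\<close> does.
    The value \<open>b\<close> from \<open>s\<close> to \<open>t\<close> compensates all factors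
    \<open>d\<close> on \<open>G\<close>.\<close>
  define E where "E H = {i \<in> H \<times> H - Id. {fst i, snd i} \<notin> P \<and> {fst i, snd i} \<noteq> {s, t}}" for H
  define b :: complex where "b = inverse (complex_of_real d ^ card (E G))"
  define f :: params where "f = (\<lambda>i j. if (i, j) = (s, t) then b else if (i, j) = (t, s) then 1 else complex_of_real d)"
  define q where "q = edge_params N P f"
  define p where "p = edge_params N P (\<lambda>_ _. 2)"
  have fnz: "f i j \<noteq> 0" for i j using d(1) by (simp add: f_def b_def)
  have qV: "q \<in> constrained_params N P"
    unfolding q_def using PN fnz by (rule edge_params_constrained)
  have pV: "p \<in> constrained_params N P"
    unfolding p_def by (rule edge_params_constrained[OF PN]) simp_all
  interpret unit_setting N P q
    using PN qV by unfold_locales (auto simp: constrained_params_iff)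
  interpret p: unit_setting N P p
    using PN pV by unfold_locales (auto simp: constrained_params_iff)
  have one: "q i j = 1" "p i j = 1" if "{i, j} \<in> P" for i j
    using PN[OF that] that by (simp_all add: q_def p_def edge_params_apply)
  have finE: "finite (E H)" if "H \<subseteq> G" for H
    using that fG finite_subset[of H G] by (simp add: E_def)
  have sig: "sigma_prod q H = complex_of_real d ^ card (E H) * (if s \<in> H \<and> t \<in> H then b else 1)" if H: "H \<subseteq> G" for H
  proof -
    have fH: "finite H" using H fG finite_subset by blast
    have "sigma_prod q H = (\<Prod>i\<in>H \<times> H - Id. (if {fst i, snd i} \<notin> P \<and> {fst i, snd i} \<noteq> {s, t} then complex_of_real d else 1) *
        (if i = (s, t) then b else 1))"
      unfolding sigma_prod_def
    proof (rule prod.cong[OF refl])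
      fix i assume i: "i \<in> H \<times> H - Id"
      then have "fst i \<in> {1..N}" "snd i \<in> {1..N}" "fst i \<noteq> snd i" using H G by auto
      then show "(case i of (a, b) \<Rightarrow> q a b) = (if {fst i, snd i} \<notin> P \<and> {fst i, snd i} \<noteq> {s, t} then complex_of_real d else 1) *
        (if i = (s, t) then b else 1)"
        using st by (cases i) (auto simp: q_def f_def edge_params_apply doubleton_eq_iff insert_commute)
    qed
    also have "\<dots> = complex_of_real d ^ card (E H) * (\<Prod>i\<in>H \<times> H - Id. if i = (s, t) then b else 1)"
      unfolding prod.distrib E_def using fH by (subst prod_if_power) simp_all
    also have "(\<Prod>i\<in>H \<times> H - Id. if i = (s, t) then b else 1) = (if s \<in> H \<and> t \<in> H then b else 1)"
      using fH st(1) by (simp add: prod.delta)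
    finally show ?thesis .
  qed
  have power: "complex_of_real d ^ k \<noteq> complex_of_real d ^ l" if "k < l" for k l
  proof -
    have "d ^ l < d ^ k" using that d by (intro power_strict_decreasing)
    then show ?thesis by (simp flip: of_real_power)
  qed
  have nd: "nondeg P H q" if H: "H \<subset> G" for H
  proof (rule nondeg_criterion[OF unit])
    show "finite H" using H fG finite_subset by blast
    fix K assume K: "K \<subseteq> H" "\<exists>a\<in>K. \<exists>b\<in>K. a \<noteq> b \<and> {a, b} \<notin> P"
    have KG: "K \<subseteq> G" "K \<noteq> G" using K(1) H by auto
    show "sigma_prod q K \<noteq> 1"
    proof (cases "s \<in> K \<and> t \<in> K")
      case True
      \<comment> \<open>The missing vertex \<open>c\<close> has an earlier neighbour
        \<open>e\<close>. This edge differs from the one between \<open>s\<close> and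
        \<open>t\<close> and is not counted in \<open>K\<close>, so \<open>b\<close>
        overcompensates.\<close>
      obtain c where c: "c \<in> G" "c \<notin> K" using KG by blast
      then have "c \<noteq> s" "c \<noteq> t" using True by auto
      then obtain e where e: "(e, c) \<in> ords C" "{e, c} \<notin> P"
        using C c(1) unfolding bipolar_def by blast
      have "e \<in> G" "e \<noteq> c"
        using e(1) ords_subset[of C] C ords_asym[of C e c] by (auto simp: bipolar_def)
      then have "(e, c) \<in> E G" "(e, c) \<notin> E K"
        using e c \<open>c \<noteq> s\<close> \<open>c \<noteq> t\<close> by (auto simp: E_def doubleton_eq_iff)
      moreover have "E K \<subseteq> E G" using KG by (auto simp: E_def)
      ultimately have "card (E K) < card (E G)"
        using finE[of G] by (intro psubset_card_mono) auto
      then show ?thesis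
        using power d(1) True by (simp add: sig[OF KG(1)] b_def field_simps)
    next
      case False
      \<comment> \<open>Without both \<open>s\<close> and \<open>t\<close>, the edge in
        \<open>K\<close> is one with parameter \<open>d\<close>, and no factor \<open>b\<close>
        occurs.\<close>
      then have "E K \<noteq> {}" using K(2) by (fastforce simp: E_def doubleton_eq_iff)
      then have "0 < card (E K)" using finE[OF KG(1)] by (simp add: card_gt_0_iff)
      then show ?thesis using power[of 0 "card (E K)"] False by (auto simp: sig[OF KG(1)])
    qed
  qed
  have "\<not> nondeg P (set C) q"
  proof (rule degenerate_criterion[OF C(1) st(1) one(1) _ d(1,3)])
    show "sigma_prod q (set C) = 1"
      using d(1) stG by (simp add: C(2) sig b_def)
    show "q a b = complex_of_real d"
      if "a \<in> set C" "b \<in> set C" "a \<noteq> b" "{a, b} \<notin> P" "{a, b} \<noteq> {s, t}" for a b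
      using that C(2) G subsetD[OF G] by (auto simp: q_def f_def edge_params_apply)
    show "nondeg P H q" if "H \<subset> set C" for H using that nd C(2) by simp
  qed
  then obtain y D where y: "\<And>E. E \<in> Om G \<Longrightarrow> S_app G q y E = 0" and D: "D \<in> Om G" "psi P G q y D \<noteq> 0"
    unfolding nondeg_def C(2) by blast
  obtain x where x: "x \<in> homog G" "\<And>E. E \<in> Om G \<Longrightarrow> Poly_Mapping.lookup x E = y E"
    using elt_of_function[OF fG] by blast
  have Sx: "S_app G q (Poly_Mapping.lookup x) E = 0" if "E \<in> Om G" for E
    using y[OF that] x(2) by (simp add: S_app_def)
  \<comment> \<open>Within a class only parameters of pairs in \<open>P\<close> enter, and these are
    1 at both points.\<close>
  have psi: "psi P G p (Poly_Mapping.lookup x) D = psi P G q y D"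
    unfolding psi_def
  proof (rule sum.cong[OF refl])
    fix E assume "E \<in> {E \<in> Om G. cls P E = cls P D}"
    then have E: "E \<in> Om G" "cls P D = cls P E" by auto
    have "{a, b} \<in> P" if "(a, b) \<in> invs D E" for a b
      using E(2) that unfolding cls_eq_iff[OF D(1) E(1)] by blast
    then have "wt p D E = wt q D E" using one by (intro wt_cong) simp
    then show "wt p D E * Poly_Mapping.lookup x E = wt q D E * y E"
      using x(2)[OF E(1)] by simp
  qed
  \<comment> \<open>The ideal only involves the parameters of pairs in \<open>P\<close>, so non-membership may be tested at \<open>p\<close>,
    where \<open>S\<close> is nondegenerate in degree \<open>G\<close>.\<close>
  have "comm_ideal N P q = comm_ideal N P p"
  proof -
    have "comm_gen q i j = comm_gen p i j" if "{i, j} \<in> P" for i j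
      using one[of j i] that by (simp add: comm_gen_def insert_commute)
    then have "{comm_gen q i j | i j. {i, j} \<in> P} = {comm_gen p i j | i j. {i, j} \<in> P}"
      by (intro Collect_cong) metis
    then show ?thesis by (simp add: comm_ideal_eq)
  qed
  moreover have "x \<notin> comm_ideal N P p"
  proof
    assume "x \<in> comm_ideal N P p"
    then have "S_app G p (Poly_Mapping.lookup x) E = 0" if "E \<in> Om G" for E
      using p.I_S_app_zero[OF _ x(1) that] by blast
    moreover have "nondeg P G p" unfolding p_def by (rule nondeg_edge_params[OF G PN])
    ultimately have "psi P G p (Poly_Mapping.lookup x) D = 0"
      using D(1) unfolding nondeg_def by (elim allE[of _ "Poly_Mapping.lookup x"]) simp
    then show False using psi D(2) by simp
  qed
  ultimately have "x \<notin> comm_ideal N P q" by simp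
  moreover have "nondeg P (G - {i}) q" if "i \<in> G" for i
    using nd[of "G - {i}"] that by blast
  ultimately have "\<exists>X\<in>quot_constants N P q G. X \<noteq> quot_class N P q G 0"
    using kernel_imp_constant[OF fG G x(1) _ Sx] by blast
  moreover have "in_general_position N (constrained_params N P) (\<lambda>p. S_rank q H = S_rank p H)" if "H \<subset> G" for H
    using general_position_iff_nondeg[OF _ PN qV, of H] nd[OF that] that G by auto
  ultimately show ?thesis using qV unfolding primitive_boundary_def by blast
qed

theorem theorem4p2:
  fixes n N :: nat and P :: "nat set set"
  assumes "2 < n" and "n \<le> N"
    and "P \<subseteq> {{i, j} | i j. i \<in> {1..n} \<and> j \<in> {1..n} \<and> i \<noteq> j}"
    and "{1, n} \<notin> P"
  shows "primitive_boundary N P {1..n} \<noteq> {} \<longleftrightarrow>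
    (\<forall>i. 1 < i \<and> i < n \<longrightarrow>
      (\<exists>xs. distinct xs \<and> set xs \<subseteq> {1..n} \<and> xs \<noteq> [] \<and> hd xs = 1 \<and> last xs = n \<and> i \<in> set xs \<and>
        (\<forall>k. Suc k < length xs \<longrightarrow> {xs ! k, xs ! Suc k} \<notin> P)))"
proof -
  let ?G = "{1..n}"
  have P: "i \<in> ?G \<and> j \<in> ?G \<and> i \<noteq> j" if "{i, j} \<in> P" for i j
  proof -
    from subsetD[OF assms(3) that] obtain a b
      where "{i, j} = {a, b}" and ab: "a \<in> ?G" "b \<in> ?G" "a \<noteq> b"
      by (elim CollectE exE conjE)
    then have "i = a \<and> j = b \<or> i = b \<and> j = a" by (simp only: doubleton_eq_iff)
    then show ?thesis using ab by metis
  qed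
  have GN: "?G \<subseteq> {1..N}" "?G \<noteq> {}" using assms(1,2) by auto
  have PN: "i \<in> {1..N} \<and> j \<in> {1..N} \<and> i \<noteq> j" if "{i, j} \<in> P" for i j using P[OF that] GN by blast
  have st: "1 \<in> ?G" "n \<in> ?G" "1 \<noteq> n" using assms(1) by auto
  note succ = successively_conv_nth[of "\<lambda>a b. {a, b} \<notin> P"]
  show ?thesis
  proof
    assume "primitive_boundary N P ?G \<noteq> {}"
    then have "\<not> separable P ?G" using boundary_imp_not_separable[OF PN GN] by blast
    then obtain L where L: "bipolar P 1 n L" "set L = ?G"
      using bipolar_exists[OF _ st assms(4)] by blast
    show "\<forall>i. 1 < i \<and> i < n \<longrightarrow>
      (\<exists>xs. distinct xs \<and> set xs \<subseteq> {1..n} \<and> xs \<noteq> [] \<and> hd xs = 1 \<and> last xs = n \<and> i \<in> set xs \<and>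
        (\<forall>k. Suc k < length xs \<longrightarrow> {xs ! k, xs ! Suc k} \<notin> P))"
    proof (intro allI impI)
      fix i assume "1 < i \<and> i < n"
      then have "i \<in> set L" using L(2) by simp
      then obtain xs where "distinct xs" "set xs \<subseteq> ?G" "xs \<noteq> []" "hd xs = 1" "last xs = n" "i \<in> set xs"
        "successively (\<lambda>a b. {a, b} \<notin> P) xs"
        using bipolar_path[OF L(1)] L(2) by metis
      then show "\<exists>xs. distinct xs \<and> set xs \<subseteq> {1..n} \<and> xs \<noteq> [] \<and> hd xs = 1 \<and> last xs = n \<and> i \<in> set xs \<and>
        (\<forall>k. Suc k < length xs \<longrightarrow> {xs ! k, xs ! Suc k} \<notin> P)"
        unfolding succ by blast
    qed
  next
    assume paths: "\<forall>i. 1 < i \<and> i < n \<longrightarrow>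
      (\<exists>xs. distinct xs \<and> set xs \<subseteq> {1..n} \<and> xs \<noteq> [] \<and> hd xs = 1 \<and> last xs = n \<and> i \<in> set xs \<and>
        (\<forall>k. Suc k < length xs \<longrightarrow> {xs ! k, xs ! Suc k} \<notin> P))"
    have "\<not> separable P ?G"
    proof (rule paths_imp_not_separable[OF st(1,2) assms(4)])
      fix i assume i: "i \<in> ?G"
      show "\<exists>xs. distinct xs \<and> set xs \<subseteq> ?G \<and> xs \<noteq> [] \<and> hd xs = 1 \<and> last xs = n \<and> i \<in> set xs \<and>
        successively (\<lambda>a b. {a, b} \<notin> P) xs"
      proof (cases "1 < i \<and> i < n")
        case True
        then show ?thesis using paths unfolding succ by blast
      next
        case False
        then have "i = 1 \<or> i = n" using i by auto
        \<comment> \<open>For the end vertices the edge between 1 and \<open>n\<close> is itself the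
          path.\<close>
        then show ?thesis using st assms(4) by (intro exI[of _ "[1, n]"]) auto
      qed
    qed
    then obtain L where "bipolar P 1 n L" "set L = ?G"
      using bipolar_exists[OF _ st assms(4)] by blast
    then show "primitive_boundary N P ?G \<noteq> {}"
      using not_separable_imp_boundary[OF P GN(1)] st(3) assms(4) by blast
  qed
qed

end
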